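(* Let $\Omega=(a,b)$ with $a<b\in\mathbb{R}$. Let $\mu\in\mathcal M(\Omega)$ be nonnegative and such that $|\mu(E^1\cap\Omega)|\le P(E)$ for all measurable sets $E\subset\Omega$. Assume that $u\in BV(\Omega)$ and $T\in\mathcal{DM}^\infty(\Omega)$ satisfy $\|T\|_{L^\infty(\Omega)}\le1$, $\operatorname{div}T=\mu$ on $\Omega$, and $(T,Du)_\lambda=\sqrt{1+|Du|^2}-\sqrt{1-|T|^2}\,\mathcal L^1$ on $\Omega$ for $\lambda=\lambda_\mu$. Then $u$ is convex on $\Omega$, and therefore locally Lipschitz. In addition, if $u_1,u_2$ are weak solutions of the prescribed mean curvature measure equation with datum $\mu$ on $\Omega$ satisfying $u_1(a^+)=u_2(a^+)$ and $u_1(b^-)=u_2(b^-)$, then $u_1=u_2$ on $\Omega$.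
   Context: $\mathcal M(\Omega)$: finite signed Radon measures on $\Omega$. $E^1$ is the set of points of density $1$ of $E$, and $P(E)$ is the perimeter of $E$ in $\mathbb{R}$. $\mathcal{DM}^\infty(\Omega)$: $F\in L^\infty(\Omega)$ whose distributional derivative $\operatorname{div}F=DF$ is in $\mathcal M(\Omega)$. For $u\in BV(\Omega)$: $u^+\ge u^-$ denote the larger/smaller one-sided limit of $u$ at each point (equal at points of approximate continuity); for Borel $\lambda:\Omega\to[0,1]$, $u^\lambda=\lambda u^++(1-\lambda)u^-$. $Du=u'\mathcal L^1+D^su$ is the Lebesgue decomposition and $\sqrt{1+|Du|^2}=\sqrt{1+|u'|^2}\,\mathcal L^1+|D^su|$ as a measure. The $\lambda$-pairing is $(F,Du)_\lambda:=\operatorname{div}(uF)-u^\lambda\operatorname{div}F$. $\lambda_\mu=\chi_{\Omega_-}$ where $\{\Omega_+,\Omega_-\}$ is a Hahn decomposition for $\mu$; for $\mu\ge0$ one takes $\lambda_\mu\equiv0$, so $u^{\lambda_\mu}=u^-$. $u\in BV(\Omega)$ is a weak solution of the prescribed mean curvature measure equation with datum $\mu$ if there exist $T\in L^\infty(\Omega)$ and a Borel $\lambda:\Omega\to[0,1]$ with $\|T\|_{L^\infty(\Omega)}\le1$, $\operatorname{div}T=\mu$ on $\Omega$ and $(T,Du)_\lambda=\sqrt{1+|Du|^2}-\sqrt{1-|T|^2}\,\mathcal L^1$ on $\Omega$. $u(a^+)$, $u(b^-)$ are the one-sided limits at the endpoints. $BV$ functions are identified with their a.e. equivalence classes (convexity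 refers to a suitable representative). *)

theory Defs
  imports "HOL-Analysis.Analysis" "HOL-Probability.Essential_Supremum"
begin

section \<open>Finite signed measures on an open subset of the line\<close>

definition borel_subsets :: "real set \<Rightarrow> real set set" where
  "borel_subsets \<Omega> = {A \<in> sets borel. A \<subseteq> \<Omega>}"

text \<open>
  A finite signed Radon measure is a real-valued countably additive function on the Borel
  subsets of \<open>\<Omega>\<close> (on an open subset of the line, finite Borel measures are automatically Radon).
  It is set to \<open>0\<close> on all other sets, so that equality of measures is equality of functions.
\<close>

definition signed_measure :: "real set \<Rightarrow> (real set \<Rightarrow> real) \<Rightarrow> bool" where
  "signed_measure \<Omega> \<nu> \<longleftrightarrow>
     (\<forall>A. A \<notin> borel_subsets \<Omega> \<longrightarrow> \<nu> A = 0) \<and>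
     \<nu> {} = 0 \<and>
     (\<forall>A :: nat \<Rightarrow> real set. range A \<subseteq> borel_subsets \<Omega> \<longrightarrow> disjoint_family A \<longrightarrow>
        (\<lambda>i. \<nu> (A i)) sums \<nu> (\<Union>i. A i))"

text \<open>
  Jordan decomposition: \<open>\<nu>\<^sup>+(A)\<close> is the supremum of \<open>\<nu>(B)\<close> over Borel \<open>B \<subseteq> A\<close>
  (\<^const>\<open>ennreal\<close> sends negative values to \<open>0\<close>, which is already attained at \<open>B = {}\<close>),
  and \<open>\<nu>\<^sup>- = (-\<nu>)\<^sup>+\<close>.
\<close>

definition pos_part :: "real set \<Rightarrow> (real set \<Rightarrow> real) \<Rightarrow> real measure" where
  "pos_part \<Omega> \<nu> = measure_of \<Omega> (borel_subsets \<Omega>)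
     (\<lambda>A. SUP B\<in>{B \<in> borel_subsets \<Omega>. B \<subseteq> A}. ennreal (\<nu> B))"

definition neg_part :: "real set \<Rightarrow> (real set \<Rightarrow> real) \<Rightarrow> real measure" where
  "neg_part \<Omega> \<nu> = pos_part \<Omega> (\<lambda>A. - \<nu> A)"

definition total_variation :: "real set \<Rightarrow> (real set \<Rightarrow> real) \<Rightarrow> real set \<Rightarrow> real" where
  "total_variation \<Omega> \<nu> A = measure (pos_part \<Omega> \<nu>) A + measure (neg_part \<Omega> \<nu>) A"

definition signed_integral ::
    "real set \<Rightarrow> (real set \<Rightarrow> real) \<Rightarrow> real set \<Rightarrow> (real \<Rightarrow> real) \<Rightarrow> real" where
  "signed_integral \<Omega> \<nu> A f = (LINT x:A|pos_part \<Omega> \<nu>. f x) - (LINT x:A|neg_part \<Omega> \<nu>. f x)"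

definition hahn_decomposition ::
    "real set \<Rightarrow> (real set \<Rightarrow> real) \<Rightarrow> real set \<Rightarrow> real set \<Rightarrow> bool" where
  "hahn_decomposition \<Omega> \<nu> P N \<longleftrightarrow>
     P \<in> borel_subsets \<Omega> \<and> N \<in> borel_subsets \<Omega> \<and> P \<union> N = \<Omega> \<and> P \<inter> N = {} \<and>
     (\<forall>A\<in>borel_subsets \<Omega>. (A \<subseteq> P \<longrightarrow> 0 \<le> \<nu> A) \<and> (A \<subseteq> N \<longrightarrow> \<nu> A \<le> 0))"

text \<open>
  Hahn decompositions are unique only up to \<open>\<bar>\<nu>\<bar>\<close>-null sets; the convention is that the
  negative set is empty when \<open>\<nu> \<ge> 0\<close>.
\<close>

definition hahn_lambda :: "real set \<Rightarrow> (real set \<Rightarrow> real) \<Rightarrow> real \<Rightarrow> real" where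
  "hahn_lambda \<Omega> \<nu> =
     (if \<forall>A\<in>borel_subsets \<Omega>. 0 \<le> \<nu> A then (\<lambda>x. 0)
      else indicator (SOME N. \<exists>P. hahn_decomposition \<Omega> \<nu> P N))"

definition lebesgue_decomposition ::
    "real set \<Rightarrow> (real set \<Rightarrow> real) \<Rightarrow> (real \<Rightarrow> real) \<Rightarrow> (real set \<Rightarrow> real) \<Rightarrow> bool" where
  "lebesgue_decomposition \<Omega> \<nu> g \<sigma> \<longleftrightarrow>
     integrable (lebesgue_on \<Omega>) g \<and>
     signed_measure \<Omega> \<sigma> \<and>
     (\<exists>N\<in>borel_subsets \<Omega>. N \<in> null_sets lborel \<and>
        (\<forall>A\<in>borel_subsets \<Omega>. \<sigma> A = \<sigma> (A \<inter> N))) \<and>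
     (\<forall>A\<in>borel_subsets \<Omega>. \<nu> A = (LINT x:A|lebesgue. g x) + \<sigma> A)"

definition ac_density :: "real set \<Rightarrow> (real set \<Rightarrow> real) \<Rightarrow> real \<Rightarrow> real" where
  "ac_density \<Omega> \<nu> = (SOME g. \<exists>\<sigma>. lebesgue_decomposition \<Omega> \<nu> g \<sigma>)"

definition singular_part :: "real set \<Rightarrow> (real set \<Rightarrow> real) \<Rightarrow> real set \<Rightarrow> real" where
  "singular_part \<Omega> \<nu> = (THE \<sigma>. \<exists>g. lebesgue_decomposition \<Omega> \<nu> g \<sigma>)"


section \<open>Distributional derivatives and function spaces\<close>

definition test_functions :: "real set \<Rightarrow> (real \<Rightarrow> real) set" where
  "test_functions \<Omega> = {\<phi>. \<phi> C1_differentiable_on UNIV \<and>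
     compact (closure {x. \<phi> x \<noteq> 0}) \<and> closure {x. \<phi> x \<noteq> 0} \<subseteq> \<Omega>}"

text \<open>
  Since \<open>\<nu>\<close> is a measure, testing with \<open>C\<^sub>c\<^sup>1\<close> or with \<open>C\<^sub>c\<^sup>\<infinity>\<close> functions makes no difference.
\<close>

definition has_distr_deriv ::
    "real set \<Rightarrow> (real \<Rightarrow> real) \<Rightarrow> (real set \<Rightarrow> real) \<Rightarrow> bool" where
  "has_distr_deriv \<Omega> F \<nu> \<longleftrightarrow>
     (\<forall>K. compact K \<longrightarrow> K \<subseteq> \<Omega> \<longrightarrow> integrable (lebesgue_on K) F) \<and>
     signed_measure \<Omega> \<nu> \<and>
     (\<forall>\<phi>\<in>test_functions \<Omega>.
        (LINT x:\<Omega>|lebesgue. F x * deriv \<phi> x) = - signed_integral \<Omega> \<nu> \<Omega> \<phi>)"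

definition distr_deriv :: "real set \<Rightarrow> (real \<Rightarrow> real) \<Rightarrow> real set \<Rightarrow> real" where
  "distr_deriv \<Omega> F = (THE \<nu>. has_distr_deriv \<Omega> F \<nu>)"

definition Linf_norm :: "real set \<Rightarrow> (real \<Rightarrow> real) \<Rightarrow> ereal" where
  "Linf_norm \<Omega> F = esssup (lebesgue_on \<Omega>) (\<lambda>x. ereal \<bar>F x\<bar>)"

definition Linf :: "real set \<Rightarrow> (real \<Rightarrow> real) set" where
  "Linf \<Omega> = {F. F \<in> borel_measurable (lebesgue_on \<Omega>) \<and> Linf_norm \<Omega> F < \<infinity>}"

definition DM_inf :: "real set \<Rightarrow> (real \<Rightarrow> real) set" where
  "DM_inf \<Omega> = {F \<in> Linf \<Omega>. \<exists>\<nu>. has_distr_deriv \<Omega> F \<nu>}"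

definition BV :: "real set \<Rightarrow> (real \<Rightarrow> real) set" where
  "BV \<Omega> = {u. integrable (lebesgue_on \<Omega>) u \<and> (\<exists>\<nu>. has_distr_deriv \<Omega> u \<nu>)}"

text \<open>
  One-sided limits of an a.e. equivalence class: intersecting the filter with
  \<^term>\<open>ae_filter lebesgue\<close> allows null sets to be discarded.
\<close>

definition right_limit :: "(real \<Rightarrow> real) \<Rightarrow> real \<Rightarrow> real" where
  "right_limit u x = Lim (inf (at_right x) (ae_filter lebesgue)) u"

definition left_limit :: "(real \<Rightarrow> real) \<Rightarrow> real \<Rightarrow> real" where
  "left_limit u x = Lim (inf (at_left x) (ae_filter lebesgue)) u"

definition u_upper :: "(real \<Rightarrow> real) \<Rightarrow> real \<Rightarrow> real" where
  "u_upper u x = max (left_limit u x) (right_limit u x)"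

definition u_lower :: "(real \<Rightarrow> real) \<Rightarrow> real \<Rightarrow> real" where
  "u_lower u x = min (left_limit u x) (right_limit u x)"

definition u_lambda :: "(real \<Rightarrow> real) \<Rightarrow> (real \<Rightarrow> real) \<Rightarrow> real \<Rightarrow> real" where
  "u_lambda lam u x = lam x * u_upper u x + (1 - lam x) * u_lower u x"


section \<open>Perimeter and density\<close>

definition perimeter :: "real set \<Rightarrow> ereal" where
  "perimeter E = (SUP \<phi>\<in>{\<phi> \<in> test_functions UNIV. \<forall>x. \<bar>\<phi> x\<bar> \<le> 1}.
     ereal (LINT x:E|lebesgue. deriv \<phi> x))"

definition density_one :: "real set \<Rightarrow> real set" where
  "density_one E = {x. ((\<lambda>r. measure lebesgue (E \<inter> {x - r<..<x + r}) / (2 * r)) \<longlongrightarrow> 1) (at_right 0)}"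


section \<open>The prescribed mean curvature measure equation\<close>

definition pairing ::
    "real set \<Rightarrow> (real \<Rightarrow> real) \<Rightarrow> (real \<Rightarrow> real) \<Rightarrow> (real \<Rightarrow> real) \<Rightarrow> real set \<Rightarrow> real" where
  "pairing \<Omega> F u lam A =
     distr_deriv \<Omega> (\<lambda>x. u x * F x) A - signed_integral \<Omega> (distr_deriv \<Omega> F) A (u_lambda lam u)"

definition area_measure :: "real set \<Rightarrow> (real \<Rightarrow> real) \<Rightarrow> real set \<Rightarrow> real" where
  "area_measure \<Omega> u A =
     (LINT x:A|lebesgue. sqrt (1 + (ac_density \<Omega> (distr_deriv \<Omega> u) x)\<^sup>2)) +
     total_variation \<Omega> (singular_part \<Omega> (distr_deriv \<Omega> u)) A"

definition pairing_equation ::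
    "real set \<Rightarrow> (real \<Rightarrow> real) \<Rightarrow> (real \<Rightarrow> real) \<Rightarrow> (real \<Rightarrow> real) \<Rightarrow> bool" where
  "pairing_equation \<Omega> T u lam \<longleftrightarrow>
     (\<forall>A\<in>borel_subsets \<Omega>.
        pairing \<Omega> T u lam A =
          area_measure \<Omega> u A - (LINT x:A|lebesgue. sqrt (1 - \<bar>T x\<bar>\<^sup>2)))"

definition weak_solution :: "real set \<Rightarrow> (real set \<Rightarrow> real) \<Rightarrow> (real \<Rightarrow> real) \<Rightarrow> bool" where
  "weak_solution \<Omega> \<mu> u \<longleftrightarrow>
     u \<in> BV \<Omega> \<and>
     (\<exists>T lam. T \<in> Linf \<Omega> \<and> Linf_norm \<Omega> T \<le> 1 \<and> has_distr_deriv \<Omega> T \<mu> \<and>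
        lam \<in> borel_measurable (restrict_space borel \<Omega>) \<and> (\<forall>x\<in>\<Omega>. 0 \<le> lam x \<and> lam x \<le> 1) \<and>
        pairing_equation \<Omega> T u lam)"

definition locally_lipschitz :: "real set \<Rightarrow> (real \<Rightarrow> real) \<Rightarrow> bool" where
  "locally_lipschitz \<Omega> v \<longleftrightarrow> (\<forall>x\<in>\<Omega>. \<exists>e>0. \<exists>L. L-lipschitz_on (cball x e \<inter> \<Omega>) v)"

end

theory Submission
  imports Defs "HOL-Probability.Distribution_Functions" "HOL-Real_Asymp.Real_Asymp"
begin

text \<open>
  Up to null sets, \<open>T = c + \<mu>(a, x]\<close> is nondecreasing and \<open>u = d + Du(a, x]\<close>. The Leibniz rule for
  Stieltjes measures turns the \<open>\<lambda>\<close>-pairing into \<open>V Du\<close>, where \<open>V\<close> is everywhere a convex combination of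
  the one-sided limits of \<open>T\<close>. On the absolutely continuous part the equation reads
  \<open>T u' + \<surd>(1 - T\<^sup>2) = \<surd>(1 + u'\<^sup>2)\<close>, the equality case of Cauchy-Schwarz, so \<open>\<bar>T\<bar> < 1\<close> and
  \<open>u' = T / \<surd>(1 - T\<^sup>2)\<close> almost everywhere. By monotonicity \<open>\<bar>V\<bar> < 1\<close> everywhere, and then
  \<open>V D\<^sup>su = \<bar>D\<^sup>su\<bar>\<close> forces \<open>D\<^sup>su = 0\<close>, whatever \<open>\<lambda>\<close> is. Hence \<open>u'\<close> is a strictly increasing
  function of the nondecreasing \<open>T\<close>, which gives convexity. Two fields \<open>T\<close> for the same \<open>\<mu>\<close> differ by
  a constant, and equal boundary values of \<open>u\<close> force this constant to vanish.
\<close>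

section \<open>Jordan decomposition of a signed measure\<close>

text \<open>The strict bound \<open>|T| < 1\<close> is read off the absolutely continuous part, so
  it holds only almost everywhere, whereas the singular part of \<open>Du\<close> lives on a null
  set, possibly on atoms of \<open>\<mu>\<close>. Monotonicity closes this gap: every point of the
  interval has good points on both sides, and their values confine both one-sided limits of
  \<open>T\<close>, hence \<open>V\<close>, strictly between -1 and 1. Common atoms of
  \<open>Du\<close> and \<open>\<mu>\<close> dictate the form of the Leibniz rule. If the
  \<lambda>-representative of \<open>u\<close> puts weights \<open>\<kappa>\<close> and
  \<open>1 - \<kappa>\<close> on its left and right limits, then \<open>T\<close> must receive the
  complementary weights \<open>1 - \<kappa>\<close> and \<open>\<kappa>\<close>. This is why
  \<open>V\<close> stays a convex combination for every \<lambda>. Signed measures are handled as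
  differences of finite Borel measures on the whole line, where distribution functions and Fubini
  apply. One such pair for \<open>\<mu>\<close> is fixed before any solution is considered, so that
  a solution is described by two numbers: the constant in \<open>T\<close> and the constant in
  \<open>u\<close>.\<close>

lemma borel_subsets_iff: "A \<in> borel_subsets \<Omega> \<longleftrightarrow> A \<in> sets borel \<and> A \<subseteq> \<Omega>"
  by (simp add: borel_subsets_def)

lemma borel_subsets_UN: "range A \<subseteq> borel_subsets \<Omega> \<Longrightarrow> (\<Union>i::nat. A i) \<in> borel_subsets \<Omega>"
  by (auto simp: borel_subsets_def intro!: sets.countable_UN)

lemma borel_subsets_Un: "A \<in> borel_subsets \<Omega> \<Longrightarrow> B \<in> borel_subsets \<Omega> \<Longrightarrow> A \<union> B \<in> borel_subsets \<Omega>"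
  by (auto simp: borel_subsets_def)

lemma borel_subsets_Int: "A \<in> borel_subsets \<Omega> \<Longrightarrow> B \<in> sets borel \<Longrightarrow> A \<inter> B \<in> borel_subsets \<Omega>"
  by (auto simp: borel_subsets_def)

lemma borel_subsets_Diff: "A \<in> borel_subsets \<Omega> \<Longrightarrow> B \<in> sets borel \<Longrightarrow> A - B \<in> borel_subsets \<Omega>"
  by (auto simp: borel_subsets_def)

lemma empty_in_borel_subsets [simp]: "{} \<in> borel_subsets \<Omega>"
  by (auto simp: borel_subsets_def)

lemma sigma_algebra_borel_subsets:
  assumes "\<Omega> \<in> sets borel"
  shows "sigma_algebra \<Omega> (borel_subsets \<Omega>)"
  unfolding sigma_algebra_iff2 using assms
  by (auto simp: borel_subsets_def intro!: sets.countable_UN)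

lemma signed_measure_sums:
  assumes "signed_measure \<Omega> \<nu>" "\<And>i. A i \<in> borel_subsets \<Omega>" "disjoint_family A"
  shows "(\<lambda>i. \<nu> (A i)) sums \<nu> (\<Union>i. A i)"
proof -
  have "range A \<subseteq> borel_subsets \<Omega>" using assms(2) by (rule image_subsetI)
  with assms(1,3) show ?thesis unfolding signed_measure_def by simp
qed

lemma signed_measure_empty: "signed_measure \<Omega> \<nu> \<Longrightarrow> \<nu> {} = 0"
  by (simp add: signed_measure_def)

lemma signed_measure_Un:
  assumes \<nu>: "signed_measure \<Omega> \<nu>" and A: "A \<in> borel_subsets \<Omega>" and B: "B \<in> borel_subsets \<Omega>"
    and AB: "A \<inter> B = {}"
  shows "\<nu> (A \<union> B) = \<nu> A + \<nu> B"
proof -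
  have "(\<lambda>i. \<nu> (binaryset A B i)) sums \<nu> (\<Union>i. binaryset A B i)"
    by (rule signed_measure_sums[OF \<nu>])
      (use A B AB in \<open>auto simp: disjoint_family_on_def binaryset_def\<close>)
  moreover have "(\<lambda>i. \<nu> (binaryset A B i)) sums (\<nu> A + \<nu> B)"
    by (rule binaryset_sums) (use \<nu> in \<open>simp add: signed_measure_def\<close>)
  ultimately show ?thesis
    using UN_binaryset_eq sums_unique2 by metis
qed

lemma signed_measure_split:
  assumes \<nu>: "signed_measure \<Omega> \<nu>" and A: "A \<in> borel_subsets \<Omega>" and B: "B \<in> sets borel"
  shows "\<nu> A = \<nu> (A \<inter> B) + \<nu> (A - B)"
  using signed_measure_Un[OF \<nu> borel_subsets_Int[OF A B] borel_subsets_Diff[OF A B]]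
  by (simp add: Int_Diff_Un Int_Diff_disjoint)

definition unbounded_on :: "real set \<Rightarrow> (real set \<Rightarrow> real) \<Rightarrow> real set \<Rightarrow> bool" where
  "unbounded_on \<Omega> \<nu> A \<longleftrightarrow> (\<forall>C. \<exists>B\<in>borel_subsets \<Omega>. B \<subseteq> A \<and> C \<le> \<bar>\<nu> B\<bar>)"

lemma not_unbounded_onE:
  assumes "\<not> unbounded_on \<Omega> \<nu> A"
  obtains C where "\<And>B. B \<in> borel_subsets \<Omega> \<Longrightarrow> B \<subseteq> A \<Longrightarrow> \<bar>\<nu> B\<bar> < C"
proof -
  from assms obtain C where "\<forall>B\<in>borel_subsets \<Omega>. B \<subseteq> A \<longrightarrow> \<not> C \<le> \<bar>\<nu> B\<bar>"
    unfolding unbounded_on_def by blast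
  then show ?thesis by (intro that[of C]) (auto simp: not_le)
qed

text \<open>Choose \<open>E\<close> inside \<open>A\<close> with measure exceeding
  \<open>|\<nu> A| + 1\<close> in absolute value. By additivity both \<open>E\<close> and
  \<open>A - E\<close> then have measure at least 1 in absolute value, and bounds on both halves
  would add up to a bound on \<open>A\<close>, so one half stays unbounded and serves as
  \<open>B\<close>.\<close>

lemma unbounded_on_step:
  assumes \<nu>: "signed_measure \<Omega> \<nu>" and A: "A \<in> borel_subsets \<Omega>" and u: "unbounded_on \<Omega> \<nu> A"
  shows "\<exists>B\<in>borel_subsets \<Omega>. B \<subseteq> A \<and> unbounded_on \<Omega> \<nu> B \<and> 1 \<le> \<bar>\<nu> (A - B)\<bar>"
proof -
  obtain E where E: "E \<in> borel_subsets \<Omega>" "E \<subseteq> A" "\<bar>\<nu> A\<bar> + 1 \<le> \<bar>\<nu> E\<bar>"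
    using u unfolding unbounded_on_def by blast
  have bE: "E \<in> sets borel" using E by (simp add: borel_subsets_def)
  have AE: "A - E \<in> borel_subsets \<Omega>" using A bE by (rule borel_subsets_Diff)
  have sp: "\<nu> A = \<nu> E + \<nu> (A - E)"
    using signed_measure_split[OF \<nu> A bE] E(2) by (simp add: Int_absorb1)
  have "unbounded_on \<Omega> \<nu> E \<or> unbounded_on \<Omega> \<nu> (A - E)"
  proof (rule ccontr)
    assume "\<not> ?thesis"
    then have nu: "\<not> unbounded_on \<Omega> \<nu> E" "\<not> unbounded_on \<Omega> \<nu> (A - E)" by auto
    obtain C where C: "\<And>B. B \<in> borel_subsets \<Omega> \<Longrightarrow> B \<subseteq> E \<Longrightarrow> \<bar>\<nu> B\<bar> < C"
      using nu(1) by (rule not_unbounded_onE) blast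
    obtain D where D: "\<And>B. B \<in> borel_subsets \<Omega> \<Longrightarrow> B \<subseteq> A - E \<Longrightarrow> \<bar>\<nu> B\<bar> < D"
      using nu(2) by (rule not_unbounded_onE) blast
    obtain B where B: "B \<in> borel_subsets \<Omega>" "B \<subseteq> A" "C + D \<le> \<bar>\<nu> B\<bar>"
      using u unfolding unbounded_on_def by blast
    have "\<nu> B = \<nu> (B \<inter> E) + \<nu> (B - E)" by (rule signed_measure_split[OF \<nu> B(1) bE])
    moreover have "\<bar>\<nu> (B \<inter> E)\<bar> < C" by (rule C) (use B bE borel_subsets_Int in auto)
    moreover have "\<bar>\<nu> (B - E)\<bar> < D" by (rule D) (use B bE borel_subsets_Diff in auto)
    ultimately show False using B(3) by linarith
  qed
  then show ?thesis
  proof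
    assume "unbounded_on \<Omega> \<nu> E"
    moreover have "1 \<le> \<bar>\<nu> (A - E)\<bar>" using sp E(3) by linarith
    ultimately show ?thesis using E by blast
  next
    assume "unbounded_on \<Omega> \<nu> (A - E)"
    moreover have "1 \<le> \<bar>\<nu> (A - (A - E))\<bar>" using E by (simp add: double_diff)
    ultimately show ?thesis using AE by blast
  qed
qed

text \<open>Countable additivity with real values already forces boundedness: otherwise the halving
  step yields a decreasing chain whose successive differences are disjoint and have measure at least
  1 in absolute value. This is what makes the positive part a finite measure.\<close>

lemma signed_measure_bounded:
  assumes \<Omega>: "\<Omega> \<in> sets borel" and \<nu>: "signed_measure \<Omega> \<nu>"
  obtains C where "\<And>B. B \<in> borel_subsets \<Omega> \<Longrightarrow> \<bar>\<nu> B\<bar> \<le> C"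
proof -
  have "\<not> unbounded_on \<Omega> \<nu> \<Omega>"
  proof
    assume u: "unbounded_on \<Omega> \<nu> \<Omega>"
    have "\<exists>A. \<forall>n. (A n \<in> borel_subsets \<Omega> \<and> unbounded_on \<Omega> \<nu> (A n)) \<and>
        (A (Suc n) \<subseteq> A n \<and> 1 \<le> \<bar>\<nu> (A n - A (Suc n))\<bar>)"
    proof (rule dependent_nat_choice)
      show "\<exists>A. A \<in> borel_subsets \<Omega> \<and> unbounded_on \<Omega> \<nu> A"
        using u \<Omega> by (auto simp: borel_subsets_iff)
      show "\<exists>B. (B \<in> borel_subsets \<Omega> \<and> unbounded_on \<Omega> \<nu> B) \<and> (B \<subseteq> A \<and> 1 \<le> \<bar>\<nu> (A - B)\<bar>)"
        if "A \<in> borel_subsets \<Omega> \<and> unbounded_on \<Omega> \<nu> A" for A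
        using unbounded_on_step[OF \<nu>, of A] that by blast
    qed
    then obtain A where A: "\<And>n. A n \<in> borel_subsets \<Omega>" "\<And>n. A (Suc n) \<subseteq> A n"
      "\<And>n. 1 \<le> \<bar>\<nu> (A n - A (Suc n))\<bar>" by blast
    have dec: "A n \<subseteq> A m" if "m \<le> n" for m n
      using that A(2) by (rule lift_Suc_antimono_le[rotated])
    have disj: "disjoint_family (\<lambda>n. A n - A (Suc n))"
      unfolding disjoint_family_on_def
    proof (intro ballI impI)
      fix m n :: nat assume "m \<noteq> n"
      then have "Suc m \<le> n \<or> Suc n \<le> m" by auto
      then show "(A m - A (Suc m)) \<inter> (A n - A (Suc n)) = {}" using dec by blast
    qed
    have "A n - A (Suc n) \<in> borel_subsets \<Omega>" for n
      using A(1)[of n] A(1)[of "Suc n"] by (auto simp: borel_subsets_iff)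
    then have "(\<lambda>n. \<nu> (A n - A (Suc n))) sums \<nu> (\<Union>n. A n - A (Suc n))"
      by (rule signed_measure_sums[OF \<nu> _ disj])
    \<comment> \<open>The terms of a convergent series tend to zero, against the lower bound 1 on
      each of them.\<close>
    then have lim: "(\<lambda>n. \<nu> (A n - A (Suc n))) \<longlonglongrightarrow> 0"
      by (rule summable_LIMSEQ_zero[OF sums_summable])
    have "\<forall>\<^sub>F n in sequentially. \<bar>\<nu> (A n - A (Suc n))\<bar> < 1"
      using tendstoD[OF lim, of 1] by (simp add: dist_real_def)
    then obtain n where "\<bar>\<nu> (A n - A (Suc n))\<bar> < 1"
      unfolding eventually_sequentially by blast
    then show False using A(3)[of n] by linarith
  qed
  then obtain C where "\<And>B. B \<in> borel_subsets \<Omega> \<Longrightarrow> B \<subseteq> \<Omega> \<Longrightarrow> \<bar>\<nu> B\<bar> < C"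
    by (rule not_unbounded_onE) blast
  then show ?thesis
    by (intro that[of C]) (auto simp: borel_subsets_iff intro: less_imp_le)
qed

text \<open>The set function inside \<open>pos_part\<close>, detached from \<open>measure_of\<close>
  so that its additivity can be established first.\<close>

definition pos_fun :: "real set \<Rightarrow> (real set \<Rightarrow> real) \<Rightarrow> real set \<Rightarrow> ennreal" where
  "pos_fun \<Omega> \<nu> A = (SUP B\<in>{B \<in> borel_subsets \<Omega>. B \<subseteq> A}. ennreal (\<nu> B))"

lemma pos_fun_upper: "B \<in> borel_subsets \<Omega> \<Longrightarrow> B \<subseteq> A \<Longrightarrow> ennreal (\<nu> B) \<le> pos_fun \<Omega> \<nu> A"
  unfolding pos_fun_def by (rule SUP_upper) auto

lemma pos_fun_mono: "A \<subseteq> A' \<Longrightarrow> pos_fun \<Omega> \<nu> A \<le> pos_fun \<Omega> \<nu> A'"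
  unfolding pos_fun_def by (rule SUP_subset_mono) auto

text \<open>Competitors in two disjoint sets can be united into a competitor in the union.\<close>

lemma pos_fun_Un_ge:
  assumes \<nu>: "signed_measure \<Omega> \<nu>" and A: "A \<inter> A' = {}"
  shows "pos_fun \<Omega> \<nu> A + pos_fun \<Omega> \<nu> A' \<le> pos_fun \<Omega> \<nu> (A \<union> A')"
proof -
  have z: "\<nu> {} = 0" using \<nu> by (simp add: signed_measure_def)
  have le: "ennreal (\<nu> B) + ennreal (\<nu> B') \<le> pos_fun \<Omega> \<nu> (A \<union> A')"
    if B: "B \<in> borel_subsets \<Omega>" "B \<subseteq> A" "B' \<in> borel_subsets \<Omega>" "B' \<subseteq> A'" for B B'
  proof -
    \<comment> \<open>\<open>ennreal\<close> clips negative numbers to 0, so a competitor of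
      negative measure is exchanged for \<open>{}\<close>. The clipped value is unchanged, and now
      \<open>ennreal\<close> commutes with the sum.\<close>
    define C where "C = (if 0 \<le> \<nu> B then B else {})"
    define C' where "C' = (if 0 \<le> \<nu> B' then B' else {})"
    have C: "C \<in> borel_subsets \<Omega>" "C' \<in> borel_subsets \<Omega>" "C \<subseteq> A" "C' \<subseteq> A'"
      using B by (auto simp: C_def C'_def)
    have "ennreal (\<nu> B) + ennreal (\<nu> B') = ennreal (\<nu> C) + ennreal (\<nu> C')"
      by (auto simp: C_def C'_def z ennreal_neg)
    also have "\<dots> = ennreal (\<nu> C + \<nu> C')"
      by (rule ennreal_plus[symmetric]) (auto simp: C_def C'_def z)
    also have "\<nu> C + \<nu> C' = \<nu> (C \<union> C')"
      by (rule signed_measure_Un[OF \<nu> C(1,2), symmetric]) (use C A in blast)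
    also have "ennreal \<dots> \<le> pos_fun \<Omega> \<nu> (A \<union> A')"
      by (rule pos_fun_upper) (use C in \<open>auto simp: borel_subsets_Un\<close>)
    finally show ?thesis .
  qed
  \<comment> \<open>A constant may be moved through a supremum in \<open>ennreal\<close> only over a
    nonempty index set; \<open>{}\<close> is always a member.\<close>
  have ne: "{B \<in> borel_subsets \<Omega>. B \<subseteq> X} \<noteq> {}" for X by (auto intro!: exI[of _ "{}"])
  have "ennreal (\<nu> B) + pos_fun \<Omega> \<nu> A' \<le> pos_fun \<Omega> \<nu> (A \<union> A')"
    if B: "B \<in> borel_subsets \<Omega>" "B \<subseteq> A" for B
    unfolding pos_fun_def[of \<Omega> \<nu> A']
    by (subst ennreal_SUP_add_right[OF ne]) (auto intro!: SUP_least le B)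
  then show ?thesis
    unfolding pos_fun_def[of \<Omega> \<nu> A]
    by (subst ennreal_SUP_add_left[OF ne, symmetric]) (auto intro!: SUP_least)
qed

lemma pos_fun_finite_ge:
  assumes \<nu>: "signed_measure \<Omega> \<nu>" and A: "disjoint_family (A :: nat \<Rightarrow> real set)"
  shows "(\<Sum>i<n. pos_fun \<Omega> \<nu> (A i)) \<le> pos_fun \<Omega> \<nu> (\<Union>i<n. A i)"
proof (induction n)
  case (Suc n)
  have "A i \<inter> A n = {}" if "i < n" for i
    using that by (intro disjoint_family_onD[OF A]) auto
  then have disj: "(\<Union>i<n. A i) \<inter> A n = {}" by blast
  have "(\<Sum>i<Suc n. pos_fun \<Omega> \<nu> (A i)) \<le> pos_fun \<Omega> \<nu> (\<Union>i<n. A i) + pos_fun \<Omega> \<nu> (A n)"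
    using Suc by (simp add: add_right_mono)
  also have "\<dots> \<le> pos_fun \<Omega> \<nu> ((\<Union>i<n. A i) \<union> A n)" by (rule pos_fun_Un_ge[OF \<nu> disj])
  also have "(\<Union>i<n. A i) \<union> A n = (\<Union>i<Suc n. A i)" by (simp add: lessThan_Suc Un_commute)
  finally show ?case .
qed simp

text \<open>One inequality is finite superadditivity in the limit. For the other, a competitor
  \<open>B\<close> in the union is cut into the pieces \<open>A i \<inter> B\<close>, each of which
  competes in its own \<open>A i\<close>.\<close>

lemma pos_fun_countably_additive:
  assumes \<nu>: "signed_measure \<Omega> \<nu>"
  shows "countably_additive (borel_subsets \<Omega>) (pos_fun \<Omega> \<nu>)"
  unfolding countably_additive_def
proof (intro allI impI antisym)
  fix A :: "nat \<Rightarrow> real set"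
  assume A: "range A \<subseteq> borel_subsets \<Omega>" "disjoint_family A"
  show "(\<Sum>i. pos_fun \<Omega> \<nu> (A i)) \<le> pos_fun \<Omega> \<nu> (\<Union>i. A i)"
  proof (rule suminf_le_const)
    show "(\<Sum>i<n. pos_fun \<Omega> \<nu> (A i)) \<le> pos_fun \<Omega> \<nu> (\<Union>i. A i)" for n
      by (rule order.trans[OF pos_fun_finite_ge[OF \<nu> A(2)] pos_fun_mono]) auto
  qed simp
  show "pos_fun \<Omega> \<nu> (\<Union>i. A i) \<le> (\<Sum>i. pos_fun \<Omega> \<nu> (A i))"
    unfolding pos_fun_def[of \<Omega> \<nu> "\<Union>i. A i"]
  proof (rule SUP_least, clarify)
    fix B assume B: "B \<in> borel_subsets \<Omega>" "B \<subseteq> (\<Union>i. A i)"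
    have m: "A i \<inter> B \<in> borel_subsets \<Omega>" for i
      using A(1) B(1) by (auto simp: borel_subsets_iff image_subset_iff)
    have "(\<lambda>i. \<nu> (A i \<inter> B)) sums \<nu> (\<Union>i. A i \<inter> B)"
      by (rule signed_measure_sums[OF \<nu> m]) (use A(2) in \<open>auto simp: disjoint_family_on_def\<close>)
    also have "(\<Union>i. A i \<inter> B) = B" using B(2) by auto
    finally have lim: "(\<lambda>n. ennreal (\<Sum>i<n. \<nu> (A i \<inter> B))) \<longlonglongrightarrow> ennreal (\<nu> B)"
      unfolding sums_def by (rule tendsto_ennrealI)
    have "ennreal (\<Sum>i<n. \<nu> (A i \<inter> B)) \<le> (\<Sum>i. pos_fun \<Omega> \<nu> (A i))" for n
    proof -
      \<comment> \<open>Negative terms are raised to zero before \<open>ennreal\<close> is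
        distributed over the sum, which is legitimate for nonnegative terms.\<close>
      have "ennreal (\<Sum>i<n. \<nu> (A i \<inter> B)) \<le> ennreal (\<Sum>i<n. max 0 (\<nu> (A i \<inter> B)))"
        by (intro ennreal_leI sum_mono) auto
      also have "\<dots> = (\<Sum>i<n. ennreal (max 0 (\<nu> (A i \<inter> B))))"
        by (rule sum_ennreal[symmetric]) auto
      also have "\<dots> \<le> (\<Sum>i<n. pos_fun \<Omega> \<nu> (A i))"
      proof (rule sum_mono)
        show "ennreal (max 0 (\<nu> (A i \<inter> B))) \<le> pos_fun \<Omega> \<nu> (A i)" for i
          using pos_fun_upper[OF m Int_lower1, of \<nu> i] by (simp add: max_def)
      qed
      also have "\<dots> \<le> (\<Sum>i. pos_fun \<Omega> \<nu> (A i))"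
        by (rule sum_le_suminf) auto
      finally show ?thesis .
    qed
    then show "ennreal (\<nu> B) \<le> (\<Sum>i. pos_fun \<Omega> \<nu> (A i))"
      by (intro LIMSEQ_le_const2[OF lim]) auto
  qed
qed

lemma signed_measureI:
  assumes "\<And>A. A \<notin> borel_subsets \<Omega> \<Longrightarrow> \<nu> A = 0" "\<nu> {} = 0"
    and "\<And>A. (\<And>i. A i \<in> borel_subsets \<Omega>) \<Longrightarrow> disjoint_family A \<Longrightarrow>
      (\<lambda>i. \<nu> (A i)) sums \<nu> (\<Union>i. A i)"
  shows "signed_measure \<Omega> \<nu>"
  unfolding signed_measure_def using assms by (simp add: image_subset_iff)

lemma signed_measure_outside: "signed_measure \<Omega> \<nu> \<Longrightarrow> A \<notin> borel_subsets \<Omega> \<Longrightarrow> \<nu> A = 0"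
  by (simp add: signed_measure_def)

lemma signed_measure_cmult:
  assumes "signed_measure \<Omega> \<nu>"
  shows "signed_measure \<Omega> (\<lambda>A. c * \<nu> A)"
  using assms
  by (intro signed_measureI)
    (simp_all add: signed_measure_outside signed_measure_empty sums_mult signed_measure_sums)

lemma signed_measure_uminus: "signed_measure \<Omega> \<nu> \<Longrightarrow> signed_measure \<Omega> (\<lambda>A. - \<nu> A)"
  using signed_measure_cmult[of \<Omega> \<nu> "-1"] by simp

lemma signed_measure_add:
  assumes "signed_measure \<Omega> \<nu>" "signed_measure \<Omega> \<nu>'"
  shows "signed_measure \<Omega> (\<lambda>A. \<nu> A + \<nu>' A)"
  using assms
  by (intro signed_measureI)
    (simp_all add: signed_measure_outside signed_measure_empty sums_add signed_measure_sums)

text \<open>\<open>measure_of\<close> returns the prescribed values only for a positive and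
  countably additive set function; \<open>pos_fun\<close> is one, and boundedness of
  \<open>\<nu>\<close> makes the result finite.\<close>

lemma
  assumes \<Omega>: "\<Omega> \<in> sets borel" and \<nu>: "signed_measure \<Omega> \<nu>"
  shows sets_pos_part: "sets (pos_part \<Omega> \<nu>) = borel_subsets \<Omega>"
    and space_pos_part: "space (pos_part \<Omega> \<nu>) = \<Omega>"
    and emeasure_pos_part: "A \<in> borel_subsets \<Omega> \<Longrightarrow> emeasure (pos_part \<Omega> \<nu>) A = pos_fun \<Omega> \<nu> A"
    and finite_pos_part: "finite_measure (pos_part \<Omega> \<nu>)"
proof -
  interpret sigma_algebra \<Omega> "borel_subsets \<Omega>" using \<Omega> by (rule sigma_algebra_borel_subsets)
  show 1: "sets (pos_part \<Omega> \<nu>) = borel_subsets \<Omega>" "space (pos_part \<Omega> \<nu>) = \<Omega>"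
    unfolding pos_part_def by simp_all
  have pos: "positive (borel_subsets \<Omega>) (pos_fun \<Omega> \<nu>)"
  proof -
    have "{B \<in> borel_subsets \<Omega>. B \<subseteq> {}} = {{}}" by auto
    then show ?thesis using \<nu> by (simp add: positive_def pos_fun_def signed_measure_def)
  qed
  show 2: "emeasure (pos_part \<Omega> \<nu>) A = pos_fun \<Omega> \<nu> A" if "A \<in> borel_subsets \<Omega>" for A
    unfolding pos_part_def pos_fun_def[of \<Omega> \<nu>, THEN eq_reflection, symmetric]
    by (rule emeasure_measure_of_sigma[OF _ pos pos_fun_countably_additive[OF \<nu>] that])
      (rule sigma_algebra_axioms)
  obtain C where C: "\<And>B. B \<in> borel_subsets \<Omega> \<Longrightarrow> \<bar>\<nu> B\<bar> \<le> C"
    using signed_measure_bounded[OF \<Omega> \<nu>] by blast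
  have "pos_fun \<Omega> \<nu> \<Omega> \<le> ennreal C"
    unfolding pos_fun_def by (rule SUP_least) (use C in \<open>force intro!: ennreal_leI\<close>)
  then show "finite_measure (pos_part \<Omega> \<nu>)"
    using \<Omega> by (intro finite_measureI) (auto simp: 1 2 borel_subsets_iff top_unique)
qed

text \<open>For \<open>B \<subseteq> A\<close>, \<open>\<nu> B = \<nu> A - \<nu> (A - B)\<close> is
  at most \<open>\<nu> A\<close> plus the negative part of \<open>A\<close>; the supremum over
  \<open>B\<close> gives one inequality. The same inequality for \<open>- \<nu>\<close> is the
  reverse one.\<close>

lemma measure_pos_part_diff:
  assumes \<Omega>: "\<Omega> \<in> sets borel" and \<nu>: "signed_measure \<Omega> \<nu>" and A: "A \<in> borel_subsets \<Omega>"
  shows "measure (pos_part \<Omega> \<nu>) A - measure (neg_part \<Omega> \<nu>) A = \<nu> A"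
proof -
  let ?\<mu> = "\<lambda>B. - \<nu> B"
  have sub: "measure (pos_part \<Omega> \<nu>) A \<le> measure (neg_part \<Omega> \<nu>) A + \<nu> A"
    if \<nu>: "signed_measure \<Omega> \<nu>" for \<nu>
  proof -
    note \<mu> = signed_measure_uminus[OF \<nu>]
    interpret P: finite_measure "pos_part \<Omega> \<nu>" using finite_pos_part[OF \<Omega> \<nu>] .
    interpret Q: finite_measure "neg_part \<Omega> \<nu>" unfolding neg_part_def using finite_pos_part[OF \<Omega> \<mu>] .
    have eqQ: "ennreal (measure (neg_part \<Omega> \<nu>) A) = pos_fun \<Omega> (\<lambda>B. - \<nu> B) A"
      using emeasure_pos_part[OF \<Omega> \<mu> A] Q.emeasure_eq_measure[of A] unfolding neg_part_def by simp
    have "- \<nu> A \<le> measure (neg_part \<Omega> \<nu>) A"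
      using pos_fun_upper[OF A subset_refl, of "\<lambda>B. - \<nu> B"]
      by (simp add: eqQ[symmetric])
    \<comment> \<open>Nonnegativity of the right-hand side is what allows the comparison in
      \<open>ennreal\<close> to be read back in the reals.\<close>
    then have nn: "0 \<le> measure (neg_part \<Omega> \<nu>) A + \<nu> A" by linarith
    have "ennreal (measure (pos_part \<Omega> \<nu>) A) = pos_fun \<Omega> \<nu> A"
      using emeasure_pos_part[OF \<Omega> \<nu> A] P.emeasure_eq_measure[of A] by simp
    also have "\<dots> \<le> ennreal (measure (neg_part \<Omega> \<nu>) A + \<nu> A)"
      unfolding pos_fun_def
    proof (rule SUP_least, clarify)
      fix B assume B: "B \<in> borel_subsets \<Omega>" "B \<subseteq> A"
      have "\<nu> A = \<nu> B + \<nu> (A - B)"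
        using signed_measure_split[OF \<nu> A, of B] B by (simp add: Int_absorb1 borel_subsets_iff)
      moreover have "ennreal (- \<nu> (A - B)) \<le> ennreal (measure (neg_part \<Omega> \<nu>) A)"
        unfolding eqQ by (rule pos_fun_upper[where \<nu>="\<lambda>B. - \<nu> B"]) (use A B in \<open>auto simp: borel_subsets_iff\<close>)
      then have "- \<nu> (A - B) \<le> measure (neg_part \<Omega> \<nu>) A" by simp
      ultimately show "ennreal (\<nu> B) \<le> ennreal (measure (neg_part \<Omega> \<nu>) A + \<nu> A)"
        by (intro ennreal_leI) linarith
    qed
    finally show ?thesis using nn by simp
  qed
  from sub[OF \<nu>] sub[OF signed_measure_uminus[OF \<nu>]] show ?thesis
    by (simp add: neg_part_def)
qed

section \<open>Signed integrals as differences of finite Borel integrals\<close>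

text \<open>\<open>pos_part\<close> lives on the Borel subsets of \<open>\<Omega>\<close>. Here the
  measure lives on all Borel sets of the line and merely gives no mass to the complement, the
  setting of distribution functions and product measures.\<close>

definition finite_borel_on :: "real set \<Rightarrow> real measure \<Rightarrow> bool" where
  "finite_borel_on \<Omega> M \<longleftrightarrow> finite_measure M \<and> sets M = sets borel \<and> emeasure M (- \<Omega>) = 0"

definition represents ::
    "real set \<Rightarrow> (real set \<Rightarrow> real) \<Rightarrow> real measure \<Rightarrow> real measure \<Rightarrow> bool" where
  "represents \<Omega> \<nu> M K \<longleftrightarrow> finite_borel_on \<Omega> M \<and> finite_borel_on \<Omega> K \<and>
     (\<forall>A\<in>borel_subsets \<Omega>. \<nu> A = measure M A - measure K A)"

lemma
  assumes "represents \<Omega> \<nu> M K"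
  shows represents_on1: "finite_borel_on \<Omega> M" and represents_on2: "finite_borel_on \<Omega> K"
    and represents_eq: "A \<in> borel_subsets \<Omega> \<Longrightarrow> \<nu> A = measure M A - measure K A"
  using assms by (auto simp: represents_def)

lemma
  assumes "finite_borel_on \<Omega> M"
  shows finite_borel_on_finite: "finite_measure M"
    and finite_borel_on_sets: "sets M = sets borel"
    and finite_borel_on_space: "space M = UNIV"
    and finite_borel_on_null: "emeasure M (- \<Omega>) = 0"
  using assms sets_eq_imp_space_eq[of M borel] by (auto simp: finite_borel_on_def)

lemma set_integrable_bounded:
  assumes M: "finite_borel_on \<Omega> M" and f: "f \<in> borel_measurable borel"
    and A: "A \<in> sets borel" and B: "\<And>x. x \<in> A \<Longrightarrow> \<bar>f x\<bar> \<le> (B::real)"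
  shows "set_integrable M A f"
proof -
  interpret finite_measure M using M by (rule finite_borel_on_finite)
  note [measurable_cong] = finite_borel_on_sets[OF M]
  note [measurable] = f A
  show ?thesis unfolding set_integrable_def
    by (rule integrable_const_bound[of _ "\<bar>B\<bar>"]) (use B in \<open>force simp: indicator_def\<close>, measurable)
qed

lemma emeasure_Int_on:
  assumes M: "finite_borel_on \<Omega> M" and \<Omega>: "\<Omega> \<in> sets borel" and A: "A \<in> sets borel"
  shows "emeasure M A = emeasure M (A \<inter> \<Omega>)"
proof -
  have "A - \<Omega> \<in> null_sets M"
    by (rule null_sets_subset[of "- \<Omega>"])
      (use \<Omega> A finite_borel_on_null[OF M] finite_borel_on_sets[OF M] in \<open>auto simp: null_sets_def\<close>)
  then have "emeasure M (A \<inter> \<Omega> \<union> (A - \<Omega>)) = emeasure M (A \<inter> \<Omega>)"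
    by (intro emeasure_Un_null_set) (use \<Omega> A finite_borel_on_sets[OF M] in auto)
  then show ?thesis by (simp add: Int_Diff_Un)
qed

lemma nn_integral_sum_eq:
  fixes f :: "real \<Rightarrow> ennreal"
  assumes s: "sets M1 = sets borel" "sets M2 = sets borel" "sets N1 = sets borel" "sets N2 = sets borel"
    and e: "\<And>A. A \<in> sets borel \<Longrightarrow> emeasure M1 A + emeasure M2 A = emeasure N1 A + emeasure N2 A"
    and f: "f \<in> borel_measurable borel"
  shows "(\<integral>\<^sup>+x. f x \<partial>M1) + (\<integral>\<^sup>+x. f x \<partial>M2) = (\<integral>\<^sup>+x. f x \<partial>N1) + (\<integral>\<^sup>+x. f x \<partial>N2)"
  using f
proof (induct rule: borel_measurable_induct)
  note [measurable_cong] = s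
  case (cong f g)
  then have "f = g" by auto
  with cong show ?case by simp
next
  note [measurable_cong] = s
  case (set A)
  then show ?case using e s by simp
next
  note [measurable_cong] = s
  case (mult u c)
  note [measurable] = mult(2)
  show ?case using mult(4) by (simp add: nn_integral_cmult distrib_left[symmetric])
next
  note [measurable_cong] = s
  case (add u v)
  note [measurable] = add(1) add(4)
  have "(\<integral>\<^sup>+x. v x + u x \<partial>M1) + (\<integral>\<^sup>+x. v x + u x \<partial>M2) =
      ((\<integral>\<^sup>+x. v x \<partial>M1) + (\<integral>\<^sup>+x. v x \<partial>M2)) + ((\<integral>\<^sup>+x. u x \<partial>M1) + (\<integral>\<^sup>+x. u x \<partial>M2))"
    by (simp add: nn_integral_add ac_simps)
  also have "\<dots> = ((\<integral>\<^sup>+x. v x \<partial>N1) + (\<integral>\<^sup>+x. v x \<partial>N2)) + ((\<integral>\<^sup>+x. u x \<partial>N1) + (\<integral>\<^sup>+x. u x \<partial>N2))"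
    using add(3,7) by simp
  also have "\<dots> = (\<integral>\<^sup>+x. v x + u x \<partial>N1) + (\<integral>\<^sup>+x. v x + u x \<partial>N2)"
    by (simp add: nn_integral_add ac_simps)
  finally show ?case .
next
  note [measurable_cong] = s
  case (seq U)
  note [measurable] = seq(1)
  have inc: "incseq (\<lambda>i. \<integral>\<^sup>+x. U i x \<partial>M)" for M :: "real measure"
    using seq(4) by (auto simp: incseq_def le_fun_def intro!: nn_integral_mono)
  have sup: "(SUP i. U i) = (\<lambda>x. SUP i. U i x)" by (simp add: fun_eq_iff image_image)
  have *: "(\<integral>\<^sup>+x. (SUP i. U i x) \<partial>M) + (\<integral>\<^sup>+x. (SUP i. U i x) \<partial>N) =
      (SUP i. (\<integral>\<^sup>+x. U i x \<partial>M) + (\<integral>\<^sup>+x. U i x \<partial>N))"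
    if [measurable_cong]: "sets M = sets borel" "sets N = sets borel" for M N
    by (simp add: ennreal_SUP_add[OF inc inc]
        nn_integral_monotone_convergence_SUP[OF seq(4)])
  show ?case unfolding sup using seq(3) by (simp only: *[OF s(1,2)] *[OF s(3,4)])
qed

lemma integral_sum_eq:
  fixes f :: "real \<Rightarrow> real"
  assumes f: "finite_measure M1" "finite_measure M2" "finite_measure N1" "finite_measure N2"
    and s: "sets M1 = sets borel" "sets M2 = sets borel" "sets N1 = sets borel" "sets N2 = sets borel"
    and e: "\<And>A. A \<in> sets borel \<Longrightarrow> measure M1 A + measure M2 A = measure N1 A + measure N2 A"
    and m: "f \<in> borel_measurable borel" and B: "\<And>x. \<bar>f x\<bar> \<le> B"
  shows "integral\<^sup>L M1 f + integral\<^sup>L M2 f = integral\<^sup>L N1 f + integral\<^sup>L N2 f"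
proof -
  note [measurable] = m
  have e': "emeasure M1 A + emeasure M2 A = emeasure N1 A + emeasure N2 A" if "A \<in> sets borel" for A
    using e[OF that] f by (simp add: finite_measure.emeasure_eq_measure ennreal_plus[symmetric] del: ennreal_plus)
  \<comment> \<open>Adding the bound \<open>B\<close> makes the integrand nonnegative; the added
    constants cancel in the end by the identity of total masses.\<close>
  have shift: "ennreal (integral\<^sup>L M f + B * measure M UNIV) = (\<integral>\<^sup>+x. ennreal (f x + B) \<partial>M)"
    and nonneg: "0 \<le> integral\<^sup>L M f + B * measure M UNIV"
    if M: "finite_measure M" "sets M = sets borel" for M
  proof -
    interpret finite_measure M by fact
    note [measurable_cong] = M(2)
    have sp: "space M = UNIV" using sets_eq_imp_space_eq[OF M(2)] by simp
    have i: "integrable M f" by (rule integrable_const_bound[of _ B]) (use B in \<open>auto\<close>)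
    have "0 \<le> f x + B" for x using B[of x] by linarith
    then have "(\<integral>\<^sup>+x. ennreal (f x + B) \<partial>M) = ennreal (LINT x|M. f x + B)"
      by (intro nn_integral_eq_integral) (use i in auto)
    moreover have "(LINT x|M. f x + B) = integral\<^sup>L M f + B * measure M UNIV"
      using i by (simp add: sp)
    moreover have "0 \<le> (LINT x|M. f x + B)"
      by (rule integral_nonneg_AE) (use \<open>\<And>x. 0 \<le> f x + B\<close> in auto)
    ultimately show "ennreal (integral\<^sup>L M f + B * measure M UNIV) = (\<integral>\<^sup>+x. ennreal (f x + B) \<partial>M)"
      "0 \<le> integral\<^sup>L M f + B * measure M UNIV" by simp_all
  qed
  have "ennreal (integral\<^sup>L M1 f + B * measure M1 UNIV) + ennreal (integral\<^sup>L M2 f + B * measure M2 UNIV)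
    = ennreal (integral\<^sup>L N1 f + B * measure N1 UNIV) + ennreal (integral\<^sup>L N2 f + B * measure N2 UNIV)"
    using nn_integral_sum_eq[OF s e', of "\<lambda>x. ennreal (f x + B)"] by (simp add: shift f s)
  then have "(integral\<^sup>L M1 f + B * measure M1 UNIV) + (integral\<^sup>L M2 f + B * measure M2 UNIV)
    = (integral\<^sup>L N1 f + B * measure N1 UNIV) + (integral\<^sup>L N2 f + B * measure N2 UNIV)"
    using nonneg f s by (simp add: ennreal_plus[symmetric] del: ennreal_plus)
  moreover have "B * measure M1 UNIV + B * measure M2 UNIV = B * measure N1 UNIV + B * measure N2 UNIV"
    using e[of UNIV] by (simp add: distrib_left[symmetric])
  ultimately show ?thesis by linarith
qed

text \<open>Push-forward along the inclusion of \<open>\<Omega>\<close> into the line.\<close>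

lemma finite_borel_on_distr:
  assumes \<Omega>: "\<Omega> \<in> sets borel" and M: "sets M = borel_subsets \<Omega>" "space M = \<Omega>" "finite_measure M"
  shows "finite_borel_on \<Omega> (distr M borel (\<lambda>x. x))"
    and "\<And>A. A \<in> borel_subsets \<Omega> \<Longrightarrow> measure (distr M borel (\<lambda>x. x)) A = measure M A"
    and "\<And>A (f :: real \<Rightarrow> real). A \<in> borel_subsets \<Omega> \<Longrightarrow> f \<in> borel_measurable borel \<Longrightarrow>
      (LINT x:A|distr M borel (\<lambda>x. x). f x) = (LINT x:A|M. f x)"
proof -
  have [measurable]: "(\<lambda>x. x) \<in> measurable M borel"
    unfolding measurable_def using \<Omega> by (auto simp: M borel_subsets_iff)
  show "finite_borel_on \<Omega> (distr M borel (\<lambda>x. x))"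
    using \<Omega> M(3) by (auto simp: finite_borel_on_def emeasure_distr M(2) intro!: finite_measure.finite_measure_distr)
  show "measure (distr M borel (\<lambda>x. x)) A = measure M A" if "A \<in> borel_subsets \<Omega>" for A
    using that by (subst measure_distr) (auto simp: borel_subsets_iff M(2) Int_absorb2)
  show "(LINT x:A|distr M borel (\<lambda>x. x). f x) = (LINT x:A|M. f x)"
    if "A \<in> borel_subsets \<Omega>" and [measurable]: "f \<in> borel_measurable borel" for A and f :: "real \<Rightarrow> real"
  proof -
    have [measurable]: "A \<in> sets borel" using that by (simp add: borel_subsets_iff)
    show ?thesis unfolding set_lebesgue_integral_def by (subst integral_distr) auto
  qed
qed

text \<open>For the Jordan pair, total variation is the sum of the two measures, which fails for a
  general representing pair. The last clause later removes the singular part away from its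
  carrier.\<close>

lemma jordan_representation:
  assumes \<Omega>: "\<Omega> \<in> sets borel" and \<nu>: "signed_measure \<Omega> \<nu>"
  obtains M K where "represents \<Omega> \<nu> M K"
    and "\<And>A. A \<in> borel_subsets \<Omega> \<Longrightarrow> total_variation \<Omega> \<nu> A = measure M A + measure K A"
    and "\<And>A f. A \<in> borel_subsets \<Omega> \<Longrightarrow> f \<in> borel_measurable borel \<Longrightarrow>
      signed_integral \<Omega> \<nu> A f = (LINT x:A|M. f x) - (LINT x:A|K. f x)"
    and "\<And>A. A \<in> borel_subsets \<Omega> \<Longrightarrow> (\<And>B. B \<in> borel_subsets \<Omega> \<Longrightarrow> B \<subseteq> A \<Longrightarrow> \<nu> B = 0) \<Longrightarrow>
      measure M A = 0 \<and> measure K A = 0"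
proof -
  note \<mu> = signed_measure_uminus[OF \<nu>]
  note p = sets_pos_part[OF \<Omega> \<nu>] space_pos_part[OF \<Omega> \<nu>] finite_pos_part[OF \<Omega> \<nu>]
  note n = sets_pos_part[OF \<Omega> \<mu>] space_pos_part[OF \<Omega> \<mu>] finite_pos_part[OF \<Omega> \<mu>]
  note p' = finite_borel_on_distr[OF \<Omega> p]
  note n' = finite_borel_on_distr[OF \<Omega> n, folded neg_part_def]
  have z: "measure (pos_part \<Omega> \<nu>) A = 0"
    if "signed_measure \<Omega> \<nu>" "A \<in> borel_subsets \<Omega>" "\<And>B. B \<in> borel_subsets \<Omega> \<Longrightarrow> B \<subseteq> A \<Longrightarrow> \<nu> B = 0" for A \<nu>
  proof -
    have "pos_fun \<Omega> \<nu> A \<le> 0" unfolding pos_fun_def by (rule SUP_least) (use that in auto)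
    then show ?thesis by (simp add: measure_def emeasure_pos_part[OF \<Omega> that(1,2)])
  qed
  show ?thesis
    by (rule that[of "distr (pos_part \<Omega> \<nu>) borel (\<lambda>x. x)" "distr (neg_part \<Omega> \<nu>) borel (\<lambda>x. x)"])
      (use p'(1,2,3) n'(1,2,3) measure_pos_part_diff[OF \<Omega> \<nu>] z[OF \<nu>] z[OF \<mu>] in
        \<open>simp_all add: represents_def total_variation_def signed_integral_def neg_part_def\<close>)
qed

lemma ex_represents:
  assumes "\<Omega> \<in> sets borel" "signed_measure \<Omega> \<nu>"
  shows "\<exists>M K. represents \<Omega> \<nu> M K"
  using jordan_representation[OF assms] by metis

lemma signed_integral_cong:
  assumes "\<And>x. x \<in> A \<Longrightarrow> f x = g x"
  shows "signed_integral \<Omega> \<nu> A f = signed_integral \<Omega> \<nu> A g"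
proof -
  have "(\<lambda>x. indicator A x *\<^sub>R f x) = (\<lambda>x. indicator A x *\<^sub>R g x)"
    using assms by (auto simp: indicator_def)
  then show ?thesis by (simp only: signed_integral_def set_lebesgue_integral_def)
qed

text \<open>Two representing pairs satisfy \<open>M' + K = K' + M\<close> as measures, so their
  integral differences agree for bounded integrands.\<close>

lemma signed_integral_represents:
  assumes \<Omega>: "\<Omega> \<in> sets borel" and \<nu>: "signed_measure \<Omega> \<nu>" and r: "represents \<Omega> \<nu> M K"
    and A: "A \<in> borel_subsets \<Omega>" and f: "f \<in> borel_measurable borel"
    and B: "\<And>x. x \<in> A \<Longrightarrow> \<bar>f x\<bar> \<le> B"
  shows "signed_integral \<Omega> \<nu> A f = (LINT x:A|M. f x) - (LINT x:A|K. f x)"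
proof -
  obtain M' K' where r': "represents \<Omega> \<nu> M' K'" and i: "\<And>A f. A \<in> borel_subsets \<Omega> \<Longrightarrow> f \<in> borel_measurable borel \<Longrightarrow>
      signed_integral \<Omega> \<nu> A f = (LINT x:A|M'. f x) - (LINT x:A|K'. f x)"
    using jordan_representation[OF \<Omega> \<nu>] by metis
  note on = represents_on1[OF r] represents_on2[OF r] represents_on1[OF r'] represents_on2[OF r']
  have e: "measure M' C + measure K C = measure K' C + measure M C" if C: "C \<in> sets borel" for C
  proof -
    have "C \<inter> \<Omega> \<in> borel_subsets \<Omega>" using \<Omega> C by (auto simp: borel_subsets_iff)
    from represents_eq[OF r this] represents_eq[OF r' this] show ?thesis
      using emeasure_Int_on[OF _ \<Omega> C] on by (simp add: measure_def)
  qed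
  have [measurable]: "A \<in> sets borel" "f \<in> borel_measurable borel" using A f by (auto simp: borel_subsets_iff)
  have B': "\<bar>f x\<bar> \<le> \<bar>B\<bar>" if "x \<in> A" for x using B[OF that] by linarith
  have "(LINT x:A|M'. f x) + (LINT x:A|K. f x) = (LINT x:A|K'. f x) + (LINT x:A|M. f x)"
    unfolding set_lebesgue_integral_def
    by (rule integral_sum_eq[where B = "\<bar>B\<bar>"])
      (use on e B' in \<open>auto simp: finite_borel_on_def indicator_def\<close>)
  then show ?thesis using i[OF A f] by linarith
qed

lemma signed_measure_set_integral:
  fixes f :: "real \<Rightarrow> real"
  assumes M: "borel_subsets \<Omega> \<subseteq> sets M" and \<Omega>: "\<Omega> \<in> sets borel" and f: "set_integrable M \<Omega> f"
  shows "signed_measure \<Omega> (\<lambda>A. if A \<in> borel_subsets \<Omega> then LINT x:A|M. f x else 0)"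
proof (rule signed_measureI)
  fix A :: "nat \<Rightarrow> real set" assume A: "\<And>i. A i \<in> borel_subsets \<Omega>" "disjoint_family A"
  have i: "set_integrable M B f" if "B \<in> borel_subsets \<Omega>" for B
    by (rule set_integrable_subset[OF f]) (use that M in \<open>auto simp: borel_subsets_iff\<close>)
  have U: "(\<Union>i. A i) \<in> borel_subsets \<Omega>" using A(1) by (intro borel_subsets_UN) auto
  have F: "(\<Union>i<n. A i) \<in> borel_subsets \<Omega>" for n
    using A(1) by (auto simp: borel_subsets_iff)
  have "(\<lambda>n. LINT x:(\<Union>i<n. A i)|M. f x) \<longlonglongrightarrow> (LINT x:(\<Union>n. \<Union>i<n. A i)|M. f x)"
  proof (rule set_integral_cont_up)
    show "(\<Union>i<n. A i) \<in> sets M" for n using F M by blast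
    show "incseq (\<lambda>n. \<Union>i<n. A i)" by (force simp: incseq_def)
    have "(\<Union>n. \<Union>i<n. A i) = (\<Union>i. A i)" by auto
    then show "set_integrable M (\<Union>n. \<Union>i<n. A i) f" using i[OF U] by simp
  qed
  moreover have "(\<Union>n. \<Union>i<n. A i) = (\<Union>i. A i)" by auto
  moreover have "(LINT x:(\<Union>i<n. A i)|M. f x) = (\<Sum>i<n. LINT x:A i|M. f x)" for n
    by (rule set_integral_finite_Union)
      (use A M i in \<open>auto simp: disjoint_family_on_def\<close>)
  ultimately have "(\<lambda>i. LINT x:A i|M. f x) sums (LINT x:(\<Union>i. A i)|M. f x)"
    by (simp add: sums_def)
  then show "(\<lambda>i. if A i \<in> borel_subsets \<Omega> then LINT x:A i|M. f x else 0) sums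
      (if (\<Union>i. A i) \<in> borel_subsets \<Omega> then LINT x:(\<Union>i. A i)|M. f x else 0)"
    using A(1) U by simp
qed (auto simp: set_lebesgue_integral_def)

section \<open>Lebesgue decomposition\<close>

text \<open>Exhaustion: a countable union of null sets whose \<open>M\<close>-measures approach the
  supremum over all null sets attains it, and a disjoint null set of positive measure would exceed
  it.\<close>

lemma ex_maximal_null_set:
  assumes M: "finite_measure M" "sets M = sets borel"
  obtains N where "N \<in> null_sets lborel"
    and "\<And>A. A \<in> null_sets lborel \<Longrightarrow> A \<inter> N = {} \<Longrightarrow> emeasure M A = 0"
proof -
  interpret finite_measure M by fact
  have sM: "A \<in> sets M" if "A \<in> null_sets lborel" for A
    using that M(2) by (auto simp: null_sets_def)
  define S where "S = measure M ` null_sets lborel"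
  have S: "S \<noteq> {}" "bdd_above S"
    unfolding S_def by (auto intro!: bdd_aboveI2[of _ _ "measure M (space M)"] bounded_measure)
  have "\<exists>A\<in>null_sets lborel. Sup S - 1 / Suc n < measure M A" for n
    using less_cSupD[OF S(1), of "Sup S - 1 / Suc n"] unfolding S_def by auto
  then obtain A where A: "\<And>n. A n \<in> null_sets lborel" "\<And>n. Sup S - 1 / Suc n < measure M (A n)"
    by metis
  define N where "N = (\<Union>n. A n)"
  have N: "N \<in> null_sets lborel" unfolding N_def using A(1) by auto
  have ge: "Sup S \<le> measure M N"
  proof (rule field_le_epsilon)
    fix e :: real assume "e > 0"
    then obtain n where n: "1 / Suc n < e" using nat_approx_posE by blast
    have "measure M (A n) \<le> measure M N"
      by (rule finite_measure_mono) (use N sM N_def in auto)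
    then show "Sup S \<le> measure M N + e" using A(2)[of n] n by linarith
  qed
  show thesis
  proof (rule that[OF N])
    fix B assume B: "B \<in> null_sets lborel" "B \<inter> N = {}"
    have "measure M B + measure M N = measure M (B \<union> N)"
      by (rule finite_measure_Union[symmetric]) (use B N sM in auto)
    also have "\<dots> \<le> Sup S"
      by (rule cSup_upper[OF _ S(2)]) (use B(1) N S_def in auto)
    finally have "measure M B = 0" using ge measure_nonneg[of M B] by linarith
    then show "emeasure M B = 0" by (simp add: emeasure_eq_measure)
  qed
qed

text \<open>After removal of a maximal null set, what remains of \<open>M\<close> is absolutely
  continuous and Radon-Nikodym applies.\<close>

lemma measure_lebesgue_decomposition:
  assumes M: "finite_measure M" "sets M = sets borel"
  obtains N g where "N \<in> null_sets lborel" and "integrable lborel (g :: real \<Rightarrow> real)"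
    and "\<And>A. A \<in> sets borel \<Longrightarrow> measure M (A - N) = (LINT x:A|lborel. g x)"
proof -
  interpret finite_measure M by fact
  obtain N where N: "N \<in> null_sets lborel"
    and max: "\<And>A. A \<in> null_sets lborel \<Longrightarrow> A \<inter> N = {} \<Longrightarrow> emeasure M A = 0"
    using ex_maximal_null_set[OF M] by blast
  have [measurable]: "N \<in> sets borel" using N by auto
  note [measurable_cong] = M(2)
  define M' where "M' = density M (indicator (- N))"
  have sM': "sets M' = sets borel" by (simp add: M'_def M(2))
  have eM': "emeasure M' A = emeasure M (A - N)"
    if [measurable]: "A \<in> sets borel" for A :: "real set"
  proof -
    have "emeasure M' A = (\<integral>\<^sup>+x. indicator (A - N) x \<partial>M)"
      unfolding M'_def
      by (subst emeasure_density, measurable, rule nn_integral_cong, simp split: split_indicator)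
    then show ?thesis by simp
  qed
  have "absolutely_continuous lborel M'"
    unfolding absolutely_continuous_def
  proof
    fix A :: "real set" assume A: "A \<in> null_sets lborel"
    have "A - N \<in> null_sets lborel" by (rule null_sets_subset[OF A]) (use A in auto)
    then have "emeasure M (A - N) = 0" by (rule max) auto
    moreover have A': "A \<in> sets borel" using A by auto
    ultimately show "A \<in> null_sets M'" by (intro null_setsI) (simp_all only: eM'[OF A'] sM')
  qed
  then obtain f where [measurable]: "f \<in> borel_measurable lborel" and f: "density lborel f = M'"
    using sigma_finite_measure.Radon_Nikodym[OF sigma_finite_lborel, of M'] sM' by auto
  have nn: "(\<integral>\<^sup>+x. f x * indicator A x \<partial>lborel) = emeasure M (A - N)"
    if [measurable]: "A \<in> sets borel" for A :: "real set"
    using eM'[OF that] unfolding f[symmetric] by (subst (asm) emeasure_density) auto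
  \<comment> \<open>The total mass is finite, so the density is finite almost everywhere and
    \<open>enn2real\<close> loses nothing.\<close>
  have fin: "AE x in lborel. f x \<noteq> \<infinity>"
    by (rule nn_integral_PInf_AE) (use nn[of UNIV] in \<open>auto\<close>)
  define g where "g x = enn2real (f x)" for x
  have [measurable]: "g \<in> borel_measurable lborel" unfolding g_def by measurable
  have g0: "0 \<le> g x" for x by (simp add: g_def)
  have nng: "(\<integral>\<^sup>+x. ennreal (indicator A x * g x) \<partial>lborel) = emeasure M (A - N)"
    if [measurable]: "A \<in> sets borel" for A :: "real set"
    unfolding nn[OF that, symmetric]
    by (rule nn_integral_cong_AE)
      (use fin in eventually_elim, auto simp: g_def indicator_def less_top)
  show thesis
  proof (rule that[OF N])
    show "integrable lborel g"
      by (rule integrableI_nonneg) (use g0 nng[of UNIV] in \<open>auto simp: less_top[symmetric]\<close>)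
    show "measure M (A - N) = (LINT x:A|lborel. g x)" if [measurable]: "A \<in> sets borel" for A :: "real set"
      unfolding set_lebesgue_integral_def
      by (subst integral_eq_nn_integral) (use g0 nng[OF that] in \<open>auto simp: measure_def\<close>)
  qed
qed

lemma set_integral_null_set:
  fixes f :: "'a \<Rightarrow> real"
  assumes "A \<in> null_sets M"
  shows "(LINT x:A|M. f x) = 0"
  unfolding set_lebesgue_integral_def
  by (rule integral_eq_zero_AE) (use AE_not_in[OF assms] in \<open>auto elim: eventually_mono\<close>)

lemma set_integral_lebesgue:
  fixes f :: "real \<Rightarrow> real"
  assumes [measurable]: "A \<in> sets borel" "f \<in> borel_measurable borel"
  shows "(LINT x:A|lebesgue. f x) = (LINT x:A|lborel. f x)"
  unfolding set_lebesgue_integral_def by (rule integral_completion) measurable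

lemma signed_measure_restrict:
  assumes \<nu>: "signed_measure \<Omega> \<nu>" and N: "N \<in> sets borel"
  shows "signed_measure \<Omega> (\<lambda>A. if A \<in> borel_subsets \<Omega> then \<nu> (A \<inter> N) else 0)"
proof (rule signed_measureI)
  fix A :: "nat \<Rightarrow> real set" assume A: "\<And>i. A i \<in> borel_subsets \<Omega>" "disjoint_family A"
  have "(\<lambda>i. \<nu> (A i \<inter> N)) sums \<nu> (\<Union>i. A i \<inter> N)"
    by (rule signed_measure_sums[OF \<nu>])
      (use A borel_subsets_Int[OF A(1) N] in \<open>auto simp: disjoint_family_on_def\<close>)
  moreover have "(\<Union>i. A i) \<in> borel_subsets \<Omega>" using A(1) by (intro borel_subsets_UN) auto
  ultimately show "(\<lambda>i. if A i \<in> borel_subsets \<Omega> then \<nu> (A i \<inter> N) else 0) sums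
      (if (\<Union>i. A i) \<in> borel_subsets \<Omega> then \<nu> ((\<Union>i. A i) \<inter> N) else 0)"
    using A(1) by simp
qed (simp_all add: signed_measure_empty[OF \<nu>])

text \<open>Both measures of a representing pair are decomposed; the union of the two exceptional
  null sets carries the singular part of the difference.\<close>

lemma lebesgue_decomposition_exists:
  assumes \<Omega>: "\<Omega> \<in> sets borel" and \<nu>: "signed_measure \<Omega> \<nu>"
  shows "\<exists>g \<sigma>. lebesgue_decomposition \<Omega> \<nu> g \<sigma>"
proof -
  obtain M K where r: "represents \<Omega> \<nu> M K" using ex_represents[OF \<Omega> \<nu>] by blast
  note on = represents_on1[OF r] represents_on2[OF r]
  note fin = on[THEN finite_borel_on_finite] and sets = on[THEN finite_borel_on_sets]
  obtain N1 g1 where N1: "N1 \<in> null_sets lborel" and g1: "integrable lborel g1"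
    and M: "\<And>A. A \<in> sets borel \<Longrightarrow> measure M (A - N1) = (LINT x:A|lborel. g1 x)"
    using measure_lebesgue_decomposition[OF fin(1) sets(1)] by metis
  obtain N2 g2 where N2: "N2 \<in> null_sets lborel" and g2: "integrable lborel g2"
    and K: "\<And>A. A \<in> sets borel \<Longrightarrow> measure K (A - N2) = (LINT x:A|lborel. g2 x)"
    using measure_lebesgue_decomposition[OF fin(2) sets(2)] by metis
  define N where "N = (N1 \<union> N2) \<inter> \<Omega>"
  define g where "g x = g1 x - g2 x" for x
  define \<sigma> where "\<sigma> A = (if A \<in> borel_subsets \<Omega> then \<nu> (A \<inter> N) else 0)" for A
  have [measurable]: "N1 \<in> sets borel" "N2 \<in> sets borel" "\<Omega> \<in> sets borel" using N1 N2 \<Omega> by auto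
  have mg [measurable]: "g1 \<in> borel_measurable borel" "g2 \<in> borel_measurable borel" "g \<in> borel_measurable borel"
    using g1 g2 unfolding g_def by auto
  have [measurable]: "N \<in> sets borel" by (simp add: N_def)
  have N: "N \<in> null_sets lborel"
    by (rule null_sets_subset[OF null_sets.Un[OF N1 N2]]) (auto simp: N_def)
  have gi: "integrable lborel g" unfolding g_def using g1 g2 by auto
  have drop: "(LINT x:A - N|lborel. h x) = (LINT x:A|lborel. h x)"
    if [measurable]: "A \<in> sets borel" "h \<in> borel_measurable borel" for A and h :: "real \<Rightarrow> real"
    unfolding set_lebesgue_integral_def
    by (rule integral_cong_AE) (measurable, use AE_not_in[OF N] in eventually_elim, auto simp: indicator_def)
  have "\<nu> A = (LINT x:A|lebesgue. g x) + \<sigma> A" if A: "A \<in> borel_subsets \<Omega>" for A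
  proof -
    have A' [measurable]: "A \<in> sets borel" using A by (auto simp: borel_subsets_iff)
    have D: "A - N \<in> borel_subsets \<Omega>" using A by (rule borel_subsets_Diff) measurable
    \<comment> \<open>Outside \<open>N\<close> neither exceptional set is met, so both measures are
      given by their densities there.\<close>
    have e: "A - N - N1 = A - N" "A - N - N2 = A - N" using A by (auto simp: N_def borel_subsets_iff)
    have "\<nu> (A - N) = (LINT x:A - N|lborel. g1 x) - (LINT x:A - N|lborel. g2 x)"
      using represents_eq[OF r D] M[of "A - N"] K[of "A - N"] by (simp add: e)
    also have "\<dots> = (LINT x:A|lborel. g1 x) - (LINT x:A|lborel. g2 x)" by (simp add: drop)
    also have "\<dots> = (LINT x:A|lborel. g x)"
      unfolding g_def by (rule set_integral_diff(2)[symmetric])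
        (simp_all only: set_integrable_def, (rule integrable_mult_indicator, simp, fact)+)
    finally show ?thesis
      using signed_measure_split[OF \<nu> A, of N] A by (simp add: \<sigma>_def set_integral_lebesgue)
  qed
  moreover have "integrable (lebesgue_on \<Omega>) g"
    using integrable_mult_indicator[OF _ gi, of \<Omega>]
    by (subst integrable_restrict_space) (auto simp: integrable_completion)
  moreover have "signed_measure \<Omega> \<sigma>" unfolding \<sigma>_def by (rule signed_measure_restrict[OF \<nu>]) measurable
  moreover have "\<sigma> A = \<sigma> (A \<inter> N)" if "A \<in> borel_subsets \<Omega>" for A
    using that borel_subsets_Int[OF that, of N] by (simp add: \<sigma>_def Int_assoc)
  moreover have "N \<in> borel_subsets \<Omega>" by (auto simp: borel_subsets_iff N_def)
  ultimately have "lebesgue_decomposition \<Omega> \<nu> g \<sigma>"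
    unfolding lebesgue_decomposition_def using N by blast
  then show ?thesis by blast
qed

text \<open>Both singular parts are carried by the null set \<open>N \<union> N'\<close>. Density
  integrals vanish there, so each singular part equals \<open>\<nu>\<close> restricted to it. The
  density itself is determined only almost everywhere and is left out of the claim.\<close>

lemma lebesgue_decomposition_unique:
  assumes 1: "lebesgue_decomposition \<Omega> \<nu> g \<sigma>" and 2: "lebesgue_decomposition \<Omega> \<nu> g' \<sigma>'"
  shows "\<sigma> = \<sigma>'"
proof
  fix A
  obtain N where N: "N \<in> borel_subsets \<Omega>" "N \<in> null_sets lborel"
    "\<And>A. A \<in> borel_subsets \<Omega> \<Longrightarrow> \<sigma> A = \<sigma> (A \<inter> N)"
    using 1 unfolding lebesgue_decomposition_def by blast
  obtain N' where N': "N' \<in> borel_subsets \<Omega>" "N' \<in> null_sets lborel"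
    "\<And>A. A \<in> borel_subsets \<Omega> \<Longrightarrow> \<sigma>' A = \<sigma>' (A \<inter> N')"
    using 2 unfolding lebesgue_decomposition_def by blast
  show "\<sigma> A = \<sigma>' A"
  proof (cases "A \<in> borel_subsets \<Omega>")
    case True
    define B where "B = A \<inter> (N \<union> N')"
    have B: "B \<in> borel_subsets \<Omega>" "B \<in> sets borel"
      using True N(1) N'(1) by (auto simp: B_def borel_subsets_iff)
    have "B \<in> null_sets lborel"
      by (rule null_sets_subset[OF null_sets.Un[OF N(2) N'(2)]]) (use B in \<open>auto simp: B_def\<close>)
    then have z: "(LINT x:B|lebesgue. h x) = 0" for h :: "real \<Rightarrow> real"
      by (intro set_integral_null_set null_sets_completionI)
    have "\<sigma> A = \<sigma> B"
      using N(3)[OF True] N(3)[OF B(1)] by (simp add: B_def Int_Un_distrib2 Int_assoc Int_absorb1)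
    also have "\<dots> = \<nu> B"
      using 1 B(1) z unfolding lebesgue_decomposition_def by simp
    also have "\<dots> = \<sigma>' B"
      using 2 B(1) z unfolding lebesgue_decomposition_def by simp
    also have "\<dots> = \<sigma>' A"
      using N'(3)[OF True] N'(3)[OF B(1)] by (simp add: B_def Int_Un_distrib2 Int_assoc Int_absorb1)
    finally show ?thesis .
  next
    case False
    then show ?thesis using 1 2 unfolding lebesgue_decomposition_def signed_measure_def by simp
  qed
qed

text \<open>The density is chosen by \<open>SOME\<close> and the singular part by
  \<open>THE\<close>, independently of each other; uniqueness of the singular part shows that the
  two choices belong to one decomposition.\<close>

lemma lebesgue_decomposition_ac_singular:
  assumes "\<Omega> \<in> sets borel" "signed_measure \<Omega> \<nu>"
  shows "lebesgue_decomposition \<Omega> \<nu> (ac_density \<Omega> \<nu>) (singular_part \<Omega> \<nu>)"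
proof -
  have "\<exists>\<sigma>. lebesgue_decomposition \<Omega> \<nu> (ac_density \<Omega> \<nu>) \<sigma>"
    unfolding ac_density_def by (rule someI_ex[OF lebesgue_decomposition_exists[OF assms]])
  then obtain \<sigma> where \<sigma>: "lebesgue_decomposition \<Omega> \<nu> (ac_density \<Omega> \<nu>) \<sigma>" by blast
  moreover have "singular_part \<Omega> \<nu> = \<sigma>"
    unfolding singular_part_def by (rule the_equality) (use \<sigma> lebesgue_decomposition_unique in blast)+
  ultimately show ?thesis by simp
qed

section \<open>Test functions and distribution functions\<close>

lemma test_function_DERIV:
  assumes "\<phi> \<in> test_functions \<Omega>"
  shows "(\<phi> has_real_derivative deriv \<phi> x) (at x)"
proof -
  obtain D where "(\<phi> has_real_derivative D x) (at x)"
    using assms unfolding test_functions_def C1_differentiable_on_def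
    by (auto simp: has_real_derivative_iff_has_vector_derivative)
  then show ?thesis using DERIV_imp_deriv by metis
qed

lemma test_function_continuous_deriv:
  assumes "\<phi> \<in> test_functions \<Omega>"
  shows "continuous_on UNIV (deriv \<phi>)"
proof -
  obtain D where D: "\<And>x. (\<phi> has_real_derivative D x) (at x)" "continuous_on UNIV D"
    using assms unfolding test_functions_def C1_differentiable_on_def
    by (auto simp: has_real_derivative_iff_has_vector_derivative)
  then have "deriv \<phi> = D" by (auto intro: DERIV_imp_deriv)
  with D show ?thesis by simp
qed

lemma test_function_continuous:
  assumes "\<phi> \<in> test_functions \<Omega>"
  shows "continuous_on UNIV \<phi>"
  by (rule DERIV_continuous_on[of _ _ "deriv \<phi>"]) (use test_function_DERIV[OF assms] in auto)

lemma test_function_measurable: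
  assumes "\<phi> \<in> test_functions \<Omega>"
  shows "\<phi> \<in> borel_measurable borel" "deriv \<phi> \<in> borel_measurable borel"
  using test_function_continuous[OF assms] test_function_continuous_deriv[OF assms]
  by (auto intro: borel_measurable_continuous_onI)

lemma test_function_support:
  assumes \<phi>: "\<phi> \<in> test_functions \<Omega>"
  obtains K where "compact K" "K \<subseteq> \<Omega>" "\<And>x. x \<notin> K \<Longrightarrow> \<phi> x = 0" "\<And>x. x \<notin> K \<Longrightarrow> deriv \<phi> x = 0"
proof
  define K where "K = closure {x. \<phi> x \<noteq> 0}"
  show "compact K" "K \<subseteq> \<Omega>" using \<phi> by (auto simp: test_functions_def K_def)
  show z: "\<phi> x = 0" if "x \<notin> K" for x
    using that closure_subset[of "{x. \<phi> x \<noteq> 0}"] by (auto simp: K_def)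
  show "deriv \<phi> x = 0" if x: "x \<notin> K" for x
  proof -
    have "((\<lambda>x. 0) has_real_derivative 0) (at x)" by simp
    moreover have "open (- K)" by (simp add: K_def open_Compl)
    ultimately have "(\<phi> has_real_derivative 0) (at x)"
      by (rule has_field_derivative_transform_within_open) (use x z in simp_all)
    then show ?thesis by (rule DERIV_imp_deriv)
  qed
qed

lemma continuous_compact_support_bounded:
  fixes f :: "real \<Rightarrow> real"
  assumes "continuous_on UNIV f" "compact K" "\<And>x. x \<notin> K \<Longrightarrow> f x = 0"
  obtains B where "\<And>x. \<bar>f x\<bar> \<le> B"
proof -
  have "compact (f ` K)"
    using assms by (intro compact_continuous_image) (auto intro: continuous_on_subset)
  then have "bounded (f ` K)" by (rule compact_imp_bounded)
  then obtain B where B: "\<And>x. x \<in> K \<Longrightarrow> \<bar>f x\<bar> \<le> B"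
    unfolding bounded_iff by auto
  have "\<bar>f x\<bar> \<le> \<bar>B\<bar>" for x
  proof (cases "x \<in> K")
    case True then show ?thesis using B[of x] by linarith
  qed (simp add: assms(3))
  then show ?thesis by (rule that)
qed

lemma test_function_bounded:
  assumes \<phi>: "\<phi> \<in> test_functions \<Omega>"
  shows "\<exists>B. \<forall>x. \<bar>\<phi> x\<bar> \<le> B \<and> \<bar>deriv \<phi> x\<bar> \<le> B"
proof -
  obtain K where K: "compact K" "\<And>x. x \<notin> K \<Longrightarrow> \<phi> x = 0" "\<And>x. x \<notin> K \<Longrightarrow> deriv \<phi> x = 0"
    using test_function_support[OF \<phi>] by metis
  obtain B1 where "\<And>x. \<bar>\<phi> x\<bar> \<le> B1"
    using continuous_compact_support_bounded[OF test_function_continuous[OF \<phi>] K(1,2)] by blast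
  moreover obtain B2 where "\<And>x. \<bar>deriv \<phi> x\<bar> \<le> B2"
    using continuous_compact_support_bounded[OF test_function_continuous_deriv[OF \<phi>] K(1,3)] by blast
  ultimately show ?thesis by (intro exI[of _ "max B1 B2"]) (auto simp: le_max_iff_disj)
qed

lemma test_function_outside:
  assumes "\<phi> \<in> test_functions \<Omega>" "x \<notin> \<Omega>"
  shows "\<phi> x = 0" "deriv \<phi> x = 0"
  using test_function_support[OF assms(1)] assms(2) by (metis subsetD)+

lemma test_function_FTC:
  assumes "\<phi> \<in> test_functions {a<..<b}" "s \<le> b"
  shows "(LINT x:{s..b}|lborel. deriv \<phi> x) = - \<phi> s"
proof -
  have "(\<integral>x. deriv \<phi> x * indicator {s..b} x \<partial>lborel) = \<phi> b - \<phi> s"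
    by (rule integral_FTC_Icc_real)
      (use assms test_function_DERIV[OF assms(1)] test_function_continuous_deriv[OF assms(1)] in
        \<open>auto simp: continuous_on_eq_continuous_at\<close>)
  then show ?thesis
    using test_function_outside(1)[OF assms(1), of b]
    by (simp add: set_lebesgue_integral_def mult.commute)
qed

lemma Fubini_bounded:
  fixes f :: "real \<Rightarrow> real \<Rightarrow> real"
  assumes M: "finite_measure M" "sets M = sets borel" and K: "finite_measure K" "sets K = sets borel"
    and f: "(\<lambda>(x, y). f x y) \<in> borel_measurable (borel \<Otimes>\<^sub>M borel)" and B: "\<And>x y. \<bar>f x y\<bar> \<le> B"
  shows "(\<integral>y. (\<integral>x. f x y \<partial>M) \<partial>K) = (\<integral>x. (\<integral>y. f x y \<partial>K) \<partial>M)"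
proof -
  interpret M: finite_measure M by fact
  interpret K: finite_measure K by fact
  interpret pair_sigma_finite M K ..
  interpret MK: finite_measure "M \<Otimes>\<^sub>M K" by (rule finite_measure_pair_measure) fact+
  note [measurable_cong] = M(2) K(2)
  have "integrable (M \<Otimes>\<^sub>M K) (case_prod f)"
    by (rule MK.integrable_const_bound[of _ B]) (use f B in \<open>auto\<close>)
  then show ?thesis by (rule Fubini_integral)
qed

lemma finite_borel_on_density:
  assumes [measurable]: "\<Omega> \<in> sets borel" and "emeasure lborel \<Omega> < \<infinity>"
  shows "finite_borel_on \<Omega> (density lborel (\<lambda>x. ennreal (indicator \<Omega> x)))"
  unfolding finite_borel_on_def
proof (intro conjI)
  have *: "emeasure (density lborel (\<lambda>x. ennreal (indicator \<Omega> x))) A = emeasure lborel (\<Omega> \<inter> A)"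
    if [measurable]: "A \<in> sets borel" for A :: "real set"
    by (subst emeasure_density, measurable, subst nn_integral_indicator[symmetric], measurable,
      rule nn_integral_cong, simp split: split_indicator)
  show "finite_measure (density lborel (\<lambda>x. ennreal (indicator \<Omega> x)))"
    by (rule finite_measureI) (use assms(2) *[of UNIV] in auto)
  show "emeasure (density lborel (\<lambda>x. ennreal (indicator \<Omega> x))) (- \<Omega>) = 0"
    using *[of "- \<Omega>"] by simp
qed simp

section \<open>Distribution functions of finite measures carried by an interval\<close>

lemma finite_borel_on_borel_measure: "finite_borel_on \<Omega> M \<Longrightarrow> finite_borel_measure M"
  by (auto simp: finite_borel_on_def finite_borel_measure_def finite_borel_measure_axioms_def)

lemma borel_measurable_cdf:
  "finite_borel_on \<Omega> M \<Longrightarrow> cdf M \<in> borel_measurable borel"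
  by (rule borel_measurable_mono)
    (auto simp: mono_def intro!: finite_borel_measure.cdf_nondecreasing finite_borel_on_borel_measure)

lemma cdf_abs_le: "finite_borel_on \<Omega> M \<Longrightarrow> \<bar>cdf M x\<bar> \<le> measure M UNIV"
  using finite_borel_measure.cdf_bounded[OF finite_borel_on_borel_measure, of \<Omega> M x]
    finite_borel_on_space[of \<Omega> M] by (simp add: cdf_def)

lemma measure_null_subset:
  assumes M: "finite_borel_on \<Omega> M" and \<Omega>: "\<Omega> \<in> sets borel" and A: "A \<in> sets borel"
  shows "measure M A = measure M (A \<inter> \<Omega>)"
  using emeasure_Int_on[OF assms] by (simp add: measure_def)

lemma cdf_eq_Ioc:
  assumes M: "finite_borel_on {a<..<b} M" and "x < b"
  shows "cdf M x = measure M {a<..x}"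
proof -
  have "{..x} \<inter> {a<..<b} = {a<..x}" using assms(2) by auto
  then show ?thesis using measure_null_subset[OF M, of "{..x}"] by (simp add: cdf_def)
qed

text \<open>Write \<open>cdf M x\<close> as the \<open>M\<close>-measure of the points
  \<open>s \<le> x\<close> and exchange the integrals: the inner one becomes the integral of
  \<open>deriv \<phi>\<close> from \<open>s\<close> to \<open>b\<close>, which is
  \<open>- \<phi> s\<close>.\<close>

lemma integral_cdf_deriv:
  assumes M: "finite_borel_on {a<..<b} M" and \<phi>: "\<phi> \<in> test_functions {a<..<b}"
  shows "(LINT x:{a<..<b}|lborel. cdf M x * deriv \<phi> x) = - (LINT x:{a<..<b}|M. \<phi> x)"
proof -
  define \<Omega> where "\<Omega> = {a<..<b}"
  define L where "L = density lborel (\<lambda>x. ennreal (indicator \<Omega> x))"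
  note [measurable] = test_function_measurable[OF \<phi>]
  have [measurable]: "\<Omega> \<in> sets borel" by (simp add: \<Omega>_def)
  have L: "finite_borel_on \<Omega> L" unfolding L_def
    by (rule finite_borel_on_density) (simp_all add: \<Omega>_def emeasure_bounded_finite[unfolded infinity_ennreal_def])
  interpret L: finite_measure L using L by (rule finite_borel_on_finite)
  interpret M: finite_borel_measure M using M by (rule finite_borel_on_borel_measure)
  note [measurable_cong] = M.M_is_borel finite_borel_on_sets[OF L]
  have [measurable]: "cdf M \<in> borel_measurable borel" by (rule borel_measurable_cdf[OF M])
  have iL: "integral\<^sup>L L f = (LINT x:\<Omega>|lborel. f x)" if [measurable]: "f \<in> borel_measurable borel"
    for f :: "real \<Rightarrow> real"
    unfolding L_def set_lebesgue_integral_def by (rule integral_density) auto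
  \<comment> \<open>The kernel of the Fubini argument: the indicator of \<open>s \<le> x\<close>
    times the derivative.\<close>
  define k where "k s x = indicator {s..} x * deriv \<phi> x" for s x
  have [measurable]: "(\<lambda>(s, x). k s x) \<in> borel_measurable (borel \<Otimes>\<^sub>M borel)"
    unfolding k_def indicator_def atLeast_iff by measurable
  obtain B where B: "\<And>x. \<bar>deriv \<phi> x\<bar> \<le> B"
    using test_function_bounded[OF \<phi>] by blast
  have kB: "\<bar>k s x\<bar> \<le> B" for s x
    using B[of x] B[of 0] by (auto simp: k_def indicator_def)
  have inner1: "(\<integral>s. k s x \<partial>M) = cdf M x * deriv \<phi> x" for x
  proof -
    have "(\<lambda>s. k s x) = (\<lambda>s. indicator {..x} s * deriv \<phi> x)" by (auto simp: k_def indicator_def)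
    then show ?thesis by (simp add: cdf_def)
  qed
  have inner2: "(\<integral>x. k s x \<partial>L) = - \<phi> s" for s
  proof -
    have m: "k s \<in> borel_measurable borel" unfolding k_def by measurable
    have "(\<integral>x. k s x \<partial>L) = (LINT x:\<Omega>|lborel. k s x)" by (rule iL[OF m])
    \<comment> \<open>The derivative vanishes at the endpoints, so the interval may be closed. The
      lower limit \<open>max a s\<close> covers \<open>s \<le> a\<close>, where
      \<open>\<phi>\<close> is zero as well.\<close>
    also have "\<dots> = (LINT x:{max a s..b}|lborel. deriv \<phi> x)"
      unfolding set_lebesgue_integral_def
      by (rule Bochner_Integration.integral_cong)
        (use test_function_outside(2)[OF \<phi>] in \<open>auto simp: k_def indicator_def \<Omega>_def\<close>)
    also have "\<dots> = - \<phi> s"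
    proof (cases "max a s \<le> b")
      case True
      have "\<phi> (max a s) = \<phi> s"
        using test_function_outside(1)[OF \<phi>, of a] test_function_outside(1)[OF \<phi>, of s] by (auto simp: max_def)
      with test_function_FTC[OF \<phi> True] show ?thesis by simp
    next
      case False
      then show ?thesis using test_function_outside(1)[OF \<phi>, of s]
        by (auto simp: set_lebesgue_integral_def max_def split: if_splits)
    qed
    finally show ?thesis .
  qed
  have "(LINT x:{a<..<b}|lborel. cdf M x * deriv \<phi> x) = (\<integral>x. (\<integral>s. k s x \<partial>M) \<partial>L)"
    unfolding inner1 by (subst iL) (auto simp: \<Omega>_def)
  also have "\<dots> = (\<integral>s. (\<integral>x. k s x \<partial>L) \<partial>M)"
    by (rule Fubini_bounded[OF _ M.M_is_borel L.finite_measure_axioms finite_borel_on_sets[OF L] _ kB])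
      (unfold_locales, measurable)
  also have "\<dots> = - (\<integral>s. \<phi> s \<partial>M)" unfolding inner2 by simp
  also have "(\<integral>s. \<phi> s \<partial>M) = (LINT x:{a<..<b}|M. \<phi> x)"
    unfolding set_lebesgue_integral_def
    by (rule Bochner_Integration.integral_cong)
      (use test_function_outside(1)[OF \<phi>] in \<open>auto simp: indicator_def\<close>)
  finally show ?thesis .
qed

text \<open>Agreement is assumed only inside the interval. To the left both distribution functions
  vanish; from \<open>b\<close> on they equal the mass of \<open>{..<b}\<close>, a left limit of
  interior values.\<close>

lemma finite_borel_on_eqI:
  assumes M: "finite_borel_on {a<..<b} M" and K: "finite_borel_on {a<..<b} K" and "a < b"
    and eq: "\<And>x. x \<in> {a<..<b} \<Longrightarrow> cdf M x = cdf K x"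
  shows "M = K"
proof -
  interpret M: finite_borel_measure M using M by (rule finite_borel_on_borel_measure)
  interpret K: finite_borel_measure K using K by (rule finite_borel_on_borel_measure)
  \<comment> \<open>The mass to the left of \<open>b\<close> is the limit of the distribution
    function at \<open>b\<close> from below, taken along points where the two functions
    coincide.\<close>
  have total: "measure M {..<b} = measure K {..<b}"
  proof (rule tendsto_unique[OF _ M.cdf_at_left])
    have "\<forall>\<^sub>F x in at_left b. cdf K x = cdf M x"
      using \<open>a < b\<close> eq unfolding eventually_at_left[OF \<open>a < b\<close>] by (intro exI[of _ a]) auto
    then show "(cdf M \<longlongrightarrow> measure K {..<b}) (at_left b)"
      using K.cdf_at_left[of b] by (rule Lim_transform_eventually[rotated])
  qed simp
  have beyond: "measure N {..x} = measure N {..<b}" if "finite_borel_on {a<..<b} N" "b \<le> x" for N x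
  proof -
    have "{..x} \<inter> {a<..<b} = {..<b} \<inter> {a<..<b}" using that by auto
    then show ?thesis
      using measure_null_subset[OF that(1), of "{..x}"] measure_null_subset[OF that(1), of "{..<b}"] by simp
  qed
  have cdf: "measure M {..x} = measure K {..x}" for x
  proof -
    consider "x \<le> a" | "x \<in> {a<..<b}" | "b \<le> x" by fastforce
    then show ?thesis
    proof cases
      case 1
      then show ?thesis
        using cdf_eq_Ioc[OF M, of x] cdf_eq_Ioc[OF K, of x] \<open>a < b\<close> by (simp add: cdf_def)
    next
      case 2 then show ?thesis using eq[of x] by (simp add: cdf_def)
    next
      case 3 then show ?thesis using beyond[OF M] beyond[OF K] total by simp
    qed
  qed
  have all: "measure M UNIV = measure K UNIV"
  proof -
    have "UNIV \<inter> {a<..<b} = {..b} \<inter> {a<..<b}" by auto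
    then show ?thesis
      using measure_null_subset[OF M, of UNIV] measure_null_subset[OF K, of UNIV]
        measure_null_subset[OF M, of "{..b}"] measure_null_subset[OF K, of "{..b}"] cdf[of b] by simp
  qed
  have gt: "{x<..} = UNIV - {..x}" for x :: real by auto
  show ?thesis
  proof (rule measure_eqI_lessThan[OF M.M_is_borel K.M_is_borel])
    show "emeasure M {x<..} < \<infinity>" for x
      by (simp add: M.emeasure_eq_measure)
    show "emeasure M {x<..} = emeasure K {x<..}" for x
      unfolding M.emeasure_eq_measure K.emeasure_eq_measure gt
      using M.finite_measure_compl[of "{..x}"] K.finite_measure_compl[of "{..x}"] cdf[of x] all
      by (simp add: M.borel_UNIV K.borel_UNIV M.M_is_borel K.M_is_borel)
  qed
qed

text \<open>The values on \<open>{a<..x}\<close> are differences of distribution functions, so a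
  representing pair must consist of two equal measures.\<close>

lemma signed_measure_eq_zeroI:
  assumes "a < b" and \<nu>: "signed_measure {a<..<b} \<nu>"
    and z: "\<And>x. x \<in> {a<..<b} \<Longrightarrow> \<nu> {a<..x} = 0"
  shows "\<nu> A = 0"
proof (cases "A \<in> borel_subsets {a<..<b}")
  case True
  obtain M K where r: "represents {a<..<b} \<nu> M K"
    using ex_represents[OF _ \<nu>] by auto
  have "cdf M x = cdf K x" if x: "x \<in> {a<..<b}" for x
  proof -
    have "{a<..x} \<in> borel_subsets {a<..<b}" using x by (auto simp: borel_subsets_iff)
    from represents_eq[OF r this] z[OF x] show ?thesis
      using x cdf_eq_Ioc[OF represents_on1[OF r], of x] cdf_eq_Ioc[OF represents_on2[OF r], of x] by simp
  qed
  then have "M = K"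
    by (rule finite_borel_on_eqI[OF represents_on1[OF r] represents_on2[OF r] \<open>a < b\<close>])
  then show ?thesis using represents_eq[OF r True] by simp
qed (rule signed_measure_outside[OF \<nu>])

section \<open>Essential one-sided limits\<close>

lemma not_AE_notin_Ioo:
  assumes "AE x in lebesgue. x \<notin> {y<..<z}" and "y < (z :: real)"
  shows False
proof -
  have "{y<..<z} \<in> null_sets lebesgue"
    using assms(1) by (subst AE_iff_null_sets) auto
  then have "emeasure lborel {y<..<z} = 0" by (simp add: null_sets_def)
  then show False using assms(2) by simp
qed

text \<open>\<open>Lim\<close> is well determined only along a nontrivial filter. A set of full
  measure meets every right neighbourhood of \<open>y\<close>.\<close>

lemma ess_at_right_neq_bot: "inf (at_right (y :: real)) (ae_filter lebesgue) \<noteq> bot"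
proof
  assume "inf (at_right y) (ae_filter lebesgue) = bot"
  then have "\<forall>\<^sub>F x in inf (at_right y) (ae_filter lebesgue). False" by simp
  then obtain Q R where Q: "\<forall>\<^sub>F x in at_right y. Q x" and R: "AE x in lebesgue. R x"
    and QR: "\<And>x. Q x \<Longrightarrow> R x \<Longrightarrow> False"
    unfolding eventually_inf by blast
  obtain z where "y < z" "\<And>x. y < x \<Longrightarrow> x < z \<Longrightarrow> Q x"
    using Q unfolding eventually_at_right_field by blast
  then show False using R QR by (intro not_AE_notin_Ioo[of y z]) (auto elim: eventually_mono)
qed

lemma ess_at_left_neq_bot: "inf (at_left (y :: real)) (ae_filter lebesgue) \<noteq> bot"
proof
  assume "inf (at_left y) (ae_filter lebesgue) = bot"
  then have "\<forall>\<^sub>F x in inf (at_left y) (ae_filter lebesgue). False" by simp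
  then obtain Q R where Q: "\<forall>\<^sub>F x in at_left y. Q x" and R: "AE x in lebesgue. R x"
    and QR: "\<And>x. Q x \<Longrightarrow> R x \<Longrightarrow> False"
    unfolding eventually_inf by blast
  obtain z where "z < y" "\<And>x. z < x \<Longrightarrow> x < y \<Longrightarrow> Q x"
    using Q unfolding eventually_at_left_field by blast
  then show False using R QR by (intro not_AE_notin_Ioo[of z y]) (auto elim: eventually_mono)
qed

lemma AE_lebesgue_on_iff:
  assumes "\<Omega> \<in> sets borel"
  shows "(AE x in lebesgue_on \<Omega>. P x) \<longleftrightarrow> (AE x in lebesgue. x \<in> \<Omega> \<longrightarrow> P x)"
  using assms by (intro AE_restrict_space_iff) auto

lemma eventually_ess_at_right:
  assumes P: "AE x in lebesgue_on {a<..<b}. P x" and y: "a \<le> y" "y < b"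
  shows "\<forall>\<^sub>F x in inf (at_right y) (ae_filter lebesgue). P x"
  unfolding eventually_inf
proof (intro exI conjI)
  show "\<forall>\<^sub>F x in at_right y. x \<in> {y<..<b}" by (rule eventually_at_rightI[of y b]) (use y in auto)
  show "AE x in lebesgue. x \<in> {a<..<b} \<longrightarrow> P x" using P by (simp add: AE_lebesgue_on_iff)
qed (use y in auto)

lemma eventually_ess_at_left:
  assumes P: "AE x in lebesgue_on {a<..<b}. P x" and y: "a < y" "y \<le> b"
  shows "\<forall>\<^sub>F x in inf (at_left y) (ae_filter lebesgue). P x"
  unfolding eventually_inf
proof (intro exI conjI)
  show "\<forall>\<^sub>F x in at_left y. x \<in> {a<..<y}" by (rule eventually_at_leftI[of a]) (use y in auto)
  show "AE x in lebesgue. x \<in> {a<..<b} \<longrightarrow> P x" using P by (simp add: AE_lebesgue_on_iff)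
qed (use y in auto)

text \<open>A representative \<open>H\<close> with an ordinary limit computes the limit of the
  equivalence class. The case \<open>y = a\<close> is included because the boundary value at
  \<open>a\<close> is read off this way.\<close>

lemma right_limit_eqI:
  assumes "AE x in lebesgue_on {a<..<b}. F x = H x" "a \<le> y" "y < b" "(H \<longlongrightarrow> l) (at_right y)"
  shows "right_limit F y = l"
  unfolding right_limit_def
proof (rule tendsto_Lim[OF ess_at_right_neq_bot])
  have "(H \<longlongrightarrow> l) (inf (at_right y) (ae_filter lebesgue))"
    using assms(4) by (rule tendsto_mono[rotated]) simp
  then show "(F \<longlongrightarrow> l) (inf (at_right y) (ae_filter lebesgue))"
    by (rule Lim_transform_eventually)
      (use eventually_ess_at_right[OF assms(1-3)] in \<open>auto elim: eventually_mono\<close>)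
qed

lemma left_limit_eqI:
  assumes "AE x in lebesgue_on {a<..<b}. F x = H x" "a < y" "y \<le> b" "(H \<longlongrightarrow> l) (at_left y)"
  shows "left_limit F y = l"
  unfolding left_limit_def
proof (rule tendsto_Lim[OF ess_at_left_neq_bot])
  have "(H \<longlongrightarrow> l) (inf (at_left y) (ae_filter lebesgue))"
    using assms(4) by (rule tendsto_mono[rotated]) simp
  then show "(F \<longlongrightarrow> l) (inf (at_left y) (ae_filter lebesgue))"
    by (rule Lim_transform_eventually)
      (use eventually_ess_at_left[OF assms(1-3)] in \<open>auto elim: eventually_mono\<close>)
qed

lemma set_integrable_mult_bounded:
  fixes f g :: "'a \<Rightarrow> real"
  assumes f: "set_integrable M A f" and [measurable]: "g \<in> borel_measurable M" and B: "\<And>x. \<bar>g x\<bar> \<le> B"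
  shows "set_integrable M A (\<lambda>x. f x * g x)"
  unfolding set_integrable_def
proof (rule Bochner_Integration.integrable_bound)
  have i: "integrable M (\<lambda>x. indicator A x *\<^sub>R f x)" using f by (simp add: set_integrable_def)
  then show "integrable M (\<lambda>x. B * (indicator A x *\<^sub>R f x))" by simp
  have "(\<lambda>x. indicator A x *\<^sub>R f x) \<in> borel_measurable M" using i by simp
  then have "(\<lambda>x. (indicator A x *\<^sub>R f x) * g x) \<in> borel_measurable M" by measurable
  then show "(\<lambda>x. indicator A x *\<^sub>R (f x * g x)) \<in> borel_measurable M" by (simp add: mult.assoc)
  have "0 \<le> B" using B[of undefined] by linarith
  then show "AE x in M. norm (indicator A x *\<^sub>R (f x * g x)) \<le> norm (B * (indicator A x *\<^sub>R f x))"
    using B by (intro AE_I2) (auto simp: abs_mult indicator_def mult.commute[of B] intro!: mult_left_mono)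
qed

lemma integrable_lebesgue_on_iff:
  fixes f :: "real \<Rightarrow> real"
  assumes "\<Omega> \<in> sets borel"
  shows "integrable (lebesgue_on \<Omega>) f \<longleftrightarrow> set_integrable lebesgue \<Omega> f"
  unfolding set_integrable_def using assms by (subst integrable_restrict_space) auto

lemma set_integrable_lebesgue_bounded:
  fixes H :: "real \<Rightarrow> real"
  assumes "\<Omega> \<in> sets borel" "emeasure lborel \<Omega> < \<infinity>"
    and "H \<in> borel_measurable borel" "\<And>x. \<bar>H x\<bar> \<le> B"
  shows "set_integrable lebesgue \<Omega> H"
proof -
  have "set_integrable lebesgue \<Omega> (\<lambda>x. 1 :: real)"
    unfolding set_integrable_def using assms(1,2)
    by (auto simp: integrable_completion intro!: integrable_real_indicator)
  from set_integrable_mult_bounded[OF this, of H B] assms(3,4) show ?thesis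
    by (simp add: measurable_completion)
qed

text \<open>Integrating by parts against each of the two distribution functions produces the two
  integrals of the representing pair, and the constant \<open>c\<close> is annihilated by
  derivatives of test functions.\<close>

lemma has_distr_deriv_cdf:
  assumes ab: "a < b" and \<rho>: "signed_measure {a<..<b} \<rho>" and r: "represents {a<..<b} \<rho> M K"
    and F: "F \<in> borel_measurable (lebesgue_on {a<..<b})"
    and FH: "AE x in lebesgue_on {a<..<b}. F x = c + cdf M x - cdf K x"
  shows "has_distr_deriv {a<..<b} F \<rho>"
    and "set_integrable lebesgue {a<..<b} F"
proof -
  define \<Omega> where "\<Omega> = {a<..<b}"
  define H where "H x = c + cdf M x - cdf K x" for x
  note on = represents_on1[OF r] represents_on2[OF r]
  have [measurable]: "cdf M \<in> borel_measurable borel" "cdf K \<in> borel_measurable borel"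
    using on by (auto intro: borel_measurable_cdf)
  have Hm [measurable]: "H \<in> borel_measurable borel" unfolding H_def by measurable
  have \<Omega> [measurable]: "\<Omega> \<in> sets borel" by (simp add: \<Omega>_def)
  have \<Omega>fin: "emeasure lborel \<Omega> < \<infinity>" by (simp add: \<Omega>_def emeasure_bounded_finite[unfolded infinity_ennreal_def])
  have HB: "\<bar>H x\<bar> \<le> \<bar>c\<bar> + measure M UNIV + measure K UNIV" for x
    using cdf_abs_le[OF on(1), of x] cdf_abs_le[OF on(2), of x] unfolding H_def by linarith
  have Hi: "set_integrable lebesgue \<Omega> H"
    by (rule set_integrable_lebesgue_bounded[OF \<Omega> \<Omega>fin Hm HB])
  have Fm: "(\<lambda>x. indicator \<Omega> x *\<^sub>R F x) \<in> borel_measurable lebesgue"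
    using F unfolding \<Omega>_def by (subst (asm) borel_measurable_restrict_space_iff) auto
  have AE: "AE x in lebesgue. x \<in> \<Omega> \<longrightarrow> F x = H x"
    using FH unfolding H_def \<Omega>_def by (simp add: AE_lebesgue_on_iff)
  have Fi: "set_integrable lebesgue \<Omega> F"
    using Hi unfolding set_integrable_def
    by (rule integrable_cong_AE_imp) (use Fm AE in \<open>auto elim!: eventually_mono simp: indicator_def\<close>)
  then show "set_integrable lebesgue {a<..<b} F" by (simp add: \<Omega>_def)
  have "(LINT x:\<Omega>|lebesgue. F x * deriv \<phi> x) = - signed_integral \<Omega> \<rho> \<Omega> \<phi>"
    if "\<phi> \<in> test_functions \<Omega>" for \<phi>
  proof -
    have \<phi>: "\<phi> \<in> test_functions {a<..<b}" using that by (simp add: \<Omega>_def)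
    note m [measurable] = test_function_measurable[OF \<phi>]
    obtain B where B: "\<And>x. \<bar>\<phi> x\<bar> \<le> B" "\<And>x. \<bar>deriv \<phi> x\<bar> \<le> B"
      using test_function_bounded[OF \<phi>] by blast
    have "(LINT x:\<Omega>|lebesgue. F x * deriv \<phi> x) = (LINT x:\<Omega>|lebesgue. H x * deriv \<phi> x)"
      unfolding set_lebesgue_integral_def
    proof (rule integral_cong_AE)
      have "(\<lambda>x. (indicator \<Omega> x *\<^sub>R F x) * deriv \<phi> x) \<in> borel_measurable lebesgue"
        using Fm m by (intro borel_measurable_times) (auto simp: measurable_completion)
      then show "(\<lambda>x. indicator \<Omega> x *\<^sub>R (F x * deriv \<phi> x)) \<in> borel_measurable lebesgue"
        by (simp add: mult.assoc)
      show "(\<lambda>x. indicator \<Omega> x *\<^sub>R (H x * deriv \<phi> x)) \<in> borel_measurable lebesgue"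
        by (rule measurable_completion) measurable
    qed (use AE in \<open>auto elim!: eventually_mono simp: indicator_def\<close>)
    also have "\<dots> = (LINT x:\<Omega>|lborel. H x * deriv \<phi> x)" by (rule set_integral_lebesgue) measurable
    also have "\<dots> = (LINT x:\<Omega>|lborel. c * deriv \<phi> x) + (LINT x:\<Omega>|lborel. cdf M x * deriv \<phi> x)
        - (LINT x:\<Omega>|lborel. cdf K x * deriv \<phi> x)"
    proof -
      have i: "set_integrable lborel \<Omega> (\<lambda>x. f x * deriv \<phi> x)"
        if [measurable]: "f \<in> borel_measurable borel" and fC: "\<And>x. \<bar>f x\<bar> \<le> C" for f :: "real \<Rightarrow> real" and C
      proof -
        have "set_integrable lebesgue \<Omega> (\<lambda>x. f x * deriv \<phi> x)"
          by (rule set_integrable_mult_bounded[OF set_integrable_lebesgue_bounded[OF \<Omega> \<Omega>fin _ fC] _ B(2)])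
            (auto intro: measurable_completion)
        then show ?thesis by (simp add: set_integrable_def integrable_completion)
      qed
      have i1: "set_integrable lborel \<Omega> (\<lambda>x. c * deriv \<phi> x)" by (rule i[of _ "\<bar>c\<bar>"]) auto
      have i2: "set_integrable lborel \<Omega> (\<lambda>x. cdf M x * deriv \<phi> x)" by (rule i[OF _ cdf_abs_le[OF on(1)]]) measurable
      have i3: "set_integrable lborel \<Omega> (\<lambda>x. cdf K x * deriv \<phi> x)" by (rule i[OF _ cdf_abs_le[OF on(2)]]) measurable
      have "(LINT x:\<Omega>|lborel. H x * deriv \<phi> x)
        = (LINT x:\<Omega>|lborel. (c * deriv \<phi> x + cdf M x * deriv \<phi> x) - cdf K x * deriv \<phi> x)"
        by (simp add: H_def algebra_simps)
      then show ?thesis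
        by (simp only: set_integral_diff(2)[OF set_integral_add(1)[OF i1 i2] i3] set_integral_add(2)[OF i1 i2])
    qed
    \<comment> \<open>The derivative of a compactly supported function has integral zero.\<close>
    also have "(LINT x:\<Omega>|lborel. c * deriv \<phi> x) = 0"
    proof -
      have "(LINT x:\<Omega>|lborel. deriv \<phi> x) = (LINT x:{a..b}|lborel. deriv \<phi> x)"
        unfolding set_lebesgue_integral_def \<Omega>_def
        by (rule Bochner_Integration.integral_cong)
          (use test_function_outside(2)[OF \<phi>] in \<open>auto simp: indicator_def\<close>)
      also have "\<dots> = 0" using test_function_FTC[OF \<phi>, of a] ab test_function_outside(1)[OF \<phi>, of a] by simp
      finally show ?thesis by simp
    qed
    also have "0 + (LINT x:\<Omega>|lborel. cdf M x * deriv \<phi> x) - (LINT x:\<Omega>|lborel. cdf K x * deriv \<phi> x)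
      = - ((LINT x:\<Omega>|M. \<phi> x) - (LINT x:\<Omega>|K. \<phi> x))"
      unfolding \<Omega>_def integral_cdf_deriv[OF on(1) \<phi>] integral_cdf_deriv[OF on(2) \<phi>] by simp
    also have "(LINT x:\<Omega>|M. \<phi> x) - (LINT x:\<Omega>|K. \<phi> x) = signed_integral \<Omega> \<rho> \<Omega> \<phi>"
      by (rule signed_integral_represents[symmetric, where B = B])
        (use \<rho> r B m in \<open>auto simp: \<Omega>_def borel_subsets_iff\<close>)
    finally show ?thesis .
  qed
  moreover have "integrable (lebesgue_on C) F" if "compact C" "C \<subseteq> \<Omega>" for C
    using that by (subst integrable_lebesgue_on_iff)
      (auto intro!: set_integrable_subset[OF Fi] borel_compact)
  ultimately show "has_distr_deriv {a<..<b} F \<rho>"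
    using \<rho> unfolding has_distr_deriv_def \<Omega>_def by blast
qed

section \<open>The lemma of du Bois-Reymond\<close>

text \<open>The primitive that vanishes at \<open>a\<close> is constant on either side of the
  support of \<open>\<tau>\<close>; zero mean makes the constant on the right zero too, so the
  primitive has compact support.\<close>

lemma ex_test_function_deriv:
  assumes \<tau>: "continuous_on UNIV \<tau>" and mM: "a < m" "m \<le> M" "M < b"
    and z: "\<And>x. x \<notin> {m<..<M} \<Longrightarrow> \<tau> x = 0" and mean: "integral\<^sup>L lborel \<tau> = (0 :: real)"
  shows "\<exists>\<phi>\<in>test_functions {a<..<b}. deriv \<phi> = \<tau>"
proof -
  have "\<exists>F. \<forall>x :: real. - \<infinity> < ereal x \<longrightarrow> ereal x < \<infinity> \<longrightarrow> (F has_vector_derivative \<tau> x) (at x)"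
    by (rule einterval_antiderivative) (use \<tau> in \<open>auto simp: continuous_on_eq_continuous_at\<close>)
  then obtain F where F: "\<And>x. (F has_real_derivative \<tau> x) (at x)"
    by (auto simp: has_real_derivative_iff_has_vector_derivative)
  have FTC: "(\<integral>x. \<tau> x * indicator {s..t} x \<partial>lborel) = F t - F s" if "s \<le> t" for s t
    by (rule integral_FTC_Icc_real) (use that F \<tau> in \<open>auto simp: continuous_on_eq_continuous_at\<close>)
  define \<phi> where "\<phi> x = F x - F a" for x
  have D: "(\<phi> has_real_derivative \<tau> x) (at x)" for x
    unfolding \<phi>_def using DERIV_diff[OF F[of x] DERIV_const[of "F a"]] by simp
  have left: "F x = F m" if "x \<le> m" for x
  proof -
    have "\<tau> y * indicator {x..m} y = 0" for y
      using z[of y] by (auto simp: indicator_def)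
    with FTC[OF that] show ?thesis by simp
  qed
  \<comment> \<open>The only place where the zero mean enters: the increment from \<open>a\<close>
    to any point beyond \<open>M\<close> is the full integral of \<open>\<tau>\<close>.\<close>
  have right: "F x = F a" if "M \<le> x" for x
  proof -
    have "\<tau> y * indicator {a..x} y = \<tau> y" for y
      by (cases "y \<in> {m<..<M}") (use z[of y] that mM in auto)
    with FTC[of a x] mean that mM show ?thesis by simp
  qed
  have supp: "{x. \<phi> x \<noteq> 0} \<subseteq> {m..M}"
  proof
    fix x assume "x \<in> {x. \<phi> x \<noteq> 0}"
    then have "F x \<noteq> F a" by (simp add: \<phi>_def)
    then have "\<not> x \<le> m" "\<not> M \<le> x" using left[of x] left[of a] right[of x] mM by auto
    then show "x \<in> {m..M}" by simp
  qed
  then have cl: "closure {x. \<phi> x \<noteq> 0} \<subseteq> {m..M}" by (intro closure_minimal) auto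
  have "\<phi> \<in> test_functions {a<..<b}"
    unfolding test_functions_def
  proof (intro CollectI conjI)
    show "\<phi> C1_differentiable_on UNIV"
      unfolding C1_differentiable_on_def using D \<tau>
      by (auto simp: has_real_derivative_iff_has_vector_derivative)
    show "compact (closure {x. \<phi> x \<noteq> 0})"
      using bounded_subset[OF bounded_closed_interval supp] by (simp add: compact_closure)
    show "closure {x. \<phi> x \<noteq> 0} \<subseteq> {a<..<b}" using cl mM by auto
  qed
  moreover have "deriv \<phi> = \<tau>" using D by (auto intro: DERIV_imp_deriv)
  ultimately show ?thesis by blast
qed

text \<open>A continuous trapezoid over \<open>{p<..<q}\<close> with edges of slope
  \<open>n\<close>. Derivatives of admissible test functions must be continuous, so indicators of
  intervals are approached by these.\<close>

definition tent :: "real \<Rightarrow> real \<Rightarrow> nat \<Rightarrow> real \<Rightarrow> real" where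
  "tent p q n x = max 0 (min 1 (real n * min (x - p) (q - x)))"

lemma continuous_tent: "continuous_on UNIV (tent p q n)"
  unfolding tent_def by (intro continuous_intros)

lemma tent_measurable [measurable]: "tent p q n \<in> borel_measurable borel"
  by (rule borel_measurable_continuous_onI[OF continuous_tent])

lemma tent_bounds: "0 \<le> tent p q n x" "tent p q n x \<le> 1" "\<bar>tent p q n x\<bar> \<le> 1"
  by (auto simp: tent_def)

lemma tent_outside:
  assumes "x \<notin> {p<..<q}"
  shows "tent p q n x = 0"
proof -
  have "min (x - p) (q - x) \<le> 0" using assms by auto
  then have "real n * min (x - p) (q - x) \<le> 0" by (intro mult_nonneg_nonpos) auto
  then show ?thesis unfolding tent_def by linarith
qed

lemma tent_limit: "(\<lambda>n. tent p q n x) \<longlonglongrightarrow> indicator {p<..<q} x"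
proof (cases "x \<in> {p<..<q}")
  case True
  define d where "d = min (x - p) (q - x)"
  have "d > 0" using True by (simp add: d_def)
  have "\<forall>\<^sub>F n in sequentially. tent p q n x = 1"
    using eventually_ge_at_top[of "nat \<lceil>1 / d\<rceil>"]
  proof eventually_elim
    case (elim n)
    then have "1 / d \<le> real n" by linarith
    then have "1 \<le> real n * d" using \<open>d > 0\<close> by (simp add: field_simps)
    then show ?case by (simp add: tent_def d_def[symmetric])
  qed
  then show ?thesis using True by (simp add: tendsto_eventually)
next
  case False
  then show ?thesis by (simp add: tent_outside)
qed

text \<open>Dominated convergence, with \<open>G\<close> cut off to the interval as the dominating
  function.\<close>

lemma tent_integral_limit:
  assumes "set_integrable lebesgue {p<..<q} (G :: real \<Rightarrow> real)"
  shows "(\<lambda>n. \<integral>x. G x * tent p q n x \<partial>lebesgue) \<longlonglongrightarrow> (LINT x:{p<..<q}|lebesgue. G x)"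
    and "integrable lebesgue (\<lambda>x. G x * tent p q n x)"
proof -
  define g where "g x = indicator {p<..<q} x * G x" for x
  have g: "integrable lebesgue g" using assms by (simp add: set_integrable_def g_def[abs_def])
  have eq: "G x * tent p q n x = g x * tent p q n x" for x n
    using tent_outside[of x p q n] by (auto simp: g_def indicator_def)
  have [measurable]: "g \<in> borel_measurable lebesgue" using g by simp
  have [measurable]: "tent p q n \<in> borel_measurable lebesgue" for n
    by (rule measurable_completion) simp
  have bd: "norm (g x * tent p q n x) \<le> norm (g x)" for x n
    using tent_bounds[of p q n x] by (auto simp: abs_mult mult_left_le)
  show "integrable lebesgue (\<lambda>x. G x * tent p q n x)"
    unfolding eq by (rule Bochner_Integration.integrable_bound[OF g]) (use bd in auto)
  show "(\<lambda>n. \<integral>x. G x * tent p q n x \<partial>lebesgue) \<longlonglongrightarrow> (LINT x:{p<..<q}|lebesgue. G x)"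
    unfolding eq set_lebesgue_integral_def
  proof (rule integral_dominated_convergence[where w = "\<lambda>x. norm (g x)"])
    show "AE x in lebesgue. (\<lambda>n. g x * tent p q n x) \<longlonglongrightarrow> indicator {p<..<q} x *\<^sub>R G x"
    proof (rule AE_I2)
      fix x
      have "(\<lambda>n. g x * tent p q n x) \<longlonglongrightarrow> g x * indicator {p<..<q} x"
        by (intro tendsto_intros tent_limit)
      then show "(\<lambda>n. g x * tent p q n x) \<longlonglongrightarrow> indicator {p<..<q} x *\<^sub>R G x"
        by (cases "x \<in> {p<..<q}") (simp_all add: g_def)
    qed
    show "(\<lambda>x. indicator {p<..<q} x *\<^sub>R G x) \<in> borel_measurable lebesgue"
      using g unfolding g_def by simp
  qed (use g bd in auto)
qed

text \<open>The Lebesgue measurable \<open>h\<close> is replaced by a Borel version; a Borel density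
  whose integrals over all Borel sets vanish is zero almost everywhere.\<close>

lemma AE_zero_of_set_integrals:
  fixes h :: "real \<Rightarrow> real"
  assumes [measurable]: "\<Omega> \<in> sets borel" and h: "set_integrable lebesgue \<Omega> h"
    and z: "\<And>A. A \<in> borel_subsets \<Omega> \<Longrightarrow> (LINT x:A|lebesgue. h x) = 0"
  shows "AE x in lebesgue. x \<in> \<Omega> \<longrightarrow> h x = 0"
proof -
  define f where "f x = indicator \<Omega> x * h x" for x
  have f: "integrable lebesgue f" using h by (simp add: set_integrable_def f_def[abs_def])
  then have fm: "f \<in> borel_measurable lebesgue" by simp
  obtain g where [measurable]: "g \<in> borel_measurable lborel" and fg: "AE x in lborel. f x = g x"
    using completion_ex_borel_measurable_real[OF fm] by blast
  have fg': "AE x in lebesgue. f x = g x" using fg by (rule AE_completion)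
  have g: "integrable lborel g"
  proof -
    have "integrable lebesgue g"
      by (rule integrable_cong_AE_imp[OF f]) (use fg' in \<open>auto intro: measurable_completion\<close>)
    then show ?thesis by (simp add: integrable_completion)
  qed
  have "AE x in lborel. g x = 0"
  proof (rule sigma_finite_measure.density_zero[OF sigma_finite_lborel g])
    fix A :: "real set" assume "A \<in> sets lborel"
    then have [measurable]: "A \<in> sets borel" by simp
    have "(LINT x:A|lborel. g x) = (LINT x:A|lebesgue. g x)"
      by (rule set_integral_lebesgue[symmetric]) measurable
    also have "\<dots> = (LINT x:A \<inter> \<Omega>|lebesgue. h x)"
      unfolding set_lebesgue_integral_def
    proof (rule integral_cong_AE)
      show "(\<lambda>x. indicator A x *\<^sub>R g x) \<in> borel_measurable lebesgue"
        by (rule measurable_completion) measurable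
      have "(\<lambda>x. indicator A x * f x) \<in> borel_measurable lebesgue"
        by (rule borel_measurable_times[OF measurable_completion fm]) measurable
      moreover have "indicator A x * f x = indicator (A \<inter> \<Omega>) x *\<^sub>R h x" for x
        by (simp add: f_def indicator_inter_arith)
      ultimately show "(\<lambda>x. indicator (A \<inter> \<Omega>) x *\<^sub>R h x) \<in> borel_measurable lebesgue" by simp
    qed (use fg' in \<open>auto elim!: eventually_mono simp: f_def indicator_def\<close>)
    also have "\<dots> = 0" by (rule z) (auto simp: borel_subsets_iff)
    finally show "(LINT x:A|lborel. g x) = 0" .
  qed
  then have "AE x in lborel. f x = 0" using fg by eventually_elim simp
  then have "AE x in lebesgue. f x = 0" by (rule AE_completion)
  then show ?thesis by eventually_elim (auto simp: f_def)
qed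

lemma set_integral_Ioc_Ioo:
  fixes f :: "real \<Rightarrow> real"
  assumes "set_integrable lebesgue {p<..q} f"
  shows "(LINT x:{p<..q}|lebesgue. f x) = (LINT x:{p<..<q}|lebesgue. f x)"
proof (rule set_integral_cong_set)
  have "AE x in lborel. x \<noteq> q" by (rule AE_lborel_singleton)
  then have "AE x in lebesgue. x \<noteq> q" by (rule AE_completion)
  then show "AE x in lebesgue. x \<in> {p<..<q} \<longleftrightarrow> x \<in> {p<..q}" by eventually_elim auto
  show "set_borel_measurable lebesgue {p<..q} f"
    using assms by (simp add: set_borel_measurable_def set_integrable_def)
  have "set_integrable lebesgue {p<..<q} f"
    using assms by (rule set_integrable_subset) auto
  then show "set_borel_measurable lebesgue {p<..<q} f"
    by (simp add: set_borel_measurable_def set_integrable_def)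
qed

lemma tent_integral: "integral\<^sup>L lebesgue (tent p q n) = integral\<^sup>L lborel (tent p q n)"
  by (rule integral_completion) simp

lemma tent_integrable: "integrable lborel (tent p q n)"
proof -
  have "set_integrable lebesgue {p<..<q} (\<lambda>x. 1 :: real)"
    by (rule set_integrable_lebesgue_bounded[where B = 1])
      (simp_all add: emeasure_bounded_finite[unfolded infinity_ennreal_def])
  from tent_integral_limit(2)[OF this] show ?thesis by (simp add: integrable_completion)
qed

lemma tent_mean_limit:
  assumes "p < q"
  shows "(\<lambda>n. integral\<^sup>L lborel (tent p q n)) \<longlonglongrightarrow> q - p"
proof -
  have "set_integrable lebesgue {p<..<q} (\<lambda>x. 1 :: real)"
    by (rule set_integrable_lebesgue_bounded[where B = 1])
      (simp_all add: emeasure_bounded_finite[unfolded infinity_ennreal_def])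
  from tent_integral_limit(1)[OF this]
  have "(\<lambda>n. integral\<^sup>L lebesgue (tent p q n)) \<longlonglongrightarrow> (LINT x:{p<..<q}|lebesgue. 1)" by simp
  also have "(LINT x:{p<..<q}|lebesgue. 1 :: real) = q - p"
    using assms by (simp add: set_lebesgue_integral_def)
  finally show ?thesis by (simp only: tent_integral)
qed

lemma set_integrable_Ioo_of_compact:
  assumes G: "\<And>C. compact C \<Longrightarrow> C \<subseteq> {a<..<b} \<Longrightarrow> integrable (lebesgue_on C) (G :: real \<Rightarrow> real)"
    and pq: "a < p" "q < b"
  shows "set_integrable lebesgue {p<..<q} G"
proof -
  have "integrable (lebesgue_on {p..q}) G" by (rule G) (use pq in auto)
  then have "set_integrable lebesgue {p..q} G" by (subst (asm) integrable_lebesgue_on_iff) auto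
  then show ?thesis by (rule set_integrable_subset) auto
qed

text \<open>Testing with primitives of differences of normalised tents shows that all interval
  averages of \<open>G\<close> agree.\<close>

lemma du_Bois_Reymond:
  assumes ab: "a < b"
    and G: "\<And>C. compact C \<Longrightarrow> C \<subseteq> {a<..<b} \<Longrightarrow> integrable (lebesgue_on C) (G :: real \<Rightarrow> real)"
    and z: "\<And>\<phi>. \<phi> \<in> test_functions {a<..<b} \<Longrightarrow> (LINT x:{a<..<b}|lebesgue. G x * deriv \<phi> x) = 0"
  shows "\<exists>c. AE x in lebesgue_on {a<..<b}. G x = c"
proof -
  have Gi: "set_integrable lebesgue {p<..<q} G" if "a < p" "q < b" for p q
    by (rule set_integrable_Ioo_of_compact[OF G that])
  \<comment> \<open>Equality of averages over two intervals, cross-multiplied.\<close>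
  have avg: "(s - r) * (LINT x:{p<..<q}|lebesgue. G x) = (q - p) * (LINT x:{r<..<s}|lebesgue. G x)"
    if pq: "a < p" "p < q" "q < b" and rs: "a < r" "r < s" "s < b" for p q r s
  proof -
    define I where "I p q n = integral\<^sup>L lborel (tent p q n)" for p q n
    have eq: "I r s n * (\<integral>x. G x * tent p q n x \<partial>lebesgue) = I p q n * (\<integral>x. G x * tent r s n x \<partial>lebesgue)" for n
    proof -
      \<comment> \<open>Each tent is weighted by the mass of the other, so \<open>\<tau>\<close> has
        mean zero and is the derivative of a test function.\<close>
      define \<tau> where "\<tau> x = I r s n * tent p q n x - I p q n * tent r s n x" for x
      have "\<exists>\<phi>\<in>test_functions {a<..<b}. deriv \<phi> = \<tau>"
      proof (rule ex_test_function_deriv[where m = "min p r" and M = "max q s"])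
        show "continuous_on UNIV \<tau>" unfolding \<tau>_def
          by (intro continuous_intros continuous_tent)
        show "\<tau> x = 0" if "x \<notin> {min p r<..<max q s}" for x
        proof -
          have "x \<notin> {p<..<q}" "x \<notin> {r<..<s}" using that by auto
          then show ?thesis by (simp add: \<tau>_def tent_outside)
        qed
        show "integral\<^sup>L lborel \<tau> = 0"
          unfolding \<tau>_def using tent_integrable[of p q n] tent_integrable[of r s n] by (simp add: I_def)
      qed (use pq rs in auto)
      then obtain \<phi> where \<phi>: "\<phi> \<in> test_functions {a<..<b}" "deriv \<phi> = \<tau>" by blast
      have "0 = (LINT x:{a<..<b}|lebesgue. G x * \<tau> x)" using z[OF \<phi>(1)] \<phi>(2) by simp
      also have "\<dots> = (\<integral>x. I r s n * (G x * tent p q n x) - I p q n * (G x * tent r s n x) \<partial>lebesgue)"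
        unfolding set_lebesgue_integral_def
      proof (rule Bochner_Integration.integral_cong)
        fix x
        show "indicator {a<..<b} x *\<^sub>R (G x * \<tau> x) =
            I r s n * (G x * tent p q n x) - I p q n * (G x * tent r s n x)"
        proof (cases "x \<in> {a<..<b}")
          case True then show ?thesis by (simp add: \<tau>_def algebra_simps)
        next
          case False
          then show ?thesis
            using pq rs tent_outside[of x p q n] tent_outside[of x r s n] by auto
        qed
      qed simp
      also have "\<dots> = I r s n * (\<integral>x. G x * tent p q n x \<partial>lebesgue) - I p q n * (\<integral>x. G x * tent r s n x \<partial>lebesgue)"
        using tent_integral_limit(2)[OF Gi[OF pq(1,3)], of n] tent_integral_limit(2)[OF Gi[OF rs(1,3)], of n]
        by simp
      finally show ?thesis by simp
    qed
    have 1: "(\<lambda>n. I r s n * (\<integral>x. G x * tent p q n x \<partial>lebesgue)) \<longlonglongrightarrow> (s - r) * (LINT x:{p<..<q}|lebesgue. G x)"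
      unfolding I_def using pq rs by (intro tendsto_mult tent_mean_limit tent_integral_limit(1) Gi)
    have "(\<lambda>n. I p q n * (\<integral>x. G x * tent r s n x \<partial>lebesgue)) \<longlonglongrightarrow> (q - p) * (LINT x:{r<..<s}|lebesgue. G x)"
      unfolding I_def using pq rs by (intro tendsto_mult tent_mean_limit tent_integral_limit(1) Gi)
    with 1 show ?thesis unfolding eq by (rule LIMSEQ_unique)
  qed
  \<comment> \<open>The middle third serves as a fixed reference interval; \<open>c\<close> is the
    average of \<open>G\<close> over it.\<close>
  define r s where "r = a + (b - a) / 3" and "s = a + 2 * (b - a) / 3"
  have rs: "a < r" "r < s" "s < b" using ab by (auto simp: r_def s_def field_simps)
  define c where "c = (LINT x:{r<..<s}|lebesgue. G x) / (s - r)"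
  have one: "set_integrable lebesgue {p<..<q} (\<lambda>x. c)" for p q :: real
    by (rule set_integrable_lebesgue_bounded[where B = "\<bar>c\<bar>"])
      (simp_all add: emeasure_bounded_finite[unfolded infinity_ennreal_def])
  have loc: "AE x in lebesgue. x \<in> {p<..<q} \<longrightarrow> G x - c = 0" if pq: "a < p" "p < q" "q < b" for p q
  proof -
    note Gpq = Gi[OF pq(1,3)]
    have i: "set_integrable lebesgue {p<..<q} (\<lambda>x. G x - c)"
      by (rule set_integral_diff(1)[OF Gpq one])
    \<comment> \<open>The integral of \<open>G - c\<close>, as a signed measure, vanishes on every
      \<open>{p<..x}\<close> by equality of averages, hence on all Borel sets.\<close>
    define \<nu> where "\<nu> A = (if A \<in> borel_subsets {p<..<q} then LINT x:A|lebesgue. G x - c else 0)" for A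
    have \<nu>: "signed_measure {p<..<q} \<nu>" unfolding \<nu>_def
      by (rule signed_measure_set_integral[OF _ _ i]) (auto simp: borel_subsets_iff)
    have "\<nu> A = 0" for A
    proof (rule signed_measure_eq_zeroI[OF pq(2) \<nu>])
      fix x assume x: "x \<in> {p<..<q}"
      then have px: "a < p" "p < x" "x < b" using pq by auto
      have "{p<..x} \<in> borel_subsets {p<..<q}" using x by (auto simp: borel_subsets_iff)
      moreover have "(LINT x:{p<..x}|lebesgue. G x - c) = (LINT x:{p<..<x}|lebesgue. G x - c)"
        by (rule set_integral_Ioc_Ioo) (rule set_integrable_subset[OF i], use x in auto)
      moreover have "\<dots> = (LINT x:{p<..<x}|lebesgue. G x) - (LINT x:{p<..<x}|lebesgue. c)"
        by (rule set_integral_diff(2)[OF Gi[OF px(1,3)] one])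
      moreover have "(LINT x:{p<..<x}|lebesgue. c) = c * (x - p)"
        using px by (simp add: set_lebesgue_integral_def)
      moreover have "(LINT x:{p<..<x}|lebesgue. G x) = c * (x - p)"
        using avg[OF px rs] rs by (simp add: c_def field_simps)
      ultimately show "\<nu> {p<..x} = 0" by (simp add: \<nu>_def)
    qed
    then have "(LINT x:A|lebesgue. G x - c) = 0" if "A \<in> borel_subsets {p<..<q}" for A
      using that by (simp add: \<nu>_def split: if_splits) metis
    then show ?thesis by (intro AE_zero_of_set_integrals[OF _ i]) auto
  qed
  \<comment> \<open>\<open>G\<close> is integrable only on compact pieces, so the interval is
    exhausted from inside; the summand 3 keeps the inner intervals nonempty already for
    \<open>n = 0\<close>.\<close>
  define e where "e n = (b - a) / (real n + 3)" for n
  have e: "0 < e n" "2 * e n < b - a" for n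
  proof -
    show "0 < e n" using ab by (simp add: e_def)
    have "2 * (b - a) < (b - a) * (real n + 3)"
      using mult_pos_pos[of "b - a" "real n + 1"] ab by (simp add: algebra_simps)
    then show "2 * e n < b - a" by (simp add: e_def pos_divide_less_eq)
  qed
  have "AE x in lebesgue. \<forall>n. x \<in> {a + e n<..<b - e n} \<longrightarrow> G x - c = 0"
  proof (subst AE_all_countable, intro allI)
    fix n
    show "AE x in lebesgue. x \<in> {a + e n<..<b - e n} \<longrightarrow> G x - c = 0"
      by (rule loc) (use e[of n] in auto)
  qed
  then have "AE x in lebesgue. x \<in> {a<..<b} \<longrightarrow> G x = c"
  proof eventually_elim
    case (elim x)
    show ?case
    proof
      assume x: "x \<in> {a<..<b}"
      have "e \<longlonglongrightarrow> 0" unfolding e_def by real_asymp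
      then have "\<forall>\<^sub>F n in sequentially. e n < min (x - a) (b - x)"
        using x by (intro order_tendstoD) auto
      then obtain n where "e n < min (x - a) (b - x)"
        unfolding eventually_sequentially by blast
      then have "x \<in> {a + e n<..<b - e n}" by auto
      then show "G x = c" using elim by auto
    qed
  qed
  then show ?thesis by (auto simp: AE_lebesgue_on_iff)
qed

section \<open>Uniqueness of the distributional derivative and the Leibniz rule\<close>

lemma borel_lebesgue_on:
  "H \<in> borel_measurable borel \<Longrightarrow> (H :: real \<Rightarrow> real) \<in> borel_measurable (lebesgue_on \<Omega>)"
  by (intro measurable_restrict_space1 measurable_completion) simp

text \<open>The difference of the two distribution functions has the same derivative
  \<open>\<nu>\<close>, so \<open>F\<close> minus this difference is annihilated by all derivatives
  of test functions and is constant.\<close>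

lemma has_distr_deriv_AE_cdf:
  assumes ab: "a < b" and F: "has_distr_deriv {a<..<b} F \<nu>" and r: "represents {a<..<b} \<nu> M K"
  shows "\<exists>c. AE x in lebesgue_on {a<..<b}. F x = c + cdf M x - cdf K x"
proof -
  define H where "H x = 0 + cdf M x - cdf K x" for x
  note on = represents_on1[OF r] represents_on2[OF r]
  have [measurable]: "cdf M \<in> borel_measurable borel" "cdf K \<in> borel_measurable borel"
    using on by (auto intro: borel_measurable_cdf)
  have Hm: "H \<in> borel_measurable borel" unfolding H_def by measurable
  have \<nu>: "signed_measure {a<..<b} \<nu>" using F by (simp add: has_distr_deriv_def)
  have H: "has_distr_deriv {a<..<b} H \<nu>"
    by (rule has_distr_deriv_cdf[OF ab \<nu> r borel_lebesgue_on[OF Hm], of 0]) (simp add: H_def)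
  \<comment> \<open>Local integrability suffices because the test function confines the product to a
    compact set.\<close>
  have int: "set_integrable lebesgue {a<..<b} (\<lambda>x. f x * deriv \<phi> x)"
    if f: "has_distr_deriv {a<..<b} f \<nu>" and \<phi>: "\<phi> \<in> test_functions {a<..<b}" for f \<phi>
  proof -
    obtain C where C: "compact C" "C \<subseteq> {a<..<b}" "\<And>x. x \<notin> C \<Longrightarrow> deriv \<phi> x = 0"
      using test_function_support[OF \<phi>] by metis
    obtain B where B: "\<And>x. \<bar>deriv \<phi> x\<bar> \<le> B" using test_function_bounded[OF \<phi>] by blast
    have "integrable (lebesgue_on C) f" using f C(1,2) by (simp add: has_distr_deriv_def)
    then have "set_integrable lebesgue C f"
      using integrable_lebesgue_on_iff[OF borel_compact[OF C(1)]] by blast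
    then have "set_integrable lebesgue C (\<lambda>x. f x * deriv \<phi> x)"
      by (rule set_integrable_mult_bounded[OF _ _ B])
        (rule measurable_completion, use test_function_measurable(2)[OF \<phi>] in simp)
    moreover have "(\<lambda>x. indicator C x *\<^sub>R (f x * deriv \<phi> x)) =
        (\<lambda>x. indicator {a<..<b} x *\<^sub>R (f x * deriv \<phi> x))"
      using C(2,3) by (auto simp: indicator_def fun_eq_iff)
    ultimately show ?thesis by (simp only: set_integrable_def)
  qed
  have "\<exists>c. AE x in lebesgue_on {a<..<b}. F x - H x = c"
  proof (rule du_Bois_Reymond[OF ab])
    fix C :: "real set" assume "compact C" "C \<subseteq> {a<..<b}"
    then show "integrable (lebesgue_on C) (\<lambda>x. F x - H x)"
      using F H by (simp add: has_distr_deriv_def)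
  next
    fix \<phi> assume \<phi>: "\<phi> \<in> test_functions {a<..<b}"
    have "(LINT x:{a<..<b}|lebesgue. (F x - H x) * deriv \<phi> x) =
        (LINT x:{a<..<b}|lebesgue. F x * deriv \<phi> x) - (LINT x:{a<..<b}|lebesgue. H x * deriv \<phi> x)"
      using set_integral_diff(2)[OF int[OF F \<phi>] int[OF H \<phi>]] by (simp add: left_diff_distrib)
    also have "\<dots> = 0" using F H \<phi> by (simp add: has_distr_deriv_def)
    finally show "(LINT x:{a<..<b}|lebesgue. (F x - H x) * deriv \<phi> x) = 0" .
  qed
  then obtain c where "AE x in lebesgue_on {a<..<b}. F x - H x = c" by blast
  then have "AE x in lebesgue_on {a<..<b}. F x = c + cdf M x - cdf K x"
    by (rule eventually_mono) (auto simp: H_def)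
  then show ?thesis by blast
qed

lemma tendsto_cdf_at_right: "finite_borel_on \<Omega> M \<Longrightarrow> (cdf M \<longlongrightarrow> cdf M y) (at_right y)"
  using finite_borel_measure.cdf_is_right_cont[OF finite_borel_on_borel_measure]
  by (simp add: continuous_within)

lemma tendsto_cdf_at_left: "finite_borel_on \<Omega> M \<Longrightarrow> (cdf M \<longlongrightarrow> measure M {..<y}) (at_left y)"
  by (rule finite_borel_measure.cdf_at_left[OF finite_borel_on_borel_measure])

lemma right_limit_cdf:
  assumes "represents {a<..<b} \<nu> M K" "AE x in lebesgue_on {a<..<b}. F x = c + cdf M x - cdf K x"
    and "a \<le> y" "y < b"
  shows "right_limit F y = c + cdf M y - cdf K y"
  by (rule right_limit_eqI[OF assms(2-4)])
    (intro tendsto_intros tendsto_cdf_at_right[OF represents_on1[OF assms(1)]]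
      tendsto_cdf_at_right[OF represents_on2[OF assms(1)]])

lemma left_limit_cdf:
  assumes "represents {a<..<b} \<nu> M K" "AE x in lebesgue_on {a<..<b}. F x = c + cdf M x - cdf K x"
    and "a < y" "y \<le> b"
  shows "left_limit F y = c + measure M {..<y} - measure K {..<y}"
  by (rule left_limit_eqI[OF assms(2-4)])
    (intro tendsto_intros tendsto_cdf_at_left[OF represents_on1[OF assms(1)]]
      tendsto_cdf_at_left[OF represents_on2[OF assms(1)]])

lemma cdf_start: "a < b \<Longrightarrow> finite_borel_on {a<..<b} M \<Longrightarrow> cdf M a = 0"
  by (simp add: cdf_eq_Ioc)

lemma represents_cdf:
  assumes r: "represents {a<..<b} \<nu> M K" and x: "x \<in> {a<..<b}"
  shows "\<nu> {a<..x} = cdf M x - cdf K x"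
proof -
  have "{a<..x} \<in> borel_subsets {a<..<b}" using x by (auto simp: borel_subsets_iff)
  then show ?thesis
    using x represents_eq[OF r, of "{a<..x}"] cdf_eq_Ioc[OF represents_on1[OF r], of x]
      cdf_eq_Ioc[OF represents_on2[OF r], of x] by simp
qed

text \<open>Essential right limits recover both distribution function representations everywhere,
  not just almost everywhere.\<close>

lemma has_distr_deriv_unique:
  assumes ab: "a < b" and 1: "has_distr_deriv {a<..<b} F \<nu>" and 2: "has_distr_deriv {a<..<b} F \<nu>'"
  shows "\<nu> = \<nu>'"
proof
  fix A
  have \<nu>: "signed_measure {a<..<b} \<nu>" "signed_measure {a<..<b} \<nu>'"
    using 1 2 by (simp_all add: has_distr_deriv_def)
  obtain M K where r: "represents {a<..<b} \<nu> M K" using ex_represents[OF _ \<nu>(1)] by auto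
  obtain M' K' where r': "represents {a<..<b} \<nu>' M' K'" using ex_represents[OF _ \<nu>(2)] by auto
  obtain c where c: "AE x in lebesgue_on {a<..<b}. F x = c + cdf M x - cdf K x"
    using has_distr_deriv_AE_cdf[OF ab 1 r] by blast
  obtain c' where c': "AE x in lebesgue_on {a<..<b}. F x = c' + cdf M' x - cdf K' x"
    using has_distr_deriv_AE_cdf[OF ab 2 r'] by blast
  have eq: "c + cdf M y - cdf K y = c' + cdf M' y - cdf K' y" if "a \<le> y" "y < b" for y
    using right_limit_cdf[OF r c that] right_limit_cdf[OF r' c' that] by simp
  \<comment> \<open>All four distribution functions vanish at \<open>a\<close>, which separates the
    constants from the measures.\<close>
  have cc: "c = c'"
    using eq[of a] ab cdf_start[OF ab represents_on1[OF r]] cdf_start[OF ab represents_on2[OF r]]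
      cdf_start[OF ab represents_on1[OF r']] cdf_start[OF ab represents_on2[OF r']] by simp
  have "\<nu> A + (- \<nu>' A) = 0"
  proof (rule signed_measure_eq_zeroI[OF ab])
    show "signed_measure {a<..<b} (\<lambda>A. \<nu> A + (- \<nu>' A))"
      by (rule signed_measure_add[OF \<nu>(1) signed_measure_uminus[OF \<nu>(2)]])
    show "\<nu> {a<..x} + (- \<nu>' {a<..x}) = 0" if "x \<in> {a<..<b}" for x
      using eq[of x] that cc by (simp add: represents_cdf[OF r that] represents_cdf[OF r' that])
  qed
  then show "\<nu> A = \<nu>' A" by simp
qed

lemma distr_deriv_eqI:
  assumes "a < b" "has_distr_deriv {a<..<b} F \<nu>"
  shows "distr_deriv {a<..<b} F = \<nu>"
  unfolding distr_deriv_def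
  by (rule the_equality) (use assms has_distr_deriv_unique in blast)+

lemma set_integral_on:
  fixes f :: "real \<Rightarrow> real"
  assumes M: "finite_borel_on \<Omega> M" and [measurable]: "\<Omega> \<in> sets borel" "A \<in> sets borel"
    "f \<in> borel_measurable borel"
  shows "(LINT x:A|M. f x) = (LINT x:A \<inter> \<Omega>|M. f x)"
proof -
  note [measurable_cong] = finite_borel_on_sets[OF M]
  have "- \<Omega> \<in> null_sets M"
    using finite_borel_on_null[OF M] by (auto simp: null_sets_def finite_borel_on_sets[OF M])
  from AE_not_in[OF this] have ae: "AE x in M. x \<in> \<Omega>" by eventually_elim simp
  show ?thesis unfolding set_lebesgue_integral_def
    by (rule integral_cong_AE) (measurable, use ae in \<open>eventually_elim, auto simp: indicator_def\<close>)
qed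

text \<open>Splits the product measure of the square \<open>{..x} \<times> {..x}\<close> along the diagonal: a share \<open>1 - \<kappa>\<close> of
  the diagonal goes to the first integral and the share \<open>\<kappa>\<close> to the second.\<close>

lemma leibniz_cdf:
  assumes M: "finite_borel_on \<Omega> M" and K: "finite_borel_on \<Omega> K"
    and \<kappa> [measurable]: "\<kappa> \<in> borel_measurable borel" and \<kappa>1: "\<And>x. 0 \<le> \<kappa> x" "\<And>x. \<kappa> x \<le> 1"
  shows "(LINT s:{..x}|K. \<kappa> s * measure M {..<s} + (1 - \<kappa> s) * cdf M s) +
    (LINT t:{..x}|M. \<kappa> t * cdf K t + (1 - \<kappa> t) * measure K {..<t}) = cdf M x * cdf K x"
proof -
  interpret M: finite_borel_measure M using M by (rule finite_borel_on_borel_measure)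
  interpret K: finite_borel_measure K using K by (rule finite_borel_on_borel_measure)
  note [measurable_cong] = M.M_is_borel K.M_is_borel
  \<comment> \<open>\<open>s\<close> is the variable of \<open>K\<close> and \<open>t\<close> that
    of \<open>M\<close>. The kernel \<open>k\<close> covers the triangle \<open>t < s\<close> and
    \<open>l\<close> the triangle \<open>s < t\<close>; the diagonal is shared between them.\<close>
  define k where "k s t = of_bool (s \<le> x) * of_bool (t \<le> x) *
      (of_bool (t < s) + (1 - \<kappa> s) * of_bool (t = s))" for s t
  define l where "l s t = of_bool (s \<le> x) * of_bool (t \<le> x) *
      (of_bool (s < t) + \<kappa> t * of_bool (s = t))" for s t
  have km: "(\<lambda>(t, s). k s t) \<in> borel_measurable (borel \<Otimes>\<^sub>M borel)"
    "(\<lambda>(t, s). l s t) \<in> borel_measurable (borel \<Otimes>\<^sub>M borel)"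
    unfolding k_def l_def of_bool_def by measurable
  have ks: "(\<lambda>s. k s t) \<in> borel_measurable borel" "(\<lambda>s. l s t) \<in> borel_measurable borel" for t
    unfolding k_def l_def of_bool_def by measurable
  have kB: "\<bar>k s t\<bar> \<le> 1" "\<bar>l s t\<bar> \<le> 1" for s t
    using \<kappa>1[of s] \<kappa>1[of t] by (auto simp: k_def l_def)
  have cdf_split: "cdf N s = measure N {..<s} + measure N {s}" if "finite_borel_measure N" for N s
  proof -
    interpret N: finite_borel_measure N by fact
    have "measure N ({..<s} \<union> {s}) = measure N {..<s} + measure N {s}"
      by (rule N.finite_measure_Union) (auto simp: N.M_is_borel)
    then show ?thesis unfolding cdf_def ivl_disj_un(2)[symmetric] .
  qed
  have step: "(\<integral>t. of_bool (s \<le> x) * (indicator {..<s} t + y * indicator {s} t) \<partial>N) =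
      indicator {..x} s * (measure N {..<s} + y * measure N {s})"
    if "finite_borel_measure N" for N s and y :: real
  proof -
    interpret N: finite_borel_measure N by fact
    note [measurable_cong] = N.M_is_borel
    have "(\<integral>t. indicator {..<s} t + y * indicator {s} t \<partial>N) = measure N {..<s} + y * measure N {s}"
      by (subst Bochner_Integration.integral_add) (auto simp: N.M_is_borel less_top[symmetric])
    then show ?thesis by (simp add: indicator_def)
  qed
  have in1: "(\<integral>t. k s t \<partial>M) = indicator {..x} s * (\<kappa> s * measure M {..<s} + (1 - \<kappa> s) * cdf M s)" for s
  proof -
    have "k s t = of_bool (s \<le> x) * (indicator {..<s} t + (1 - \<kappa> s) * indicator {s} t)" for t
      by (auto simp: k_def indicator_def)
    then have "(\<integral>t. k s t \<partial>M) = indicator {..x} s * (measure M {..<s} + (1 - \<kappa> s) * measure M {s})"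
      by (simp only: step[OF M.finite_borel_measure_axioms])
    then show ?thesis
      unfolding cdf_split[OF M.finite_borel_measure_axioms] by (simp add: algebra_simps)
  qed
  have in2: "(\<integral>s. l s t \<partial>K) = indicator {..x} t * (\<kappa> t * cdf K t + (1 - \<kappa> t) * measure K {..<t})" for t
  proof -
    have "l s t = of_bool (t \<le> x) * (indicator {..<t} s + \<kappa> t * indicator {t} s)" for s
      by (auto simp: l_def indicator_def)
    then have "(\<integral>s. l s t \<partial>K) = indicator {..x} t * (measure K {..<t} + \<kappa> t * measure K {t})"
      by (simp only: step[OF K.finite_borel_measure_axioms])
    then show ?thesis
      unfolding cdf_split[OF K.finite_borel_measure_axioms] by (simp add: algebra_simps)
  qed
  have ki: "integrable K (\<lambda>s. k s t)" "integrable K (\<lambda>s. l s t)" for t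
    using ks kB by (auto intro!: K.integrable_const_bound[of _ 1])
  \<comment> \<open>The diagonal shares add up to 1, so \<open>k + l\<close> is the indicator of the
    whole square.\<close>
  have sum: "(\<integral>s. k s t \<partial>K) + (\<integral>s. l s t \<partial>K) = indicator {..x} t * cdf K x" for t
  proof -
    have "k s t + l s t = of_bool (t \<le> x) * indicator {..x} s" for s
      by (auto simp: k_def l_def indicator_def)
    then have "(\<integral>s. k s t \<partial>K) + (\<integral>s. l s t \<partial>K) = (\<integral>s. of_bool (t \<le> x) * indicator {..x} s \<partial>K)"
      using ki by (simp add: Bochner_Integration.integral_add[symmetric] del: Bochner_Integration.integral_add)
    also have "\<dots> = of_bool (t \<le> x) * cdf K x" by (simp add: cdf_def K.M_is_borel)
    finally show ?thesis by (simp add: indicator_def)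
  qed
  have "(LINT s:{..x}|K. \<kappa> s * measure M {..<s} + (1 - \<kappa> s) * cdf M s) = (\<integral>s. (\<integral>t. k s t \<partial>M) \<partial>K)"
    by (simp add: in1 set_lebesgue_integral_def)
  also have "\<dots> = (\<integral>t. (\<integral>s. k s t \<partial>K) \<partial>M)"
    by (rule Fubini_bounded[OF M.finite_measure_axioms M.M_is_borel K.finite_measure_axioms K.M_is_borel km(1) kB(1)])
  finally have A: "(LINT s:{..x}|K. \<kappa> s * measure M {..<s} + (1 - \<kappa> s) * cdf M s) = (\<integral>t. (\<integral>s. k s t \<partial>K) \<partial>M)" .
  have B: "(LINT t:{..x}|M. \<kappa> t * cdf K t + (1 - \<kappa> t) * measure K {..<t}) = (\<integral>t. (\<integral>s. l s t \<partial>K) \<partial>M)"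
    by (simp add: in2 set_lebesgue_integral_def)
  have mi: "integrable M (\<lambda>t. \<integral>s. f s t \<partial>K)"
    if f: "(\<lambda>(t, s). f s t) \<in> borel_measurable (borel \<Otimes>\<^sub>M borel)" and fB: "\<And>s t. \<bar>f s t\<bar> \<le> 1"
    for f :: "real \<Rightarrow> real \<Rightarrow> real"
  proof (rule M.integrable_const_bound[of _ "measure K UNIV"])
    have [measurable]: "(\<lambda>(t, s). f s t) \<in> borel_measurable (M \<Otimes>\<^sub>M K)" using f by measurable
    show "(\<lambda>t. \<integral>s. f s t \<partial>K) \<in> borel_measurable M" by measurable
    show "AE t in M. norm (\<integral>s. f s t \<partial>K) \<le> measure K UNIV"
    proof (rule AE_I2)
      fix t
      have "norm (\<integral>s. f s t \<partial>K) \<le> (\<integral>s. norm (f s t) \<partial>K)" by (rule integral_norm_bound)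
      also have "\<dots> \<le> (\<integral>s. 1 \<partial>K)"
        by (rule integral_mono') (use fB in auto)
      finally show "norm (\<integral>s. f s t \<partial>K) \<le> measure K UNIV" by (simp add: K.borel_UNIV)
    qed
  qed
  have "integrable M (\<lambda>t. \<integral>s. k s t \<partial>K)" "integrable M (\<lambda>t. \<integral>s. l s t \<partial>K)"
    by (rule mi[OF km(1) kB(1)]) (rule mi[OF km(2) kB(2)])
  then have "(\<integral>t. (\<integral>s. k s t \<partial>K) \<partial>M) + (\<integral>t. (\<integral>s. l s t \<partial>K) \<partial>M) = (\<integral>t. indicator {..x} t * cdf K x \<partial>M)"
    by (simp add: Bochner_Integration.integral_add[symmetric] sum del: Bochner_Integration.integral_add)
  also have "\<dots> = cdf M x * cdf K x" by (simp add: cdf_def M.M_is_borel)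
  finally show ?thesis unfolding A B .
qed

section \<open>The pairing as an integral against the derivative\<close>

text \<open>The value assigned at a jump of the distribution function: weight
  \<open>\<kappa>\<close> on the left limit, the rest on the right limit. Away from atoms this is
  just \<open>cdf M\<close>.\<close>

definition cdf_mix :: "(real \<Rightarrow> real) \<Rightarrow> real measure \<Rightarrow> real \<Rightarrow> real" where
  "cdf_mix \<kappa> M s = \<kappa> s * measure M {..<s} + (1 - \<kappa> s) * cdf M s"

lemma measure_lessThan_bounds:
  assumes "finite_borel_on \<Omega> M"
  shows "measure M {..<s} \<le> cdf M s" "cdf M s \<le> measure M UNIV"
proof -
  interpret finite_borel_measure M using assms by (rule finite_borel_on_borel_measure)
  show "measure M {..<s} \<le> cdf M s" "cdf M s \<le> measure M UNIV"
    unfolding cdf_def by (auto intro!: finite_measure_mono simp: M_is_borel)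
qed

lemma borel_measurable_measure_lessThan:
  assumes M: "finite_borel_on \<Omega> M"
  shows "(\<lambda>s. measure M {..<s}) \<in> borel_measurable borel"
proof (rule borel_measurable_mono, rule monoI)
  interpret finite_borel_measure M using M by (rule finite_borel_on_borel_measure)
  show "measure M {..<s} \<le> measure M {..<t}" if "s \<le> t" for s t
    using that by (intro finite_measure_mono) (auto simp: M_is_borel)
qed

lemma borel_measurable_cdf_mix:
  assumes "finite_borel_on \<Omega> M" "\<kappa> \<in> borel_measurable borel"
  shows "cdf_mix \<kappa> M \<in> borel_measurable borel"
  using borel_measurable_cdf[OF assms(1)] borel_measurable_measure_lessThan[OF assms(1)] assms(2)
  unfolding cdf_mix_def by measurable

lemma cdf_mix_bound:
  assumes M: "finite_borel_on \<Omega> M" and \<kappa>: "0 \<le> \<kappa> s" "\<kappa> s \<le> 1"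
  shows "\<bar>cdf_mix \<kappa> M s\<bar> \<le> measure M UNIV"
proof -
  have "0 \<le> cdf_mix \<kappa> M s" unfolding cdf_mix_def using \<kappa> by (auto simp: cdf_def)
  moreover have "cdf_mix \<kappa> M s \<le> measure M UNIV" unfolding cdf_mix_def
    by (rule convex_bound_le) (use measure_lessThan_bounds[OF M, of s] \<kappa> in auto)
  ultimately show ?thesis by simp
qed

lemma leibniz_cdf_mix:
  assumes "finite_borel_on \<Omega> M" "finite_borel_on \<Omega> K" "\<kappa> \<in> borel_measurable borel"
    "\<And>x. 0 \<le> \<kappa> x" "\<And>x. \<kappa> x \<le> 1"
  shows "(LINT s:{..x}|K. cdf_mix \<kappa> M s) + (LINT t:{..x}|M. cdf_mix (\<lambda>s. 1 - \<kappa> s) K t) = cdf M x * cdf K x"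
  using leibniz_cdf[OF assms, of x] unfolding cdf_mix_def by (simp add: add.commute)

lemma set_integral_cdf_mix:
  assumes N: "finite_borel_on \<Omega>' N" and M: "finite_borel_on \<Omega> M" and K: "finite_borel_on \<Omega> K"
    and \<kappa>: "\<kappa> \<in> borel_measurable borel" "\<And>x. 0 \<le> \<kappa> x" "\<And>x. \<kappa> x \<le> 1"
    and A: "A \<in> sets borel"
  shows "(LINT s:A|N. d + cdf_mix \<kappa> M s - cdf_mix \<kappa> K s) =
    d * measure N A + (LINT s:A|N. cdf_mix \<kappa> M s) - (LINT s:A|N. cdf_mix \<kappa> K s)"
proof -
  have i: "set_integrable N A (\<lambda>s. d)"
    by (rule set_integrable_bounded[OF N _ A, of _ "\<bar>d\<bar>"]) auto
  have i1: "set_integrable N A (cdf_mix \<kappa> M)"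
    by (rule set_integrable_bounded[OF N borel_measurable_cdf_mix[OF M \<kappa>(1)] A cdf_mix_bound[of \<Omega>]])
      (use M \<kappa> in auto)
  have i2: "set_integrable N A (cdf_mix \<kappa> K)"
    by (rule set_integrable_bounded[OF N borel_measurable_cdf_mix[OF K \<kappa>(1)] A cdf_mix_bound[of \<Omega>]])
      (use K \<kappa> in auto)
  have "(LINT s:A|N. d) = d * measure N A"
    using A finite_borel_on_sets[OF N] by (simp add: set_lebesgue_integral_def)
  then show ?thesis
    using set_integral_diff(2)[OF set_integral_add(1)[OF i i1] i2] set_integral_add(2)[OF i i1] by simp
qed

text \<open>Bilinearity reduces the claim to four products of distribution functions of positive
  measures. The constants contribute through the masses of \<open>{a<..x}\<close>, and
  \<open>d * c\<close> is the value of the product at \<open>a\<close>.\<close>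

lemma leibniz_signed:
  assumes r: "represents {a<..<b} \<nu> M1 M2" and q: "represents {a<..<b} \<mu> K1 K2"
    and \<kappa>: "\<kappa> \<in> borel_measurable borel" "\<And>x. 0 \<le> \<kappa> x" "\<And>x. \<kappa> x \<le> 1"
    and U: "U = (\<lambda>s. d + cdf_mix \<kappa> M1 s - cdf_mix \<kappa> M2 s)"
    and V: "V = (\<lambda>s. c + cdf_mix (\<lambda>s. 1 - \<kappa> s) K1 s - cdf_mix (\<lambda>s. 1 - \<kappa> s) K2 s)"
    and x: "x \<in> {a<..<b}"
  shows "((LINT s:{a<..x}|K1. U s) - (LINT s:{a<..x}|K2. U s)) +
      ((LINT s:{a<..x}|M1. V s) - (LINT s:{a<..x}|M2. V s)) =
    (d + cdf M1 x - cdf M2 x) * (c + cdf K1 x - cdf K2 x) - d * c"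
proof -
  note M = represents_on1[OF r] represents_on2[OF r] and K = represents_on1[OF q] represents_on2[OF q]
  have \<kappa>': "(\<lambda>s. 1 - \<kappa> s) \<in> borel_measurable borel" "\<And>x. 0 \<le> 1 - \<kappa> x" "\<And>x. 1 - \<kappa> x \<le> 1"
    using \<kappa> by auto
  have Um: "U \<in> borel_measurable borel"
    unfolding U using borel_measurable_cdf_mix[OF M(1) \<kappa>(1)] borel_measurable_cdf_mix[OF M(2) \<kappa>(1)] by measurable
  have Vm: "V \<in> borel_measurable borel"
    unfolding V using borel_measurable_cdf_mix[OF K(1) \<kappa>'(1)] borel_measurable_cdf_mix[OF K(2) \<kappa>'(1)] by measurable
  have to: "(LINT s:{a<..x}|N. f s) = (LINT s:{..x}|N. f s)"
    if "finite_borel_on {a<..<b} N" "f \<in> borel_measurable borel" for N and f :: "real \<Rightarrow> real"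
  proof -
    have "{..x} \<inter> {a<..<b} = {a<..x} \<inter> {a<..<b}" using x by auto
    then show ?thesis
      using set_integral_on[OF that(1) _ _ that(2), of "{a<..x}"] set_integral_on[OF that(1) _ _ that(2), of "{..x}"]
      by simp
  qed
  have IU: "(LINT s:{a<..x}|N. U s) =
      d * cdf N x + (LINT s:{..x}|N. cdf_mix \<kappa> M1 s) - (LINT s:{..x}|N. cdf_mix \<kappa> M2 s)"
    if N: "finite_borel_on {a<..<b} N" for N
    unfolding to[OF N Um] unfolding U cdf_def by (rule set_integral_cdf_mix[OF N M \<kappa>]) simp
  have IV: "(LINT s:{a<..x}|N. V s) = c * cdf N x + (LINT s:{..x}|N. cdf_mix (\<lambda>s. 1 - \<kappa> s) K1 s)
      - (LINT s:{..x}|N. cdf_mix (\<lambda>s. 1 - \<kappa> s) K2 s)"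
    if N: "finite_borel_on {a<..<b} N" for N
    unfolding to[OF N Vm] unfolding V cdf_def by (rule set_integral_cdf_mix[OF N K \<kappa>']) simp
  have expand: "(d + m1 - m2) * (c + k1 - k2) - d * c =
    d * k1 - d * k2 + c * m1 - c * m2 + m1 * k1 - m1 * k2 - m2 * k1 + m2 * k2" for m1 m2 k1 k2
    by (simp add: algebra_simps)
  show ?thesis
    unfolding IU[OF K(1)] IU[OF K(2)] IV[OF M(1)] IV[OF M(2)] expand
    using leibniz_cdf_mix[OF M(1) K(1) \<kappa>, of x] leibniz_cdf_mix[OF M(1) K(2) \<kappa>, of x]
      leibniz_cdf_mix[OF M(2) K(1) \<kappa>, of x] leibniz_cdf_mix[OF M(2) K(2) \<kappa>, of x]
    by linarith
qed

text \<open>Turns the larger/smaller convention into a left/right one: the weight flips with the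
  sign of the jump.\<close>

lemma u_lambda_eq:
  assumes "left_limit u x = l" "right_limit u x = r"
    and "k = (if l \<le> r then 1 - lam x else lam x)"
  shows "u_lambda lam u x = k * l + (1 - k) * r"
  using assms by (auto simp: u_lambda_def u_upper_def u_lower_def max_def min_def algebra_simps)

text \<open>By the Leibniz rule the derivative of \<open>u * T\<close> is
  \<open>U \<mu> + V \<nu>\<close>. The weights are arranged so that \<open>U\<close> is the
  \<lambda>-representative of \<open>u\<close>; subtracting its integral against
  \<open>\<mu>\<close> leaves \<open>V \<nu>\<close>.\<close>

lemma pairing_eq_signed_integral:
  assumes ab: "a < b" and \<nu>: "signed_measure {a<..<b} \<nu>" and \<mu>: "signed_measure {a<..<b} \<mu>"
    and r: "represents {a<..<b} \<nu> M1 M2" and q: "represents {a<..<b} \<mu> K1 K2"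
    and um: "u \<in> borel_measurable (lebesgue_on {a<..<b})" and Tm: "T \<in> borel_measurable (lebesgue_on {a<..<b})"
    and u: "AE x in lebesgue_on {a<..<b}. u x = d + cdf M1 x - cdf M2 x"
    and T: "AE x in lebesgue_on {a<..<b}. T x = c + cdf K1 x - cdf K2 x"
    and lam: "lam \<in> borel_measurable (restrict_space borel {a<..<b})"
      "\<And>x. x \<in> {a<..<b} \<Longrightarrow> 0 \<le> lam x \<and> lam x \<le> 1"
  obtains k V where "\<And>x. 0 \<le> k x" "\<And>x. k x \<le> (1 :: real)"
    and "V = (\<lambda>x. k x * (c + cdf K1 x - cdf K2 x) + (1 - k x) * (c + measure K1 {..<x} - measure K2 {..<x}))"
    and "V \<in> borel_measurable borel" "\<And>x. \<bar>V x\<bar> \<le> \<bar>c\<bar> + measure K1 UNIV + measure K2 UNIV"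
    and "\<And>A. A \<in> borel_subsets {a<..<b} \<Longrightarrow> pairing {a<..<b} T u lam A = signed_integral {a<..<b} \<nu> A V"
proof -
  define \<Omega> where "\<Omega> = {a<..<b}"
  have \<Omega> [measurable]: "\<Omega> \<in> sets borel" by (simp add: \<Omega>_def)
  note M = represents_on1[OF r] represents_on2[OF r] and K = represents_on1[OF q] represents_on2[OF q]
  have [measurable]: "cdf N \<in> borel_measurable borel" "(\<lambda>s. measure N {..<s}) \<in> borel_measurable borel"
    if "finite_borel_on \<Omega> N" for N
    using borel_measurable_cdf[OF that] borel_measurable_measure_lessThan[OF that] by auto
  note M' [measurable] = M[folded \<Omega>_def] and K' [measurable] = K[folded \<Omega>_def]
  define ul where "ul x = d + measure M1 {..<x} - measure M2 {..<x}" for x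
  define ur where "ur x = d + cdf M1 x - cdf M2 x" for x
  have ulm [measurable]: "ul \<in> borel_measurable borel" unfolding ul_def by measurable
  have urm [measurable]: "ur \<in> borel_measurable borel" unfolding ur_def by measurable
  \<comment> \<open>\<open>lam\<close> is measurable on the interval only; extension by zero makes
    it a Borel function on the line with values still between 0 and 1.\<close>
  define lam' where "lam' x = indicator \<Omega> x *\<^sub>R lam x" for x
  have lam'm [measurable]: "lam' \<in> borel_measurable borel"
    using lam(1) unfolding lam'_def \<Omega>_def by (subst (asm) borel_measurable_restrict_space_iff) auto
  have lam'b: "0 \<le> lam' x" "lam' x \<le> 1" for x
    using lam(2)[of x] by (auto simp: lam'_def \<Omega>_def indicator_def)
  \<comment> \<open>The weight on the left limit of \<open>u\<close>, decided pointwise by the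
    direction of the jump.\<close>
  define \<kappa> where "\<kappa> x = (if ul x \<le> ur x then 1 - lam' x else lam' x)" for x
  have \<kappa>m [measurable]: "\<kappa> \<in> borel_measurable borel" unfolding \<kappa>_def by measurable
  have \<kappa>b: "0 \<le> \<kappa> x" "\<kappa> x \<le> 1" for x using lam'b[of x] by (auto simp: \<kappa>_def)
  have \<kappa>'m: "(\<lambda>x. 1 - \<kappa> x) \<in> borel_measurable borel" by measurable
  define U where "U = (\<lambda>s. d + cdf_mix \<kappa> M1 s - cdf_mix \<kappa> M2 s)"
  define V where "V = (\<lambda>s. c + cdf_mix (\<lambda>s. 1 - \<kappa> s) K1 s - cdf_mix (\<lambda>s. 1 - \<kappa> s) K2 s)"
  have Um: "U \<in> borel_measurable borel"
    unfolding U_def using borel_measurable_cdf_mix[OF M(1) \<kappa>m] borel_measurable_cdf_mix[OF M(2) \<kappa>m] by measurable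
  have Vm: "V \<in> borel_measurable borel"
    unfolding V_def using borel_measurable_cdf_mix[OF K(1) \<kappa>'m] borel_measurable_cdf_mix[OF K(2) \<kappa>'m] by measurable
  have UB: "\<bar>U x\<bar> \<le> \<bar>d\<bar> + measure M1 UNIV + measure M2 UNIV" for x
    using cdf_mix_bound[of _ M1 \<kappa> x, OF M(1) \<kappa>b] cdf_mix_bound[of _ M2 \<kappa> x, OF M(2) \<kappa>b] unfolding U_def by linarith
  have VB: "\<bar>V x\<bar> \<le> \<bar>c\<bar> + measure K1 UNIV + measure K2 UNIV" for x
    using cdf_mix_bound[of _ K1 "\<lambda>x. 1 - \<kappa> x" x, OF K(1)] cdf_mix_bound[of _ K2 "\<lambda>x. 1 - \<kappa> x" x, OF K(2)] \<kappa>b[of x]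
    unfolding V_def by auto
  have rep: "signed_integral \<Omega> \<nu>' A f = (LINT s:A|N1. f s) - (LINT s:A|N2. f s)"
    if "signed_measure \<Omega> \<nu>'" "represents \<Omega> \<nu>' N1 N2" "A \<in> borel_subsets \<Omega>" "f \<in> borel_measurable borel" "\<And>x. \<bar>f x\<bar> \<le> B"
    for \<nu>' N1 N2 A f B
    by (rule signed_integral_represents[OF \<Omega> that(1-4), of B]) (rule that(5))
  have sm: "signed_measure \<Omega> (\<lambda>A. if A \<in> borel_subsets \<Omega> then signed_integral \<Omega> \<nu>' A f else 0)"
    if "signed_measure \<Omega> \<nu>'" "represents \<Omega> \<nu>' N1 N2" "f \<in> borel_measurable borel" "\<And>x. \<bar>f x\<bar> \<le> B" for \<nu>' N1 N2 f B
  proof -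
    have 1: "signed_measure \<Omega> (\<lambda>A. if A \<in> borel_subsets \<Omega> then LINT s:A|N. f s else 0)"
      if "finite_borel_on \<Omega> N" for N
      by (rule signed_measure_set_integral[OF _ \<Omega> set_integrable_bounded[OF that \<open>f \<in> borel_measurable borel\<close> \<Omega>, of B]])
        (use finite_borel_on_sets[OF that] \<open>\<And>x. \<bar>f x\<bar> \<le> B\<close> in \<open>auto simp: borel_subsets_iff\<close>)
    have "(\<lambda>A. if A \<in> borel_subsets \<Omega> then signed_integral \<Omega> \<nu>' A f else 0) =
      (\<lambda>A. (if A \<in> borel_subsets \<Omega> then LINT s:A|N1. f s else 0) + - (if A \<in> borel_subsets \<Omega> then LINT s:A|N2. f s else 0))"
      using rep[OF that(1,2) _ that(3,4)] by (auto simp: fun_eq_iff)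
    then show ?thesis
      using signed_measure_add[OF 1[OF represents_on1[OF that(2)]] signed_measure_uminus[OF 1[OF represents_on2[OF that(2)]]]]
      by simp
  qed
  note \<nu>' = \<nu>[folded \<Omega>_def] and \<mu>' = \<mu>[folded \<Omega>_def] and r' = r[folded \<Omega>_def] and q' = q[folded \<Omega>_def]
  \<comment> \<open>The candidate for the derivative of the product.\<close>
  define \<rho> where "\<rho> A = (if A \<in> borel_subsets \<Omega> then signed_integral \<Omega> \<mu> A U else 0) +
      (if A \<in> borel_subsets \<Omega> then signed_integral \<Omega> \<nu> A V else 0)" for A
  have \<rho>: "signed_measure \<Omega> \<rho>"
    unfolding \<rho>_def by (rule signed_measure_add[OF sm[OF \<mu>' q' Um UB] sm[OF \<nu>' r' Vm VB]])
  obtain R1 R2 where R: "represents \<Omega> \<rho> R1 R2" using ex_represents[OF \<Omega> \<rho>] by blast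
  \<comment> \<open>Evaluating \<open>\<rho>\<close> on \<open>{a<..x}\<close> identifies the
    product of the two representatives as a constant plus the distribution function of
    \<open>\<rho>\<close>.\<close>
  have prod: "(d + cdf M1 x - cdf M2 x) * (c + cdf K1 x - cdf K2 x) = d * c + cdf R1 x - cdf R2 x"
    if x: "x \<in> \<Omega>" for x
  proof -
    have A: "{a<..x} \<in> borel_subsets \<Omega>" using x by (auto simp: borel_subsets_iff \<Omega>_def)
    have "cdf R1 x - cdf R2 x = \<rho> {a<..x}"
      using represents_cdf[OF R[unfolded \<Omega>_def]] x by (simp add: \<Omega>_def)
    also have "\<dots> = ((LINT s:{a<..x}|K1. U s) - (LINT s:{a<..x}|K2. U s)) +
        ((LINT s:{a<..x}|M1. V s) - (LINT s:{a<..x}|M2. V s))"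
      using A rep[OF \<mu>' q' A Um UB] rep[OF \<nu>' r' A Vm VB] by (simp add: \<rho>_def)
    also have "\<dots> = (d + cdf M1 x - cdf M2 x) * (c + cdf K1 x - cdf K2 x) - d * c"
      by (rule leibniz_signed[OF r q \<kappa>m \<kappa>b U_def V_def]) (use x \<Omega>_def in auto)
    finally show ?thesis by simp
  qed
  have "AE x in lebesgue_on {a<..<b}. u x * T x = d * c + cdf R1 x - cdf R2 x"
    using u T unfolding AE_lebesgue_on_iff[OF \<Omega>[unfolded \<Omega>_def]]
    by eventually_elim (use prod[unfolded \<Omega>_def] in auto)
  then have "has_distr_deriv {a<..<b} (\<lambda>x. u x * T x) \<rho>"
    by (rule has_distr_deriv_cdf(1)[OF ab \<rho>[unfolded \<Omega>_def] R[unfolded \<Omega>_def] borel_measurable_times[OF um Tm]])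
  then have duT: "distr_deriv \<Omega> (\<lambda>x. u x * T x) = \<rho>"
    unfolding \<Omega>_def by (rule distr_deriv_eqI[OF ab])
  have dT: "distr_deriv \<Omega> T = \<mu>"
    unfolding \<Omega>_def by (rule distr_deriv_eqI[OF ab has_distr_deriv_cdf(1)[OF ab \<mu> q Tm T]])
  \<comment> \<open>At every point of the interval, atoms included, \<open>U\<close> is the
    \<lambda>-representative; equality almost everywhere would be too weak for an integral against
    \<open>\<mu>\<close>.\<close>
  have uU: "u_lambda lam u x = U x" if x: "x \<in> \<Omega>" for x
  proof -
    have "left_limit u x = ul x" unfolding ul_def
      by (rule left_limit_cdf[OF r u]) (use x \<Omega>_def in auto)
    moreover have "right_limit u x = ur x" unfolding ur_def
      by (rule right_limit_cdf[OF r u]) (use x \<Omega>_def in auto)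
    moreover have "\<kappa> x = (if ul x \<le> ur x then 1 - lam x else lam x)"
      using x by (simp add: \<kappa>_def lam'_def)
    ultimately have "u_lambda lam u x = \<kappa> x * ul x + (1 - \<kappa> x) * ur x" by (rule u_lambda_eq)
    then show ?thesis by (simp add: U_def ul_def ur_def cdf_mix_def algebra_simps)
  qed
  show thesis
  proof (rule that[of "\<lambda>x. \<kappa> x" V])
    show "V = (\<lambda>x. \<kappa> x * (c + cdf K1 x - cdf K2 x) + (1 - \<kappa> x) * (c + measure K1 {..<x} - measure K2 {..<x}))"
      by (auto simp: V_def cdf_mix_def algebra_simps)
    fix A assume A: "A \<in> borel_subsets {a<..<b}"
    have "signed_integral \<Omega> \<mu> A (u_lambda lam u) = signed_integral \<Omega> \<mu> A U"
      by (rule signed_integral_cong) (use A uU in \<open>auto simp: borel_subsets_iff \<Omega>_def\<close>)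
    then have "pairing \<Omega> T u lam A = signed_integral \<Omega> \<nu> A V"
      using A[folded \<Omega>_def] by (simp add: pairing_def duT dT \<rho>_def)
    then show "pairing {a<..<b} T u lam A = signed_integral {a<..<b} \<nu> A V" by (simp add: \<Omega>_def)
  qed (use \<kappa>b Vm VB in auto)
qed

section \<open>Localisation of signed integrals and integration against densities\<close>

lemma finite_measure_density_indicator:
  assumes M: "finite_measure M" "sets M = sets borel" and [measurable]: "A \<in> sets borel"
  shows "finite_measure (density M (\<lambda>x. ennreal (indicator A x)))"
    and "\<And>B. B \<in> sets borel \<Longrightarrow> measure (density M (\<lambda>x. ennreal (indicator A x))) B = measure M (B \<inter> A)"
    and "\<And>f :: real \<Rightarrow> real. f \<in> borel_measurable borel \<Longrightarrow>
      integral\<^sup>L (density M (\<lambda>x. ennreal (indicator A x))) f = (LINT x:A|M. f x)"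
proof -
  interpret finite_measure M by fact
  note [measurable_cong] = M(2)
  have e: "emeasure (density M (\<lambda>x. ennreal (indicator A x))) B = emeasure M (B \<inter> A)"
    if [measurable]: "B \<in> sets borel" for B
    by (subst emeasure_density, measurable, subst nn_integral_indicator[symmetric], measurable,
      rule nn_integral_cong, simp split: split_indicator)
  show "finite_measure (density M (\<lambda>x. ennreal (indicator A x)))"
    by (rule finite_measureI) (use sets_eq_imp_space_eq[OF M(2)] e[of UNIV] in simp)
  show "measure (density M (\<lambda>x. ennreal (indicator A x))) B = measure M (B \<inter> A)" if "B \<in> sets borel" for B
    by (simp add: measure_def e[OF that])
  show "integral\<^sup>L (density M (\<lambda>x. ennreal (indicator A x))) f = (LINT x:A|M. f x)"
    if [measurable]: "f \<in> borel_measurable borel" for f :: "real \<Rightarrow> real"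
    unfolding set_lebesgue_integral_def by (rule integral_density) auto
qed

text \<open>Restricted to \<open>A\<close>, the two pairs satisfy \<open>M1 + N2 = M2 + N1\<close>.
  This permits replacing \<open>\<nu>\<close> by its singular part on a null set and by its density
  elsewhere.\<close>

lemma signed_integral_local:
  assumes r: "represents \<Omega> \<nu> M1 M2" and r': "represents \<Omega> \<nu>' N1 N2" and A: "A \<in> borel_subsets \<Omega>"
    and eq: "\<And>B. B \<in> borel_subsets \<Omega> \<Longrightarrow> B \<subseteq> A \<Longrightarrow> \<nu> B = \<nu>' B"
    and f: "f \<in> borel_measurable borel" and B: "\<And>x. \<bar>f x\<bar> \<le> (B :: real)"
  shows "(LINT x:A|M1. f x) - (LINT x:A|M2. f x) = (LINT x:A|N1. f x) - (LINT x:A|N2. f x)"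
proof -
  note on = represents_on1[OF r] represents_on2[OF r] represents_on1[OF r'] represents_on2[OF r']
  have A': "A \<in> sets borel" using A by (simp add: borel_subsets_iff)
  let ?R = "\<lambda>M. density M (\<lambda>x. ennreal (indicator A x))"
  have R: "finite_measure (?R M)" "sets (?R M) = sets borel" "integral\<^sup>L (?R M) f = (LINT x:A|M. f x)"
    "\<And>C. C \<in> sets borel \<Longrightarrow> measure (?R M) C = measure M (C \<inter> A)" if "finite_borel_on \<Omega> M" for M
    using finite_measure_density_indicator[OF finite_borel_on_finite[OF that] finite_borel_on_sets[OF that] A'] f
      finite_borel_on_sets[OF that] by auto
  have "integral\<^sup>L (?R M1) f + integral\<^sup>L (?R N2) f = integral\<^sup>L (?R M2) f + integral\<^sup>L (?R N1) f"
  proof (rule integral_sum_eq[OF R(1) R(1) R(1) R(1) R(2) R(2) R(2) R(2) _ f B])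
    fix C :: "real set" assume C: "C \<in> sets borel"
    have CA: "C \<inter> A \<in> borel_subsets \<Omega>" using A C by (auto simp: borel_subsets_iff)
    show "measure (?R M1) C + measure (?R N2) C = measure (?R M2) C + measure (?R N1) C"
      using eq[OF CA] represents_eq[OF r CA] represents_eq[OF r' CA] by (simp add: R(4)[OF _ C] on)
  qed (use on in auto)
  then show ?thesis by (simp add: R(3) on)
qed

lemma finite_borel_on_density_real:
  assumes w: "integrable lborel w" "\<And>x. 0 \<le> w x" "\<And>x. x \<notin> \<Omega> \<Longrightarrow> w x = (0 :: real)"
    and [measurable]: "\<Omega> \<in> sets borel"
  shows "finite_borel_on \<Omega> (density lborel (\<lambda>x. ennreal (w x)))"
    and "\<And>A. A \<in> sets borel \<Longrightarrow> measure (density lborel (\<lambda>x. ennreal (w x))) A = (LINT x:A|lborel. w x)"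
    and "\<And>A f. A \<in> sets borel \<Longrightarrow> f \<in> borel_measurable borel \<Longrightarrow>
      (LINT x:A|density lborel (\<lambda>x. ennreal (w x)). f x) = (LINT x:A|lborel. f x * w x :: real)"
proof -
  have [measurable]: "w \<in> borel_measurable borel" using w(1) by auto
  have e: "emeasure (density lborel (\<lambda>x. ennreal (w x))) A = ennreal (LINT x:A|lborel. w x)"
    and nn: "0 \<le> (LINT x:A|lborel. w x)"
    if [measurable]: "A \<in> sets borel" for A
  proof -
    have i: "integrable lborel (\<lambda>x. indicator A x *\<^sub>R w x)"
      by (rule integrable_mult_indicator[OF _ w(1)]) simp
    have "emeasure (density lborel (\<lambda>x. ennreal (w x))) A = (\<integral>\<^sup>+x. ennreal (indicator A x *\<^sub>R w x) \<partial>lborel)"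
      by (subst emeasure_density, measurable, rule nn_integral_cong, simp split: split_indicator)
    also have "\<dots> = ennreal (LINT x:A|lborel. w x)"
      unfolding set_lebesgue_integral_def by (rule nn_integral_eq_integral[OF i]) (use w(2) in auto)
    finally show "emeasure (density lborel (\<lambda>x. ennreal (w x))) A = ennreal (LINT x:A|lborel. w x)" .
    show "0 \<le> (LINT x:A|lborel. w x)"
      unfolding set_lebesgue_integral_def by (rule integral_nonneg_AE) (use w(2) in auto)
  qed
  have z: "(LINT x:- \<Omega>|lborel. w x) = 0"
  proof -
    have "(\<lambda>x. indicator (- \<Omega>) x *\<^sub>R w x) = (\<lambda>x. 0)" using w(3) by (auto simp: indicator_def fun_eq_iff)
    then show ?thesis by (simp add: set_lebesgue_integral_def)
  qed
  show "finite_borel_on \<Omega> (density lborel (\<lambda>x. ennreal (w x)))"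
    unfolding finite_borel_on_def
    by (intro conjI finite_measureI) (use e[of UNIV] e[of "- \<Omega>"] z in simp_all)
  show "measure (density lborel (\<lambda>x. ennreal (w x))) A = (LINT x:A|lborel. w x)" if "A \<in> sets borel" for A
    using e[OF that] nn[OF that] by (simp add: measure_def)
  show "(LINT x:A|density lborel (\<lambda>x. ennreal (w x)). f x) = (LINT x:A|lborel. f x * w x)"
    if [measurable]: "A \<in> sets borel" "f \<in> borel_measurable borel" for A and f :: "real \<Rightarrow> real"
  proof -
    have "(LINT x:A|density lborel (\<lambda>x. ennreal (w x)). f x) = (\<integral>x. w x *\<^sub>R (indicator A x *\<^sub>R f x) \<partial>lborel)"
      unfolding set_lebesgue_integral_def by (rule integral_density) (use w(2) in auto)
    then show ?thesis by (simp add: set_lebesgue_integral_def mult_ac)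
  qed
qed

text \<open>Positive and negative parts of a Borel version of \<open>g\<close> are densities of a
  representing pair, and only its agreement with \<open>\<nu>\<close> on subsets of \<open>A\<close>
  matters for the integral over \<open>A\<close>.\<close>

lemma signed_integral_density:
  assumes \<Omega> [measurable]: "\<Omega> \<in> sets borel" and \<nu>: "signed_measure \<Omega> \<nu>" and g: "set_integrable lebesgue \<Omega> g"
    and A: "A \<in> borel_subsets \<Omega>"
    and eq: "\<And>B. B \<in> borel_subsets \<Omega> \<Longrightarrow> B \<subseteq> A \<Longrightarrow> \<nu> B = (LINT x:B|lebesgue. g x)"
    and f [measurable]: "f \<in> borel_measurable borel" and B: "\<And>x. \<bar>f x\<bar> \<le> (B :: real)"
  shows "signed_integral \<Omega> \<nu> A f = (LINT x:A|lebesgue. f x * g x)"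
proof -
  have gm: "(\<lambda>x. indicator \<Omega> x *\<^sub>R g x) \<in> borel_measurable lebesgue"
    using g by (simp add: set_integrable_def)
  obtain g0 where [measurable]: "g0 \<in> borel_measurable lborel" and g0: "AE x in lborel. indicator \<Omega> x *\<^sub>R g x = g0 x"
    using completion_ex_borel_measurable_real[OF gm] by blast
  \<comment> \<open>A Borel version of \<open>g\<close>, cut off outside \<open>\<Omega>\<close> so
    that the measures built from it are carried by \<open>\<Omega>\<close>.\<close>
  define h where "h x = indicator \<Omega> x * g0 x" for x
  have hm [measurable]: "h \<in> borel_measurable borel" unfolding h_def by measurable
  have hg: "AE x in lebesgue. indicator \<Omega> x * g x = h x"
    using AE_completion[OF g0] by eventually_elim (auto simp: h_def indicator_def)
  have hi: "integrable lborel h"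
  proof -
    have "integrable lebesgue h"
      by (rule integrable_cong_AE_imp[OF g[unfolded set_integrable_def]])
        (use hg in \<open>auto intro: measurable_completion\<close>)
    then show ?thesis by (simp add: integrable_completion)
  qed
  have h0: "h x = 0" if "x \<notin> \<Omega>" for x using that by (simp add: h_def)
  have cong: "(LINT x:C|lebesgue. p x * g x) = (LINT x:C|lborel. p x * h x)"
    if C: "C \<in> borel_subsets \<Omega>" and [measurable]: "p \<in> borel_measurable borel" for C and p :: "real \<Rightarrow> real"
  proof -
    have [measurable]: "C \<in> sets borel" using C by (simp add: borel_subsets_iff)
    have "(LINT x:C|lebesgue. p x * g x) = (LINT x:C|lebesgue. p x * h x)"
      unfolding set_lebesgue_integral_def
    proof (rule integral_cong_AE)
      have "(\<lambda>x. (indicator C x * p x) * (indicator \<Omega> x *\<^sub>R g x)) \<in> borel_measurable lebesgue"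
        by (rule borel_measurable_times[OF measurable_completion gm]) measurable
      moreover have "(\<lambda>x. (indicator C x * p x) * (indicator \<Omega> x *\<^sub>R g x)) =
          (\<lambda>x. indicator C x *\<^sub>R (p x * g x))"
        using C by (auto simp: borel_subsets_iff indicator_def fun_eq_iff)
      ultimately show "(\<lambda>x. indicator C x *\<^sub>R (p x * g x)) \<in> borel_measurable lebesgue"
        by (simp only:)
      show "(\<lambda>x. indicator C x *\<^sub>R (p x * h x)) \<in> borel_measurable lebesgue"
        by (rule measurable_completion) measurable
      show "AE x in lebesgue. indicator C x *\<^sub>R (p x * g x) = indicator C x *\<^sub>R (p x * h x)"
        using hg by eventually_elim (use C in \<open>auto simp: borel_subsets_iff indicator_def split: if_splits\<close>)
    qed
    also have "\<dots> = (LINT x:C|lborel. p x * h x)" by (rule set_integral_lebesgue) measurable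
    finally show ?thesis .
  qed
  define wp where "wp x = max 0 (h x)" for x
  define wn where "wn x = max 0 (- h x)" for x
  have wi: "integrable lborel wp" "integrable lborel wn"
    unfolding wp_def wn_def using hi by (auto intro!: integrable_max)
  have h_eq: "h x = wp x - wn x" for x by (auto simp: wp_def wn_def)
  note P = finite_borel_on_density_real[OF wi(1), of \<Omega>] and N = finite_borel_on_density_real[OF wi(2), of \<Omega>]
  have w0: "0 \<le> wp x" "0 \<le> wn x" "x \<notin> \<Omega> \<Longrightarrow> wp x = 0" "x \<notin> \<Omega> \<Longrightarrow> wn x = 0" for x
    using h0[of x] by (auto simp: wp_def wn_def)
  have split: "(LINT x:C|lborel. p x * wp x) - (LINT x:C|lborel. p x * wn x) = (LINT x:C|lborel. p x * h x)"
    if C: "C \<in> sets borel" and p: "p \<in> borel_measurable borel" "\<And>x. \<bar>p x\<bar> \<le> b" for C p b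
  proof -
    have i: "set_integrable lborel C (\<lambda>x. p x * w x)" if "integrable lborel w" for w
    proof -
      have "set_integrable lborel C w" unfolding set_integrable_def
        by (rule integrable_mult_indicator[OF _ that]) (use C in simp)
      from set_integrable_mult_bounded[OF this, of p b] p show ?thesis by (simp add: mult.commute)
    qed
    have "(LINT x:C|lborel. p x * h x) = (LINT x:C|lborel. p x * wp x - p x * wn x)"
      by (simp add: h_eq right_diff_distrib)
    then show ?thesis using set_integral_diff(2)[OF i[OF wi(1)] i[OF wi(2)]] by simp
  qed
  \<comment> \<open>The purely absolutely continuous companion of \<open>\<nu>\<close>; the two are
    compared on subsets of \<open>A\<close> only.\<close>
  define \<nu>' where "\<nu>' A = (if A \<in> borel_subsets \<Omega> then LINT x:A|lebesgue. g x else 0)" for A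
  have r': "represents \<Omega> \<nu>' (density lborel (\<lambda>x. ennreal (wp x))) (density lborel (\<lambda>x. ennreal (wn x)))"
    unfolding represents_def
  proof (intro conjI ballI)
    show "finite_borel_on \<Omega> (density lborel (\<lambda>x. ennreal (wp x)))" by (rule P(1)) (use w0 in auto)
    show "finite_borel_on \<Omega> (density lborel (\<lambda>x. ennreal (wn x)))" by (rule N(1)) (use w0 in auto)
    fix C assume C: "C \<in> borel_subsets \<Omega>"
    then have C': "C \<in> sets borel" by (simp add: borel_subsets_iff)
    show "\<nu>' C = measure (density lborel (\<lambda>x. ennreal (wp x))) C - measure (density lborel (\<lambda>x. ennreal (wn x))) C"
      using split[OF C', of "\<lambda>x. 1" 1] cong[OF C, of "\<lambda>x. 1"] P(2)[OF _ _ _ C'] N(2)[OF _ _ _ C'] w0 C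
      by (simp add: \<nu>'_def)
  qed
  obtain M1 M2 where r: "represents \<Omega> \<nu> M1 M2" using ex_represents[OF \<Omega> \<nu>] by blast
  have A': "A \<in> sets borel" using A by (simp add: borel_subsets_iff)
  have "signed_integral \<Omega> \<nu> A f = (LINT x:A|M1. f x) - (LINT x:A|M2. f x)"
    by (rule signed_integral_represents[OF \<Omega> \<nu> r A f, of B]) (rule B)
  also have "\<dots> = (LINT x:A|density lborel (\<lambda>x. ennreal (wp x)). f x) - (LINT x:A|density lborel (\<lambda>x. ennreal (wn x)). f x)"
    by (rule signed_integral_local[OF r r' A _ f B]) (use eq in \<open>simp add: \<nu>'_def\<close>)
  also have "\<dots> = (LINT x:A|lborel. f x * wp x) - (LINT x:A|lborel. f x * wn x)"
    using P(3)[OF _ _ _ A' f] N(3)[OF _ _ _ A' f] w0 by simp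
  also have "\<dots> = (LINT x:A|lborel. f x * h x)" by (rule split[OF A' f B])
  also have "\<dots> = (LINT x:A|lebesgue. f x * g x)" by (rule cong[OF A f, symmetric])
  finally show ?thesis .
qed

text \<open>With \<open>s = sqrt (1 - t^2)\<close> the vector \<open>(t, s)\<close> has length 1,
  and its inner product with \<open>(g, 1)\<close> equals the length of the latter. Squaring turns
  this into \<open>(s * g - t)^2 = 0\<close>, that is, the vectors are parallel.\<close>

lemma unit_vector_equality:
  fixes t g :: real
  assumes t: "\<bar>t\<bar> \<le> 1" and eq: "t * g + sqrt (1 - t\<^sup>2) = sqrt (1 + g\<^sup>2)"
  shows "\<bar>t\<bar> < 1" "g = t / sqrt (1 - t\<^sup>2)"
proof -
  define s where "s = sqrt (1 - t\<^sup>2)"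
  have t2: "t\<^sup>2 \<le> 1" using t by (simp add: abs_square_le_1)
  then have s: "0 \<le> s" "s\<^sup>2 = 1 - t\<^sup>2" by (simp_all add: s_def)
  have "(t * g + s)\<^sup>2 = 1 + g\<^sup>2"
    unfolding eq[folded s_def] by (simp add: add_nonneg_nonneg)
  then have "(t * g)\<^sup>2 + 2 * (t * g) * s + s\<^sup>2 = 1 + g\<^sup>2" by (simp add: power2_sum)
  moreover have "(t * g)\<^sup>2 = g\<^sup>2 - (s * g)\<^sup>2"
    by (simp only: power_mult_distrib s(2)) (simp add: algebra_simps)
  moreover have "(s * g - t)\<^sup>2 = (s * g)\<^sup>2 - 2 * (t * g) * s + t\<^sup>2"
    by (simp add: power2_diff algebra_simps)
  ultimately have "(s * g - t)\<^sup>2 = 0" using s(2) by linarith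
  then have sg: "s * g = t" by simp
  \<comment> \<open>If \<open>s = 0\<close>, then \<open>t = s * g = 0\<close>, while
    \<open>s^2 = 1 - t^2\<close> would be 1.\<close>
  have "s \<noteq> 0"
  proof
    assume "s = 0"
    then show False using sg s(2) by simp
  qed
  then have "0 < s" using s(1) by simp
  then have "0 < 1 - t\<^sup>2" by (simp add: s_def)
  then show "\<bar>t\<bar> < 1" by (simp add: abs_square_less_1)
  show "g = t / sqrt (1 - t\<^sup>2)" using sg \<open>0 < s\<close> by (simp add: s_def[symmetric] field_simps)
qed

section \<open>Structure of solutions\<close>

text \<open>On the interval from -1 to 1 this is the inverse of \<open>p / sqrt (1 + p^2)\<close>:
  it recovers the slope of a graph from the horizontal component of its normalised gradient.\<close>

definition slope :: "real \<Rightarrow> real" where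
  "slope t = t / sqrt (1 - t\<^sup>2)"

lemma slope_measurable [measurable]: "slope \<in> borel_measurable borel"
  unfolding slope_def by measurable

text \<open>The derivative is \<open>(1 - x^2)\<close> to the power -3/2, which is positive.\<close>

lemma slope_strict_mono:
  assumes "\<bar>s\<bar> < 1" "\<bar>t\<bar> < 1" "s < t"
  shows "slope s < slope t"
proof -
  have pos: "0 < 1 - x\<^sup>2" if "\<bar>x\<bar> < 1" for x :: real
    using that by (simp add: abs_square_less_1)
  have der: "(slope has_real_derivative 1 / (sqrt (1 - x\<^sup>2) * (1 - x\<^sup>2))) (at x)" if "\<bar>x\<bar> < 1" for x
  proof -
    have p: "0 < 1 - x\<^sup>2" by (rule pos[OF that])
    define r where "r = sqrt (1 - x\<^sup>2)"
    have r: "0 < r" "1 - x\<^sup>2 = r\<^sup>2" using p by (auto simp: r_def)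
    have "(slope has_real_derivative (1 * r - x * ((0 - 2 * x) * (inverse r / 2))) / (r * r)) (at x)"
      unfolding slope_def[abs_def] r_def
      by (rule derivative_eq_intros refl | use p in force)+
    moreover have "(1 * r - x * ((0 - 2 * x) * (inverse r / 2))) / (r * r) = 1 / (r * r\<^sup>2)"
    proof -
      have "x\<^sup>2 = 1 - r\<^sup>2" using r(2) by simp
      then show ?thesis using r(1) by (simp add: field_simps power2_eq_square)
    qed
    moreover have "sqrt (1 - x\<^sup>2) * (1 - x\<^sup>2) = r * r\<^sup>2"
      by (simp only: r_def[symmetric]) (simp only: r(2))
    ultimately show ?thesis by simp
  qed
  show ?thesis
  proof (rule DERIV_pos_imp_increasing[OF assms(3)])
    fix x assume "s \<le> x" "x \<le> t"
    then have x: "\<bar>x\<bar> < 1" using assms by auto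
    show "\<exists>y. (slope has_real_derivative y) (at x) \<and> 0 < y"
      using der[OF x] pos[OF x] by (intro exI conjI) auto
  qed
qed

lemma slope_mono: "\<bar>s\<bar> < 1 \<Longrightarrow> \<bar>t\<bar> < 1 \<Longrightarrow> s \<le> t \<Longrightarrow> slope s \<le> slope t"
  using slope_strict_mono[of s t] by (cases "s = t") auto

lemma AE_lebesgue_on_obtain:
  assumes "AE x in lebesgue_on {a<..<b}. P x" "a \<le> y" "y < z" "z \<le> (b :: real)"
  obtains x where "y < x" "x < z" "P x"
proof (rule ccontr)
  assume "\<not> thesis"
  with that have "\<not> P x" if "y < x" "x < z" for x using that by blast
  then have "AE x in lebesgue. x \<notin> {y<..<z}"
    using assms(1) unfolding AE_lebesgue_on_iff[OF borel_open[OF open_greaterThanLessThan]]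
    by (rule_tac eventually_mono) (use assms(2-4) in auto)
  then show False using assms(3) by (rule not_AE_notin_Ioo)
qed

text \<open>\<open>K1\<close> and \<open>K2\<close> form an arbitrary representing pair, yet the
  difference is the value of \<open>\<mu>\<close> on \<open>{a<..x}\<close> and inherits
  monotonicity from its sign.\<close>

lemma cdf_diff_mono:
  assumes q: "represents {a<..<b} \<mu> K1 K2" and \<mu>: "signed_measure {a<..<b} \<mu>"
    and nn: "\<forall>A\<in>borel_subsets {a<..<b}. 0 \<le> \<mu> A"
    and xy: "a < x" "x \<le> y" "y < b"
  shows "cdf K1 x - cdf K2 x \<le> cdf K1 y - cdf K2 y"
proof -
  have xs: "{a<..y} \<in> borel_subsets {a<..<b}" and ys: "{a<..x} \<in> sets borel"
    and d: "{x<..y} \<in> borel_subsets {a<..<b}"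
    using xy by (auto simp: borel_subsets_iff)
  have "{a<..y} \<inter> {a<..x} = {a<..x}" "{a<..y} - {a<..x} = {x<..y}" using xy by auto
  with signed_measure_split[OF \<mu> xs ys] have "\<mu> {a<..y} = \<mu> {a<..x} + \<mu> {x<..y}" by simp
  moreover have "0 \<le> \<mu> {x<..y}" using nn d by blast
  ultimately show ?thesis using represents_cdf[OF q, of x] represents_cdf[OF q, of y] xy by simp
qed

text \<open>A finite measure has countably many atoms. Hence the choice of weights at jumps is
  invisible almost everywhere, and \<open>V\<close> agrees with \<open>T\<close> there.\<close>

lemma AE_cdf_eq_measure_lessThan:
  assumes "finite_borel_on \<Omega> M"
  shows "AE x in lebesgue. cdf M x = measure M {..<x}"
proof -
  interpret finite_borel_measure M using assms by (rule finite_borel_on_borel_measure)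
  have "{x. measure M {x} > 0} \<in> null_sets lborel"
    by (rule countable_imp_null_set_lborel[OF countable_atoms])
  from AE_completion[OF AE_not_in[OF this]] show ?thesis
  proof eventually_elim
    case (elim x)
    then have "measure M {x} = 0" using measure_nonneg[of M "{x}"] by (simp add: less_le)
    moreover have "measure M ({..<x} \<union> {x}) = measure M {..<x} + measure M {x}"
      by (rule finite_measure_Union) (auto simp: M_is_borel)
    ultimately show ?case unfolding cdf_def ivl_disj_un(2)[symmetric] by simp
  qed
qed

text \<open>With the Jordan pair \<open>S1\<close>, \<open>S2\<close> of \<open>\<sigma>\<close>,
  the equation says that the integrals over \<open>N\<close> of \<open>1 - V\<close> against
  \<open>S1\<close> and of \<open>1 + V\<close> against \<open>S2\<close> add up to zero. Both
  integrands are positive on \<open>N\<close>, so both measures vanish there.\<close>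

lemma singular_eq_zero:
  assumes \<Omega>: "\<Omega> \<in> sets borel" and \<sigma>: "signed_measure \<Omega> \<sigma>" and N: "N \<in> borel_subsets \<Omega>"
    and conc: "\<And>A. A \<in> borel_subsets \<Omega> \<Longrightarrow> \<sigma> A = \<sigma> (A \<inter> N)"
    and V: "V \<in> borel_measurable borel" "\<And>x. \<bar>V x\<bar> \<le> B" and V1: "\<And>x. x \<in> N \<Longrightarrow> \<bar>V x\<bar> < 1"
    and eq: "signed_integral \<Omega> \<sigma> N V = total_variation \<Omega> \<sigma> N"
  shows "\<sigma> A = 0"
proof -
  obtain S1 S2 where r: "represents \<Omega> \<sigma> S1 S2"
    and tv: "\<And>A. A \<in> borel_subsets \<Omega> \<Longrightarrow> total_variation \<Omega> \<sigma> A = measure S1 A + measure S2 A"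
    and si: "\<And>A f. A \<in> borel_subsets \<Omega> \<Longrightarrow> f \<in> borel_measurable borel \<Longrightarrow>
      signed_integral \<Omega> \<sigma> A f = (LINT x:A|S1. f x) - (LINT x:A|S2. f x)"
    using jordan_representation[OF \<Omega> \<sigma>] by metis
  note on = represents_on1[OF r] represents_on2[OF r]
  have N': "N \<in> sets borel" using N by (simp add: borel_subsets_iff)
  have i: "set_integrable S N V" "set_integrable S N (\<lambda>x. 1 :: real)" "(LINT x:N|S. 1 :: real) = measure S N"
    if "finite_borel_on \<Omega> S" for S
    using set_integrable_bounded[OF that V(1) N' V(2)] set_integrable_bounded[OF that _ N', of "\<lambda>x. 1" 1]
      N' finite_borel_on_sets[OF that] by (auto simp: set_lebesgue_integral_def)
  have z: "measure S N = 0"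
    if S: "finite_borel_on \<Omega> S" and W: "set_integrable S N W" "\<And>x. x \<in> N \<Longrightarrow> 0 < W x" "(LINT x:N|S. W x) = 0"
    for S and W :: "real \<Rightarrow> real"
  proof -
    define W' where "W' x = indicator N x * W x" for x
    have "N \<in> null_sets S"
    proof (rule null_if_pos_func_has_zero_int[of S W'])
      show "integrable S W'" using W(1) by (simp add: set_integrable_def W'_def[abs_def])
      show "N \<in> sets S" using N' finite_borel_on_sets[OF S] by simp
      show "AE x\<in>N in S. 0 < W' x" using W(2) by (auto simp: W'_def)
      have "(LINT x:N|S. W' x) = (LINT x:N|S. W x)"
        by (rule set_lebesgue_integral_cong) (use N' finite_borel_on_sets[OF S] in \<open>auto simp: W'_def\<close>)
      then show "(LINT x:N|S. W' x) = 0" using W(3) by simp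
    qed
    then show ?thesis by (simp add: measure_def null_sets_def)
  qed
  have nn: "0 \<le> (LINT x:N|S. W x)" if "\<And>x. x \<in> N \<Longrightarrow> 0 < W x" for S and W :: "real \<Rightarrow> real"
    unfolding set_lebesgue_integral_def
    by (rule integral_nonneg_AE) (use that in \<open>auto simp: indicator_def intro: less_imp_le\<close>)
  have 1: "(LINT x:N|S1. 1 - V x) = measure S1 N - (LINT x:N|S1. V x)"
    "(LINT x:N|S2. 1 + V x) = measure S2 N + (LINT x:N|S2. V x)"
    using set_integral_diff(2)[OF i(2,1)[OF on(1)]] set_integral_add(2)[OF i(2,1)[OF on(2)]] i(3) on by auto
  have V2: "0 < 1 - V x" "0 < 1 + V x" if "x \<in> N" for x using V1[OF that] by auto
  have "(LINT x:N|S1. 1 - V x) + (LINT x:N|S2. 1 + V x) = 0"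
    using 1 eq tv[OF N] si[OF N V(1)] by linarith
  then have 0: "(LINT x:N|S1. 1 - V x) = 0" "(LINT x:N|S2. 1 + V x) = 0"
    using nn[of "\<lambda>x. 1 - V x" S1, OF V2(1)] nn[of "\<lambda>x. 1 + V x" S2, OF V2(2)] by linarith+
  have m: "measure S1 N = 0" "measure S2 N = 0"
    using z[OF on(1) set_integral_diff(1)[OF i(2,1)[OF on(1)]] V2(1) 0(1)]
      z[OF on(2) set_integral_add(1)[OF i(2,1)[OF on(2)]] V2(2) 0(2)] by auto
  show ?thesis
  proof (cases "A \<in> borel_subsets \<Omega>")
    case True
    have AN: "A \<inter> N \<in> borel_subsets \<Omega>" using True N' by (rule borel_subsets_Int)
    have "measure S (A \<inter> N) = 0" if "finite_borel_on \<Omega> S" "measure S N = 0" for S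
    proof -
      interpret S: finite_measure S using that by (simp add: finite_borel_on_finite)
      have "measure S (A \<inter> N) \<le> measure S N"
        by (rule S.finite_measure_mono) (use N' finite_borel_on_sets[OF that(1)] in auto)
      then show ?thesis using that(2) measure_nonneg[of S "A \<inter> N"] by linarith
    qed
    then show ?thesis using conc[OF True] represents_eq[OF r AN] m on by simp
  qed (rule signed_measure_outside[OF \<sigma>])
qed

lemma total_variation_eq_zero:
  assumes "\<Omega> \<in> sets borel" "signed_measure \<Omega> \<nu>" "A \<in> borel_subsets \<Omega>"
    and "\<And>B. B \<in> borel_subsets \<Omega> \<Longrightarrow> B \<subseteq> A \<Longrightarrow> \<nu> B = 0"
  shows "total_variation \<Omega> \<nu> A = 0"
proof -
  obtain M K where "total_variation \<Omega> \<nu> A = measure M A + measure K A" "measure M A = 0 \<and> measure K A = 0"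
    using jordan_representation[OF assms(1,2)] assms(3,4) by metis
  then show ?thesis by simp
qed

text \<open>The pair \<open>K1\<close>, \<open>K2\<close> is a parameter, not produced by the lemma,
  so that the conclusions for two different solutions can be compared through their constants
  \<open>c\<close> alone.\<close>

lemma solution_structure:
  fixes a b :: real
  defines "\<Omega> \<equiv> {a<..<b}"
  assumes ab: "a < b" and \<mu>: "signed_measure \<Omega> \<mu>" and nn: "\<forall>A\<in>borel_subsets \<Omega>. 0 \<le> \<mu> A"
    and q: "represents \<Omega> \<mu> K1 K2"
    and T: "has_distr_deriv \<Omega> T \<mu>" and Tm: "T \<in> borel_measurable (lebesgue_on \<Omega>)" and T1: "Linf_norm \<Omega> T \<le> 1"
    and u: "u \<in> BV \<Omega>"
    and lam: "lam \<in> borel_measurable (restrict_space borel \<Omega>)" "\<And>x. x \<in> \<Omega> \<Longrightarrow> 0 \<le> lam x \<and> lam x \<le> 1"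
    and pe: "pairing_equation \<Omega> T u lam"
  shows "\<exists>c d. (\<forall>x\<in>\<Omega>. \<bar>c + cdf K1 x - cdf K2 x\<bar> < 1) \<and>
    set_integrable lborel \<Omega> (\<lambda>x. slope (c + cdf K1 x - cdf K2 x)) \<and>
    (AE x in lebesgue_on \<Omega>. u x = d + (LINT t:{a<..x}|lborel. slope (c + cdf K1 t - cdf K2 t))) \<and>
    right_limit u a = d \<and>
    left_limit u b = d + (LINT t:\<Omega>|lborel. slope (c + cdf K1 t - cdf K2 t))"
proof -
  have \<Omega> [measurable]: "\<Omega> \<in> sets borel" by (simp add: \<Omega>_def)
  note K = represents_on1[OF q] represents_on2[OF q]
  have [measurable]: "cdf K1 \<in> borel_measurable borel" "cdf K2 \<in> borel_measurable borel"
    using K by (auto intro: borel_measurable_cdf)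
  obtain \<nu> where \<nu>u: "has_distr_deriv \<Omega> u \<nu>" using u by (auto simp: BV_def)
  have um: "u \<in> borel_measurable (lebesgue_on \<Omega>)" using u by (auto simp: BV_def)
  have \<nu>: "signed_measure \<Omega> \<nu>" using \<nu>u by (simp add: has_distr_deriv_def)
  have du: "distr_deriv \<Omega> u = \<nu>" using distr_deriv_eqI[OF ab \<nu>u[unfolded \<Omega>_def]] by (simp add: \<Omega>_def)
  obtain M1 M2 where r: "represents \<Omega> \<nu> M1 M2" using ex_represents[OF \<Omega> \<nu>] by blast
  note M = represents_on1[OF r] represents_on2[OF r]
  obtain d where d: "AE x in lebesgue_on \<Omega>. u x = d + cdf M1 x - cdf M2 x"
    using has_distr_deriv_AE_cdf[OF ab \<nu>u[unfolded \<Omega>_def] r[unfolded \<Omega>_def]] unfolding \<Omega>_def by blast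
  obtain c where c: "AE x in lebesgue_on \<Omega>. T x = c + cdf K1 x - cdf K2 x"
    using has_distr_deriv_AE_cdf[OF ab T[unfolded \<Omega>_def] q[unfolded \<Omega>_def]] unfolding \<Omega>_def by blast
  define Tr where "Tr x = c + cdf K1 x - cdf K2 x" for x
  \<comment> \<open>\<open>Tr\<close> is the right-continuous representative of the field and
    \<open>Tl\<close> collects its left limits; at atoms of \<open>\<mu>\<close> they
    differ.\<close>
  define Tl where "Tl x = c + measure K1 {..<x} - measure K2 {..<x}" for x
  have Trm [measurable]: "Tr \<in> borel_measurable borel" unfolding Tr_def by measurable
  have Tr_mono: "Tr x \<le> Tr y" if "a < x" "x \<le> y" "y < b" for x y
    using cdf_diff_mono[OF q[unfolded \<Omega>_def] \<mu>[unfolded \<Omega>_def] nn[unfolded \<Omega>_def] that] by (simp add: Tr_def)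
  have AE_T: "AE x in lebesgue. x \<in> \<Omega> \<longrightarrow> T x = Tr x \<and> \<bar>Tr x\<bar> \<le> 1"
  proof -
    have "AE x in lebesgue_on \<Omega>. ereal \<bar>T x\<bar> \<le> Linf_norm \<Omega> T" unfolding Linf_norm_def by (rule esssup_AE)
    with c have "AE x in lebesgue_on \<Omega>. T x = Tr x \<and> \<bar>Tr x\<bar> \<le> 1"
    proof eventually_elim
      case (elim x)
      then have "ereal \<bar>T x\<bar> \<le> 1" using T1 by (rule_tac order.trans)
      then show ?case using elim(1) by (simp add: Tr_def one_ereal_def)
    qed
    then show ?thesis unfolding AE_lebesgue_on_iff[OF \<Omega>] .
  qed
  define g where "g = ac_density \<Omega> \<nu>"
  define \<sigma> where "\<sigma> = singular_part \<Omega> \<nu>"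
  have LD: "lebesgue_decomposition \<Omega> \<nu> g \<sigma>"
    unfolding g_def \<sigma>_def by (rule lebesgue_decomposition_ac_singular[OF \<Omega> \<nu>])
  have gi': "integrable (lebesgue_on \<Omega>) g" and \<sigma>: "signed_measure \<Omega> \<sigma>"
    and \<nu>A: "\<And>A. A \<in> borel_subsets \<Omega> \<Longrightarrow> \<nu> A = (LINT x:A|lebesgue. g x) + \<sigma> A"
    using LD unfolding lebesgue_decomposition_def by auto
  obtain N where N: "N \<in> borel_subsets \<Omega>" "N \<in> null_sets lborel" and \<sigma>N: "\<And>A. A \<in> borel_subsets \<Omega> \<Longrightarrow> \<sigma> A = \<sigma> (A \<inter> N)"
    using LD unfolding lebesgue_decomposition_def by blast
  have N' [measurable]: "N \<in> sets borel" using N by auto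
  have gm [measurable]: "g \<in> borel_measurable (lebesgue_on \<Omega>)" using gi' by simp
  have gi: "set_integrable lebesgue \<Omega> g" using gi' integrable_lebesgue_on_iff[OF \<Omega>] by blast
  obtain k V where k: "\<And>x. 0 \<le> k x" "\<And>x. k x \<le> (1 :: real)"
    and V: "V = (\<lambda>x. k x * (c + cdf K1 x - cdf K2 x) + (1 - k x) * (c + measure K1 {..<x} - measure K2 {..<x}))"
    and Vm [measurable]: "V \<in> borel_measurable borel" and VB: "\<And>x. \<bar>V x\<bar> \<le> \<bar>c\<bar> + measure K1 UNIV + measure K2 UNIV"
    and pV: "\<And>A. A \<in> borel_subsets \<Omega> \<Longrightarrow> pairing \<Omega> T u lam A = signed_integral \<Omega> \<nu> A V"
    using pairing_eq_signed_integral[OF ab \<nu>[unfolded \<Omega>_def] \<mu>[unfolded \<Omega>_def] r[unfolded \<Omega>_def]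
        q[unfolded \<Omega>_def] um[unfolded \<Omega>_def] Tm[unfolded \<Omega>_def] d[unfolded \<Omega>_def] c[unfolded \<Omega>_def]
        lam(1)[unfolded \<Omega>_def] lam(2)[unfolded \<Omega>_def], folded \<Omega>_def]
    by blast
  have V': "V x = k x * Tr x + (1 - k x) * Tl x" for x by (simp add: V Tr_def Tl_def)
  have eqA: "signed_integral \<Omega> \<nu> A V = (LINT x:A|lebesgue. sqrt (1 + (g x)\<^sup>2)) + total_variation \<Omega> \<sigma> A
      - (LINT x:A|lebesgue. sqrt (1 - \<bar>T x\<bar>\<^sup>2))" if "A \<in> borel_subsets \<Omega>" for A
    using pe pV[OF that] that by (simp add: pairing_equation_def area_measure_def du g_def \<sigma>_def)
  have fin: "finite_measure (lebesgue_on \<Omega>)"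
    by (rule finite_measureI) (simp add: space_restrict_space emeasure_restrict_space \<Omega>_def less_imp_le[OF ab])
  interpret L: finite_measure "lebesgue_on \<Omega>" by (rule fin)
  \<comment> \<open>Linear growth: \<open>sqrt (1 + g^2)\<close> is at most \<open>1 + |g|\<close>,
    integrable on a bounded interval.\<close>
  have i1: "set_integrable lebesgue \<Omega> (\<lambda>x. sqrt (1 + (g x)\<^sup>2))"
  proof -
    have "integrable (lebesgue_on \<Omega>) (\<lambda>x. sqrt (1 + (g x)\<^sup>2))"
    proof (rule Bochner_Integration.integrable_bound)
      show "integrable (lebesgue_on \<Omega>) (\<lambda>x. 1 + \<bar>g x\<bar>)" using gi' by auto
      have "sqrt (1 + (g x)\<^sup>2) \<le> 1 + \<bar>g x\<bar>" for x
        by (rule real_le_lsqrt) (auto simp: power2_sum)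
      then show "AE x in lebesgue_on \<Omega>. norm (sqrt (1 + (g x)\<^sup>2)) \<le> norm (1 + \<bar>g x\<bar>)" by auto
    qed measurable
    then show ?thesis using integrable_lebesgue_on_iff[OF \<Omega>] by blast
  qed
  have i2: "set_integrable lebesgue \<Omega> (\<lambda>x. sqrt (1 - \<bar>T x\<bar>\<^sup>2))"
  proof -
    have "integrable (lebesgue_on \<Omega>) (\<lambda>x. sqrt (1 - \<bar>T x\<bar>\<^sup>2))"
    proof (rule L.integrable_const_bound[of _ 1])
      show "AE x in lebesgue_on \<Omega>. norm (sqrt (1 - \<bar>T x\<bar>\<^sup>2)) \<le> 1"
        unfolding AE_lebesgue_on_iff[OF \<Omega>] using AE_T
      proof eventually_elim
        case (elim x)
        show ?case
        proof
          assume "x \<in> \<Omega>"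
          then have "(T x)\<^sup>2 \<le> 1" using elim by (simp add: abs_square_le_1)
          moreover have "0 \<le> (T x)\<^sup>2" by simp
          ultimately show "norm (sqrt (1 - \<bar>T x\<bar>\<^sup>2)) \<le> 1" by simp
        qed
      qed
    qed (use Tm in measurable)
    then show ?thesis using integrable_lebesgue_on_iff[OF \<Omega>] by blast
  qed
  have i3: "set_integrable lebesgue \<Omega> (\<lambda>x. V x * g x)"
  proof -
    have "V \<in> borel_measurable lebesgue" by (rule measurable_completion) simp
    then have "set_integrable lebesgue \<Omega> (\<lambda>x. g x * V x)"
      by (rule set_integrable_mult_bounded[OF gi _ VB])
    then show ?thesis by (simp only: mult.commute)
  qed
  \<comment> \<open>Off \<open>N\<close> the singular part is absent, so the equation compares
    absolutely continuous measures on every Borel set and their densities agree almost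
    everywhere.\<close>
  have AEh: "AE x in lebesgue. x \<in> \<Omega> - N \<longrightarrow> V x * g x - (sqrt (1 + (g x)\<^sup>2) - sqrt (1 - \<bar>T x\<bar>\<^sup>2)) = 0"
  proof (rule AE_zero_of_set_integrals)
    show "set_integrable lebesgue (\<Omega> - N) (\<lambda>x. V x * g x - (sqrt (1 + (g x)\<^sup>2) - sqrt (1 - \<bar>T x\<bar>\<^sup>2)))"
      by (rule set_integrable_subset[OF set_integral_diff(1)[OF i3 set_integral_diff(1)[OF i1 i2]]]) auto
    fix A assume "A \<in> borel_subsets (\<Omega> - N)"
    then have A: "A \<in> borel_subsets \<Omega>" "A \<in> sets borel" and AN: "A \<inter> N = {}" by (auto simp: borel_subsets_iff)
    have \<sigma>0: "\<sigma> B = 0" if B: "B \<in> borel_subsets \<Omega>" "B \<subseteq> A" for B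
    proof -
      have "B \<inter> N = {}" using AN B(2) by blast
      then show ?thesis using \<sigma>N[OF B(1)] signed_measure_empty[OF \<sigma>] by simp
    qed
    have "signed_integral \<Omega> \<nu> A V = (LINT x:A|lebesgue. V x * g x)"
      by (rule signed_integral_density[OF \<Omega> \<nu> gi A(1) _ Vm VB]) (simp add: \<nu>A \<sigma>0)
    moreover have "total_variation \<Omega> \<sigma> A = 0" by (rule total_variation_eq_zero[OF \<Omega> \<sigma> A(1) \<sigma>0])
    moreover have s: "set_integrable lebesgue A f" if "set_integrable lebesgue \<Omega> f" for f :: "real \<Rightarrow> real"
      by (rule set_integrable_subset[OF that]) (use A in \<open>auto simp: borel_subsets_iff\<close>)
    ultimately show "(LINT x:A|lebesgue. V x * g x - (sqrt (1 + (g x)\<^sup>2) - sqrt (1 - \<bar>T x\<bar>\<^sup>2))) = 0"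
      using eqA[OF A(1)] set_integral_diff(2)[OF s[OF i3] set_integral_diff(1)[OF s[OF i1] s[OF i2]]]
        set_integral_diff(2)[OF s[OF i1] s[OF i2]] by simp
  qed measurable
  have AEg: "AE x in lebesgue. x \<in> \<Omega> \<longrightarrow> \<bar>Tr x\<bar> < 1 \<and> g x = slope (Tr x)"
    using AEh AE_T AE_completion[OF AE_not_in[OF N(2)]] AE_cdf_eq_measure_lessThan[OF K(1)] AE_cdf_eq_measure_lessThan[OF K(2)]
  proof eventually_elim
    case (elim x)
    show ?case
    proof
      assume x: "x \<in> \<Omega>"
      \<comment> \<open>At a point carrying no atom the convex combination collapses, whatever its
        weight.\<close>
      have "Tl x = Tr x" using elim(4,5) by (simp add: Tl_def Tr_def)
      then have "V x = Tr x" by (simp add: V' algebra_simps)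
      then have "Tr x * g x + sqrt (1 - (Tr x)\<^sup>2) = sqrt (1 + (g x)\<^sup>2)" using x elim(1-3) by simp
      then show "\<bar>Tr x\<bar> < 1 \<and> g x = slope (Tr x)"
        using unit_vector_equality[of "Tr x" "g x"] x elim(2) by (simp add: slope_def)
    qed
  qed
  then have AET: "AE x in lebesgue_on {a<..<b}. \<bar>Tr x\<bar> < 1"
    unfolding AE_lebesgue_on_iff[OF \<Omega>[unfolded \<Omega>_def]] \<Omega>_def by eventually_elim auto
  \<comment> \<open>Both bounds pass to the left limit from the monotonicity of
    \<open>Tr\<close>.\<close>
  have Tl_bounds: "Tl x \<le> Tr x" "\<And>y. a < y \<Longrightarrow> y < x \<Longrightarrow> Tr y \<le> Tl x" if x: "a < x" "x < b" for x
  proof -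
    have lim: "(Tr \<longlongrightarrow> Tl x) (at_left x)"
      unfolding Tr_def Tl_def by (intro tendsto_intros tendsto_cdf_at_left[OF K(1)] tendsto_cdf_at_left[OF K(2)])
    show "Tl x \<le> Tr x"
      by (rule tendsto_upperbound[OF lim]) (use x Tr_mono in \<open>auto intro!: eventually_at_leftI[of a]\<close>)
    show "Tr y \<le> Tl x" if "a < y" "y < x" for y
      by (rule tendsto_lowerbound[OF lim]) (use x that Tr_mono in \<open>auto intro!: eventually_at_leftI[of y]\<close>)
  qed
  \<comment> \<open>From almost everywhere to everywhere: a good point to the right of
    \<open>x\<close> bounds \<open>Tr x\<close> from above, a good point to the left bounds
    \<open>Tl x\<close> from below.\<close>
  have bounds: "- 1 < Tl x" "Tl x \<le> Tr x" "Tr x < 1" if "x \<in> \<Omega>" for x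
  proof -
    have x: "a < x" "x < b" using that by (auto simp: \<Omega>_def)
    obtain y where y: "x < y" "y < b" "\<bar>Tr y\<bar> < 1"
      using AE_lebesgue_on_obtain[OF AET, of x b] x by auto
    then show "Tr x < 1" using Tr_mono[of x y] x by auto
    obtain z where z: "a < z" "z < x" "\<bar>Tr z\<bar> < 1"
      using AE_lebesgue_on_obtain[OF AET, of a x] x by auto
    then show "- 1 < Tl x" using Tl_bounds(2)[OF x z(1,2)] by auto
    show "Tl x \<le> Tr x" by (rule Tl_bounds(1)[OF x])
  qed
  have V1: "\<bar>V x\<bar> < 1" if "x \<in> \<Omega>" for x
  proof -
    note B = bounds[OF that]
    have "V x \<le> Tr x" unfolding V' by (rule convex_bound_le) (use B k in auto)
    moreover have "- V x \<le> - Tl x"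
      using convex_bound_le[of "- Tr x" "- Tl x" "- Tl x" "k x" "1 - k x"] B k by (simp add: V')
    ultimately show ?thesis using B by auto
  qed
  have null: "(LINT x:A|lebesgue. f x) = 0" if "A \<in> borel_subsets \<Omega>" "A \<subseteq> N" for A and f :: "real \<Rightarrow> real"
  proof -
    have "A \<in> null_sets lborel" by (rule null_sets_subset[OF N(2)]) (use that in \<open>auto simp: borel_subsets_iff\<close>)
    then show ?thesis by (intro set_integral_null_set null_sets_completionI)
  qed
  \<comment> \<open>On the null set \<open>N\<close> the Lebesgue integrals disappear and
    \<open>\<nu>\<close> coincides with \<open>\<sigma>\<close>; what is left of the equation is
    that \<open>V\<close> integrates against \<open>\<sigma>\<close> to its total variation.\<close>
  have "\<sigma> A = 0" for A
  proof (rule singular_eq_zero[OF \<Omega> \<sigma> N(1) \<sigma>N Vm VB])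
    show "\<bar>V x\<bar> < 1" if "x \<in> N" for x using V1 that N(1) by (auto simp: borel_subsets_iff)
    obtain S1 S2 where rs: "represents \<Omega> \<sigma> S1 S2" using ex_represents[OF \<Omega> \<sigma>] by blast
    have "signed_integral \<Omega> \<sigma> N V = (LINT x:N|S1. V x) - (LINT x:N|S2. V x)"
      by (rule signed_integral_represents[OF \<Omega> \<sigma> rs N(1) Vm VB])
    also have "\<dots> = (LINT x:N|M1. V x) - (LINT x:N|M2. V x)"
      by (rule signed_integral_local[OF rs r N(1) _ Vm VB]) (simp add: \<nu>A null)
    also have "\<dots> = signed_integral \<Omega> \<nu> N V"
      by (rule signed_integral_represents[OF \<Omega> \<nu> r N(1) Vm VB, symmetric])
    also have "\<dots> = total_variation \<Omega> \<sigma> N" using eqA[OF N(1)] null[OF N(1)] by simp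
    finally show "signed_integral \<Omega> \<sigma> N V = total_variation \<Omega> \<sigma> N" .
  qed
  then have \<nu>g: "\<nu> A = (LINT x:A|lebesgue. g x)" if "A \<in> borel_subsets \<Omega>" for A using \<nu>A[OF that] by simp
  define s where "s x = slope (Tr x)" for x
  have sm [measurable]: "s \<in> borel_measurable borel" unfolding s_def by measurable
  have si: "set_integrable lborel \<Omega> s"
  proof -
    have "integrable lebesgue (\<lambda>x. indicator \<Omega> x *\<^sub>R s x)"
    proof (rule integrable_cong_AE_imp[OF gi[unfolded set_integrable_def]])
      show "(\<lambda>x. indicator \<Omega> x *\<^sub>R s x) \<in> borel_measurable lebesgue" by (rule measurable_completion) measurable
      show "AE x in lebesgue. indicator \<Omega> x *\<^sub>R g x = indicator \<Omega> x *\<^sub>R s x"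
        using AEg by eventually_elim (auto simp: indicator_def s_def)
    qed
    then show ?thesis by (simp add: set_integrable_def integrable_completion)
  qed
  have \<nu>s: "\<nu> A = (LINT x:A|lborel. s x)" if A: "A \<in> borel_subsets \<Omega>" for A
  proof -
    have [measurable]: "A \<in> sets borel" using A by (simp add: borel_subsets_iff)
    have "(LINT x:A|lebesgue. g x) = (LINT x:A|lebesgue. s x)"
      unfolding set_lebesgue_integral_def
    proof (rule integral_cong_AE)
      have "set_integrable lebesgue A g"
        by (rule set_integrable_subset[OF gi]) (use A in \<open>auto simp: borel_subsets_iff\<close>)
      then show "(\<lambda>x. indicator A x *\<^sub>R g x) \<in> borel_measurable lebesgue" by (simp add: set_integrable_def)
      show "(\<lambda>x. indicator A x *\<^sub>R s x) \<in> borel_measurable lebesgue" by (rule measurable_completion) measurable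
      show "AE x in lebesgue. indicator A x *\<^sub>R g x = indicator A x *\<^sub>R s x"
        using AEg by eventually_elim (use A in \<open>auto simp: indicator_def s_def borel_subsets_iff\<close>)
    qed
    then show ?thesis using \<nu>g[OF A] set_integral_lebesgue[of A s] by simp
  qed
  have ux: "AE x in lebesgue_on \<Omega>. u x = d + (LINT t:{a<..x}|lborel. s t)"
  proof -
    have "d + cdf M1 x - cdf M2 x = d + (LINT t:{a<..x}|lborel. s t)" if x: "x \<in> \<Omega>" for x
    proof -
      have "{a<..x} \<in> borel_subsets \<Omega>" using x by (auto simp: borel_subsets_iff \<Omega>_def)
      from \<nu>s[OF this] show ?thesis using represents_cdf[OF r[unfolded \<Omega>_def] x[unfolded \<Omega>_def]] by simp
    qed
    then show ?thesis using d unfolding AE_lebesgue_on_iff[OF \<Omega>] by (rule_tac eventually_mono) auto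
  qed
  \<comment> \<open>The distribution functions vanish at \<open>a\<close>, so the additive constant
    of \<open>u\<close> is its boundary value.\<close>
  have ra: "right_limit u a = d"
    using right_limit_cdf[OF r[unfolded \<Omega>_def] d[unfolded \<Omega>_def], of a] ab M[unfolded \<Omega>_def] by (simp add: cdf_start)
  have lb: "left_limit u b = d + (LINT t:\<Omega>|lborel. s t)"
  proof -
    have *: "measure M {..<b} = measure M \<Omega>" if "finite_borel_on \<Omega> M" for M
    proof -
      have "{..<b} \<inter> \<Omega> = \<Omega>" by (auto simp: \<Omega>_def)
      then show ?thesis using measure_null_subset[OF that \<Omega>, of "{..<b}"] by simp
    qed
    have \<Omega>\<Omega>: "\<Omega> \<in> borel_subsets \<Omega>" by (simp add: borel_subsets_iff)
    have "left_limit u b = d + measure M1 {..<b} - measure M2 {..<b}"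
      by (rule left_limit_cdf[OF r[unfolded \<Omega>_def] d[unfolded \<Omega>_def]]) (use ab in auto)
    then show ?thesis using \<nu>s[OF \<Omega>\<Omega>] represents_eq[OF r \<Omega>\<Omega>] *[OF M(1)] *[OF M(2)] by simp
  qed
  have "\<bar>Tr x\<bar> < 1" if "x \<in> \<Omega>" for x using bounds[OF that] by auto
  then show ?thesis
    by (intro exI[of _ c] exI[of _ d]) (use si ux ra lb in \<open>simp add: s_def[abs_def] Tr_def[abs_def]\<close>)
qed

section \<open>Convexity and uniqueness\<close>

text \<open>The supporting line at the convex combination \<open>m\<close> is affine, so
  \<open>v m\<close> is the weighted mean of its values at \<open>x\<close> and \<open>y\<close>,
  which lie below those of \<open>v\<close>.\<close>

lemma convex_on_supporting_lines:
  assumes sup: "\<And>y z. y \<in> {a<..<b} \<Longrightarrow> z \<in> {a<..<b} \<Longrightarrow> v y + k y * (z - y) \<le> (v z :: real)"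
  shows "convex_on {a<..<b} v"
  unfolding convex_on_def
proof (intro conjI ballI allI impI)
  show C: "convex {a<..<b}" by simp
  fix x y s t :: real
  assume xy: "x \<in> {a<..<b}" "y \<in> {a<..<b}" and st: "0 \<le> s" "0 \<le> t" "s + t = 1"
  define m where "m = s *\<^sub>R x + t *\<^sub>R y"
  have m: "m \<in> {a<..<b}" unfolding m_def by (rule convexD[OF C xy st])
  have hm: "s * x + t * y = m" by (simp add: m_def)
  have "s * (v m + k m * (x - m)) + t * (v m + k m * (y - m)) =
      (s + t) * v m + k m * (s * x + t * y - (s + t) * m)"
    by (simp add: algebra_simps)
  also have "\<dots> = v m" by (simp only: st(3) hm) simp
  finally have "v m = s * (v m + k m * (x - m)) + t * (v m + k m * (y - m))" ..
  also have "\<dots> \<le> s * v x + t * v y"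
    using sup[OF m xy(1)] sup[OF m xy(2)] st by (intro add_mono mult_left_mono) auto
  finally show "v (s *\<^sub>R x + t *\<^sub>R y) \<le> s * v x + t * v y" by (simp only: m_def)
qed

text \<open>Supporting lines at \<open>y\<close> and at \<open>z\<close> trap
  \<open>v z - v y\<close> between \<open>k y * (z - y)\<close> and \<open>k z * (z - y)\<close>,
  and a monotone \<open>k\<close> is bounded on a closed ball by its values at the two ends.\<close>

lemma locally_lipschitz_supporting_lines:
  assumes sup: "\<And>y z. y \<in> {a<..<b} \<Longrightarrow> z \<in> {a<..<b} \<Longrightarrow> v y + k y * (z - y) \<le> (v z :: real)"
    and mono: "\<And>y z. y \<in> {a<..<b} \<Longrightarrow> z \<in> {a<..<b} \<Longrightarrow> y \<le> z \<Longrightarrow> k y \<le> k z"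
  shows "locally_lipschitz {a<..<b} v"
  unfolding locally_lipschitz_def
proof
  fix x assume x: "x \<in> {a<..<b}"
  \<comment> \<open>Half the distance to the boundary, so that the closed ball, including its end
    points, stays inside the interval.\<close>
  define e where "e = min (x - a) (b - x) / 2"
  have e: "0 < e" "a < x - e" "x + e < b" using x by (auto simp: e_def min_def field_simps)
  define L where "L = max \<bar>k (x - e)\<bar> \<bar>k (x + e)\<bar>"
  have kL: "\<bar>k y\<bar> \<le> L" if y: "x - e \<le> y" "y \<le> x + e" for y
    using mono[of "x - e" y] mono[of y "x + e"] y e unfolding L_def by auto
  have "L-lipschitz_on (cball x e \<inter> {a<..<b}) v"
  proof (rule lipschitz_onI)
    fix y z assume "y \<in> cball x e \<inter> {a<..<b}" "z \<in> cball x e \<inter> {a<..<b}"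
    then have y: "x - e \<le> y" "y \<le> x + e" "y \<in> {a<..<b}" and z: "x - e \<le> z" "z \<le> x + e" "z \<in> {a<..<b}"
      by (auto simp: dist_real_def)
    have ab: "\<bar>k w * (z - y)\<bar> \<le> L * \<bar>z - y\<bar>" if "\<bar>k w\<bar> \<le> L" for w
      using that by (simp add: abs_mult mult_right_mono)
    have "k y * (z - y) \<le> v z - v y" using sup[OF y(3) z(3)] by simp
    moreover have "v z - v y \<le> k z * (z - y)" using sup[OF z(3) y(3)] by (simp add: algebra_simps)
    ultimately have "\<bar>v y - v z\<bar> \<le> L * \<bar>z - y\<bar>"
      using ab[OF kL[OF y(1,2)]] ab[OF kL[OF z(1,2)]] by linarith
    then show "dist (v y) (v z) \<le> L * dist y z" by (simp add: dist_real_def abs_minus_commute)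
  qed (simp add: L_def)
  then show "\<exists>e>0. \<exists>L. L-lipschitz_on (cball x e \<inter> {a<..<b}) v" using e(1) by blast
qed

text \<open>The value \<open>s y\<close> is a subgradient: between \<open>y\<close> and
  \<open>z\<close> a monotone integrand stays on one side of \<open>s y\<close>, and for
  \<open>z < y\<close> the orientation of the integral and the inequality reverse together.\<close>

lemma primitive_supporting_line:
  assumes s: "set_integrable lborel {a<..<b} s"
    and mono: "\<And>y z. y \<in> {a<..<b} \<Longrightarrow> z \<in> {a<..<b} \<Longrightarrow> y \<le> z \<Longrightarrow> s y \<le> (s z :: real)"
    and y: "y \<in> {a<..<b}" and z: "z \<in> {a<..<b}"
  shows "(LINT t:{a<..y}|lborel. s t) + s y * (z - y) \<le> (LINT t:{a<..z}|lborel. s t)"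
proof -
  have i: "set_integrable lborel {p<..q} s" if "a \<le> p" "q < b" for p q
    by (rule set_integrable_subset[OF s]) (use that in auto)
  have c: "(LINT t:{p<..q}|lborel. w) = w * (q - p)" "set_integrable lborel {p<..q} (\<lambda>t. w)"
    if "p \<le> q" for p q w :: real
    using that by (simp_all add: set_lebesgue_integral_def set_integrable_def)
  have split: "(LINT t:{a<..q}|lborel. s t) = (LINT t:{a<..p}|lborel. s t) + (LINT t:{p<..q}|lborel. s t)"
    if pq: "a < p" "p \<le> q" "q < b" for p q
  proof -
    have "{a<..q} = {a<..p} \<union> {p<..q}" using pq by auto
    then show ?thesis using set_integral_Un[of "{a<..p}" "{p<..q}" lborel s] i[of a p] i[of p q] pq by auto
  qed
  show ?thesis
  proof (cases "y \<le> z")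
    case True
    have "(LINT t:{y<..z}|lborel. s y) \<le> (LINT t:{y<..z}|lborel. s t)"
      by (rule set_integral_mono[OF c(2)[OF True] i]) (use y z mono in auto)
    then show ?thesis using split[of y z] c(1)[OF True, of "s y"] y z True by simp
  next
    case False
    then have zy: "z \<le> y" by simp
    have "(LINT t:{z<..y}|lborel. s t) \<le> (LINT t:{z<..y}|lborel. s y)"
      by (rule set_integral_mono[OF i c(2)[OF zy]]) (use y z mono in auto)
    then show ?thesis using split[of z y] c(1)[OF zy, of "s y"] y z zy by (simp add: algebra_simps)
  qed
qed

text \<open>A strictly positive difference with zero integral would make the interval a null
  set.\<close>

lemma set_integral_Ioo_strict_mono:
  fixes a b :: real
  assumes "a < b" and f: "set_integrable lborel {a<..<b} f" and g: "set_integrable lborel {a<..<b} g"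
    and less: "\<And>x. x \<in> {a<..<b} \<Longrightarrow> f x < (g x :: real)"
  shows "(LINT x:{a<..<b}|lborel. f x) \<noteq> (LINT x:{a<..<b}|lborel. g x)"
proof
  assume eq: "(LINT x:{a<..<b}|lborel. f x) = (LINT x:{a<..<b}|lborel. g x)"
  define h where "h x = indicator {a<..<b} x * (g x - f x)" for x
  have "{a<..<b} \<in> null_sets lborel"
  proof (rule null_if_pos_func_has_zero_int[of lborel h])
    show "integrable lborel h"
      using set_integral_diff(1)[OF g f] by (simp add: set_integrable_def h_def[abs_def])
    show "AE x\<in>{a<..<b} in lborel. 0 < h x" using less by (auto simp: h_def)
    have "(LINT x:{a<..<b}|lborel. h x) = (LINT x:{a<..<b}|lborel. g x - f x)"
      by (rule set_lebesgue_integral_cong) (auto simp: h_def)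
    also have "\<dots> = 0" using set_integral_diff(2)[OF g f] eq by simp
    finally show "(LINT x:{a<..<b}|lborel. h x) = 0" .
  qed simp
  then show False using \<open>a < b\<close> by (simp add: null_sets_def)
qed

theorem theorem9p1:
  fixes a b :: real and \<Omega> :: "real set" and \<mu> :: "real set \<Rightarrow> real"
  assumes "a < b" and "\<Omega> = {a<..<b}"
    and "signed_measure \<Omega> \<mu>"
    and "\<forall>A\<in>borel_subsets \<Omega>. 0 \<le> \<mu> A"
    and "\<forall>E\<in>sets lebesgue. E \<subseteq> \<Omega> \<longrightarrow> ereal \<bar>\<mu> (density_one E \<inter> \<Omega>)\<bar> \<le> perimeter E"
  shows "(\<forall>u T. u \<in> BV \<Omega> \<longrightarrow> T \<in> DM_inf \<Omega> \<longrightarrow> Linf_norm \<Omega> T \<le> 1 \<longrightarrow>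
            has_distr_deriv \<Omega> T \<mu> \<longrightarrow> pairing_equation \<Omega> T u (hahn_lambda \<Omega> \<mu>) \<longrightarrow>
            (\<exists>v. (AE x in lebesgue_on \<Omega>. v x = u x) \<and> convex_on \<Omega> v \<and> locally_lipschitz \<Omega> v)) \<and>
         (\<forall>u1 u2. weak_solution \<Omega> \<mu> u1 \<longrightarrow> weak_solution \<Omega> \<mu> u2 \<longrightarrow>
            right_limit u1 a = right_limit u2 a \<longrightarrow> left_limit u1 b = left_limit u2 b \<longrightarrow>
            (AE x in lebesgue_on \<Omega>. u1 x = u2 x))"
proof -
  note ab = assms(1) and \<Omega> = assms(2)
  note \<mu> = assms(3)[unfolded \<Omega>] and nn = assms(4)[unfolded \<Omega>]
  \<comment> \<open>Fixed once for all solutions, so that any two fields for \<open>\<mu>\<close>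
    differ by a constant through the form of \<open>Tr\<close> alone.\<close>
  obtain K1 K2 where q: "represents {a<..<b} \<mu> K1 K2" using ex_represents[OF _ \<mu>] by auto
  define Tr where "Tr c x = c + cdf K1 x - cdf K2 x" for c x
  define s where "s c x = slope (Tr c x)" for c x
  note struct = solution_structure[OF ab \<mu> nn q, folded Tr_def, folded s_def]
  have s_mono: "s c y \<le> s c z" if "\<forall>x\<in>{a<..<b}. \<bar>Tr c x\<bar> < 1" "y \<in> {a<..<b}" "z \<in> {a<..<b}" "y \<le> z" for c y z
    unfolding s_def using that cdf_diff_mono[OF q \<mu> nn, of y z] by (intro slope_mono) (auto simp: Tr_def)
  have part1: "\<exists>v. (AE x in lebesgue_on \<Omega>. v x = u x) \<and> convex_on \<Omega> v \<and> locally_lipschitz \<Omega> v"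
    if u: "u \<in> BV \<Omega>" and T: "T \<in> DM_inf \<Omega>" "Linf_norm \<Omega> T \<le> 1" "has_distr_deriv \<Omega> T \<mu>"
      and pe: "pairing_equation \<Omega> T u (hahn_lambda \<Omega> \<mu>)" for u T
  proof -
    \<comment> \<open>For nonnegative \<open>\<mu>\<close> the convention in
      \<open>hahn_lambda\<close> selects \<lambda> identically zero.\<close>
    have hl: "hahn_lambda \<Omega> \<mu> = (\<lambda>x. 0)" using assms(4) by (simp add: hahn_lambda_def)
    have Tm: "T \<in> borel_measurable (lebesgue_on \<Omega>)" using T(1) by (simp add: DM_inf_def Linf_def)
    obtain c d where cd: "\<forall>x\<in>{a<..<b}. \<bar>Tr c x\<bar> < 1" "set_integrable lborel {a<..<b} (s c)"
      "AE x in lebesgue_on {a<..<b}. u x = d + (LINT t:{a<..x}|lborel. s c t)"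
      using struct[of T u "\<lambda>x. 0"] T(2,3) Tm u pe hl unfolding \<Omega> by auto
    define v where "v x = d + (LINT t:{a<..x}|lborel. s c t)" for x
    have sup: "v y + s c y * (z - y) \<le> v z" if "y \<in> {a<..<b}" "z \<in> {a<..<b}" for y z
      using primitive_supporting_line[OF cd(2) s_mono[OF cd(1)] that] by (simp add: v_def)
    have "AE x in lebesgue_on {a<..<b}. v x = u x" using cd(3) by (rule eventually_mono) (simp add: v_def)
    moreover have "convex_on {a<..<b} v" by (rule convex_on_supporting_lines[OF sup])
    moreover have "locally_lipschitz {a<..<b} v"
      by (rule locally_lipschitz_supporting_lines[OF sup s_mono[OF cd(1)]])
    ultimately show ?thesis unfolding \<Omega> by blast
  qed
  have sol: "\<exists>c d. (\<forall>x\<in>{a<..<b}. \<bar>Tr c x\<bar> < 1) \<and> set_integrable lborel {a<..<b} (s c) \<and>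
      (AE x in lebesgue_on {a<..<b}. u x = d + (LINT t:{a<..x}|lborel. s c t)) \<and>
      right_limit u a = d \<and> left_limit u b = d + (LINT t:{a<..<b}|lborel. s c t)"
    if u: "weak_solution \<Omega> \<mu> u" for u
  proof -
    obtain T lam where T: "T \<in> Linf \<Omega>" "Linf_norm \<Omega> T \<le> 1" "has_distr_deriv \<Omega> T \<mu>"
      and lam: "lam \<in> borel_measurable (restrict_space borel \<Omega>)" "\<forall>x\<in>\<Omega>. 0 \<le> lam x \<and> lam x \<le> 1"
      and pe: "pairing_equation \<Omega> T u lam"
      using u unfolding weak_solution_def by blast
    show ?thesis
      using struct[of T u lam] T lam pe u unfolding \<Omega> by (simp add: Linf_def weak_solution_def)
  qed
  have part2: "AE x in lebesgue_on \<Omega>. u1 x = u2 x"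
    if w: "weak_solution \<Omega> \<mu> u1" "weak_solution \<Omega> \<mu> u2"
      and lim: "right_limit u1 a = right_limit u2 a" "left_limit u1 b = left_limit u2 b" for u1 u2
  proof -
    obtain c1 d1 where 1: "\<forall>x\<in>{a<..<b}. \<bar>Tr c1 x\<bar> < 1" "set_integrable lborel {a<..<b} (s c1)"
      "AE x in lebesgue_on {a<..<b}. u1 x = d1 + (LINT t:{a<..x}|lborel. s c1 t)"
      "right_limit u1 a = d1" "left_limit u1 b = d1 + (LINT t:{a<..<b}|lborel. s c1 t)"
      using sol[OF w(1)] by blast
    obtain c2 d2 where 2: "\<forall>x\<in>{a<..<b}. \<bar>Tr c2 x\<bar> < 1" "set_integrable lborel {a<..<b} (s c2)"
      "AE x in lebesgue_on {a<..<b}. u2 x = d2 + (LINT t:{a<..x}|lborel. s c2 t)"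
      "right_limit u2 a = d2" "left_limit u2 b = d2 + (LINT t:{a<..<b}|lborel. s c2 t)"
      using sol[OF w(2)] by blast
    have d: "d1 = d2" using lim(1) 1(4) 2(4) by simp
    have eq: "(LINT t:{a<..<b}|lborel. s c1 t) = (LINT t:{a<..<b}|lborel. s c2 t)"
      using lim(2) 1(5) 2(5) d by simp
    \<comment> \<open>A larger constant in the field gives a strictly larger slope at every point,
      hence a different total increment of \<open>u\<close> over the interval; equal boundary values
      exclude this.\<close>
    have less: "s c x < s c' x" if "\<bar>Tr c x\<bar> < 1" "\<bar>Tr c' x\<bar> < 1" "c < c'" for c c' x
      unfolding s_def by (rule slope_strict_mono) (use that in \<open>auto simp: Tr_def\<close>)
    have "\<not> c1 < c2"
      using set_integral_Ioo_strict_mono[OF ab 1(2) 2(2)] less 1(1) 2(1) eq by blast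
    moreover have "\<not> c2 < c1"
      using set_integral_Ioo_strict_mono[OF ab 2(2) 1(2)] less 1(1) 2(1) eq by metis
    ultimately have "c1 = c2" by simp
    with 1(3) 2(3) d show ?thesis unfolding \<Omega> by (auto elim: eventually_elim2)
  qed
  show ?thesis using part1 part2 by blast
qed

end
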